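(* Let $p_t^{(1)},p_t^{(2)}$ be the marginal densities of two (perfect) diffusion models with the same forward SDE coefficients, $\mathrm{d}X_t=f_t(X_t)\mathrm{d}t+\sigma_t\overrightarrow{\mathrm{d}W_t}$ (and different initial laws). Let $\beta>0$, $c\in[0,1/2]$, $\eta=\beta+(1-\beta)c$, $\zeta=\sqrt{1+(1-\beta)2c/\beta}$. In the product weight $w_{[\tau,\tau']}=[R^{\nu^{(1)}}_{\mu^{(1)}}(X_{[\tau,\tau']})]^\beta[R^{\nu^{(2)}}_{\mu^{(2)}}(X_{[\tau,\tau']})]^\beta[R^a_b(X_{[\tau,\tau']})]^{-1}$ (for targets $q_t\propto(p_t^{(1)}p_t^{(2)})^\beta$) choose $$a_t=f_t-\eta\sigma_t^2(\nabla\log p_t^{(1)}+\nabla\log p_t^{(2)}),\quad b_t=f_t-(\eta\sigma_t^2-\epsilon_t^2\beta)(\nabla\log p_t^{(1)}+\nabla\log p_t^{(2)}),\quad\epsilon_t=\zeta\sigma_t.$$ Then this is equivalent to the product Feynman–Kac corrector: the sampling process is the backward SDE $$\mathrm{d}X_t=\big(f_t(X_t)-\eta\sigma_t^2\nabla\log p_t^{(1)}(X_t)-\eta\sigma_t^2\nabla\log p_t^{(2)}(X_t)\big)\mathrm{d}t+\zeta\sigma_t\overleftarrow{\mathrm{d}W_t},$$ and along it $w_t:=w_{[t,\tau']}(X_{[t,\tau']})$ satisfies the backward ODE $$\mathrm{d}\log w_t=-\Big((2\beta-1)\nabla\cdot f_t(X_t)+\sigma_t^2\beta\,\nabla\log p_t^{(1)}(X_t)\cdot\nabla\log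 p_t^{(2)}(X_t)+\frac{\sigma_t^2}{2}\beta(\beta-1)\|\nabla\log p_t^{(1)}(X_t)+\nabla\log p_t^{(2)}(X_t)\|^2\Big)\mathrm{d}t.$$
   Context: Notation. $\overrightarrow{\mathrm{d}\cdot}$: forward It\^o SDE/integral (left-endpoint evaluation). $\overleftarrow{\mathrm{d}\cdot}$: backward SDE/integral, run from the later time $\tau'$ downwards (right-endpoint evaluation). The ODE for $\log w_t$ is in the variable $t$, solved backwards from $\log w_{\tau'}=0$, i.e. $\log w_\tau=-\int_\tau^{\tau'}(\cdots)\mathrm{d}t$ with $(\cdots)$ the right-hand side coefficient. Time-reversal pairs with marginals $p_t^{(i)}$ and diffusion coefficient $\epsilon_t$: $\mu^{(i)}_t=f_t+\frac{\epsilon_t^2-\sigma_t^2}{2}\nabla\log p^{(i)}_t$ (forward), $\nu^{(i)}_t=f_t-\frac{\epsilon_t^2+\sigma_t^2}{2}\nabla\log p^{(i)}_t$ (backward), $i=1,2$. For a forward drift $\mu$ and backward drift $\nu$ with diffusion coefficient $\epsilon_t$: $$R^\nu_\mu(X_{[\tau,\tau']})=\exp\Big(\int_\tau^{\tau'}\tfrac1{\epsilon_t^2}\nu_t\cdot\overleftarrow{\mathrm{d}X_t}-\int_\tau^{\tau'}\tfrac1{\epsilon_t^2}\mu_t\cdot\overrightarrow{\mathrm{d}X_t}+\tfrac12\int_\tau^{\tau'}\tfrac1{\epsilon_t^2}(\|\mu_t\|^2-\|\nu_t\|^2)\mathrm{d}t\Big),$$ drifts evaluated along $X_t$; $R^a_b$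 is the same with backward drift $a$ and forward drift $b$. The weight $w_{[\tau,\tau']}$ equals, up to a path-independent constant, $\mathrm{d}\overrightarrow{\mathbb Q}^b/\mathrm{d}\overleftarrow{\mathbb Q}^a$, where $\overleftarrow{\mathbb Q}^a$ is the law of the backward SDE with drift $a$ started from $q_{\tau'}$ and $\overrightarrow{\mathbb Q}^b$ the law of the forward SDE with drift $b$ started from $q_\tau$. $f_t$, $\log p^{(i)}_t$ and $\sigma_t>0$ are assumed sufficiently smooth. *)

theory Defs
  imports "HOL-Probability.Probability"
begin

section \<open>Spatial derivatives and smoothness\<close>

definition grad :: "('a::real_inner \<Rightarrow> real) \<Rightarrow> 'a \<Rightarrow> 'a" where
  "grad g x = (THE D. GDERIV g x :> D)"

definition divergence :: "('a::euclidean_space \<Rightarrow> 'a) \<Rightarrow> 'a \<Rightarrow> real" where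
  "divergence g x = (\<Sum>b\<in>Basis. frechet_derivative g (at x) b \<bullet> b)"

definition C1_on :: "'a::real_normed_vector set \<Rightarrow> ('a \<Rightarrow> 'b::real_normed_vector) \<Rightarrow> bool" where
  "C1_on S g \<longleftrightarrow>
     (\<exists>D. continuous_on S D \<and>
          (\<forall>z\<in>S. (g has_derivative blinfun_apply (D z)) (at z within S)))"

section \<open>Forward and backward stochastic integrals\<close>

definition fine_partition :: "real \<Rightarrow> real \<Rightarrow> real \<Rightarrow> nat \<Rightarrow> (nat \<Rightarrow> real) \<Rightarrow> bool" where
  "fine_partition d s t n u \<longleftrightarrow>
     u 0 = s \<and> u n = t \<and> (\<forall>k<n. u k \<le> u (Suc k) \<and> u (Suc k) - u k < d)"

text \<open>
  Both integrals are limits in probability, as the mesh tends to zero, of Riemann sums over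
  deterministic partitions, with left-endpoint (forward) or right-endpoint (backward) evaluation
  of the integrand \<open>H\<close>. For path-continuous adapted \<open>H\<close> and path-continuous semimartingales \<open>X\<close>
  (adapted in the matching direction of time) these are the usual Ito integrals. The increments
  of \<open>X\<close> are taken in increasing time in both cases. The product \<open>op\<close> is the inner product
  for \<open>H \<cdot> dX\<close> and scalar multiplication for a noise term with scalar diffusion coefficient.
  Measurability of the sums is required because \<open>measure\<close> vanishes on non-measurable sets.
\<close>

definition left_sum ::
  "('h \<Rightarrow> 'x \<Rightarrow> 'v) \<Rightarrow> (real \<Rightarrow> 'w \<Rightarrow> 'h) \<Rightarrow> (real \<Rightarrow> 'w \<Rightarrow> 'x::real_normed_vector)
     \<Rightarrow> nat \<Rightarrow> (nat \<Rightarrow> real) \<Rightarrow> 'w \<Rightarrow> 'v::real_normed_vector" where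
  "left_sum op H X n u \<omega> = (\<Sum>k<n. op (H (u k) \<omega>) (X (u (Suc k)) \<omega> - X (u k) \<omega>))"

definition right_sum ::
  "('h \<Rightarrow> 'x \<Rightarrow> 'v) \<Rightarrow> (real \<Rightarrow> 'w \<Rightarrow> 'h) \<Rightarrow> (real \<Rightarrow> 'w \<Rightarrow> 'x::real_normed_vector)
     \<Rightarrow> nat \<Rightarrow> (nat \<Rightarrow> real) \<Rightarrow> 'w \<Rightarrow> 'v::real_normed_vector" where
  "right_sum op H X n u \<omega> = (\<Sum>k<n. op (H (u (Suc k)) \<omega>) (X (u (Suc k)) \<omega> - X (u k) \<omega>))"

definition mesh_limit ::
  "'w measure \<Rightarrow> (nat \<Rightarrow> (nat \<Rightarrow> real) \<Rightarrow> 'w \<Rightarrow> 'v::euclidean_space) \<Rightarrow> real \<Rightarrow> real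
     \<Rightarrow> ('w \<Rightarrow> 'v) \<Rightarrow> bool" where
  "mesh_limit M S s t I \<longleftrightarrow>
     I \<in> borel_measurable M \<and>
     (\<forall>e>0. \<exists>d>0. \<forall>n u. fine_partition d s t n u \<longrightarrow>
        S n u \<in> borel_measurable M \<and>
        measure M {\<omega> \<in> space M. norm (S n u \<omega> - I \<omega>) > e} < e)"

definition has_forward_integral where
  "has_forward_integral M op H X s t I \<longleftrightarrow> mesh_limit M (left_sum op H X) s t I"

definition has_backward_integral where
  "has_backward_integral M op H X s t I \<longleftrightarrow> mesh_limit M (right_sum op H X) s t I"

text \<open>The values below are determined only up to almost sure equality.\<close>

definition forward_integral ::
  "'w measure \<Rightarrow> (real \<Rightarrow> 'w \<Rightarrow> 'a::euclidean_space) \<Rightarrow> (real \<Rightarrow> 'w \<Rightarrow> 'a)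
     \<Rightarrow> real \<Rightarrow> real \<Rightarrow> 'w \<Rightarrow> real" where
  "forward_integral M H X s t = (SOME I. has_forward_integral M (\<bullet>) H X s t I)"

definition backward_integral ::
  "'w measure \<Rightarrow> (real \<Rightarrow> 'w \<Rightarrow> 'a::euclidean_space) \<Rightarrow> (real \<Rightarrow> 'w \<Rightarrow> 'a)
     \<Rightarrow> real \<Rightarrow> real \<Rightarrow> 'w \<Rightarrow> real" where
  "backward_integral M H X s t = (SOME I. has_backward_integral M (\<bullet>) H X s t I)"

section \<open>Brownian motion and stochastic differential equations\<close>

definition brownian_motion ::
  "'w measure \<Rightarrow> (real \<Rightarrow> 'w measure) \<Rightarrow> (real \<Rightarrow> 'w \<Rightarrow> 'a::euclidean_space)
     \<Rightarrow> real \<Rightarrow> real \<Rightarrow> bool" where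
  "brownian_motion M F W s t \<longleftrightarrow>
     prob_space M \<and>
     filtration (space M) F \<and> (\<forall>r. subalgebra M (F r)) \<and>
     (\<forall>r\<in>{s..t}. W r \<in> borel_measurable (F r)) \<and>
     (AE \<omega> in M. W s \<omega> = 0) \<and>
     (AE \<omega> in M. continuous_on {s..t} (\<lambda>r. W r \<omega>)) \<and>
     (\<forall>r u. s \<le> r \<longrightarrow> r < u \<longrightarrow> u \<le> t \<longrightarrow>
        distributed M lborel (\<lambda>\<omega>. W u \<omega> - W r \<omega>)
          (\<lambda>x. ennreal (\<Prod>b\<in>Basis. normal_density 0 (sqrt (u - r)) (x \<bullet> b))) \<and>
        prob_space.indep_set M (sets (F r))
          (sets (vimage_algebra (space M) (\<lambda>\<omega>. W u \<omega> - W r \<omega>) borel)))"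

text \<open>
  The reversed process started at the later time \<open>t\<close>; here \<open>G\<close> is a decreasing family of
  \<open>\<sigma>\<close>-algebras, \<open>G r\<close> being the information available when running down from \<open>t\<close> to \<open>r\<close>.
\<close>

definition backward_brownian_motion ::
  "'w measure \<Rightarrow> (real \<Rightarrow> 'w measure) \<Rightarrow> (real \<Rightarrow> 'w \<Rightarrow> 'a::euclidean_space)
     \<Rightarrow> real \<Rightarrow> real \<Rightarrow> bool" where
  "backward_brownian_motion M G W s t \<longleftrightarrow>
     brownian_motion M (\<lambda>r. G (s + t - r)) (\<lambda>r. W (s + t - r)) s t"

definition forward_sde ::
  "'w measure \<Rightarrow> (real \<Rightarrow> 'w measure) \<Rightarrow> (real \<Rightarrow> 'w \<Rightarrow> 'a::euclidean_space)
     \<Rightarrow> (real \<Rightarrow> 'a \<Rightarrow> 'a) \<Rightarrow> (real \<Rightarrow> real) \<Rightarrow> (real \<Rightarrow> 'w \<Rightarrow> 'a) \<Rightarrow> real \<Rightarrow> real \<Rightarrow> bool" where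
  "forward_sde M F W f \<sigma> X s t \<longleftrightarrow>
     brownian_motion M F W s t \<and>
     (\<forall>r\<in>{s..t}. X r \<in> borel_measurable (F r)) \<and>
     (AE \<omega> in M. continuous_on {s..t} (\<lambda>r. X r \<omega>)) \<and>
     (AE \<omega> in M. (\<lambda>r. f r (X r \<omega>)) integrable_on {s..t}) \<and>
     (\<forall>u\<in>{s..t}. has_forward_integral M (*\<^sub>R) (\<lambda>r _. \<sigma> r) W s u
        (\<lambda>\<omega>. X u \<omega> - X s \<omega> - integral {s..u} (\<lambda>r. f r (X r \<omega>))))"

text \<open>
  \<open>dX = a dr + \<epsilon> dW\<close> run downwards from \<open>t\<close>, i.e.
  \<open>X u = X t - \<integral>\<^bsub>u\<^esub>\<^bsup>t\<^esup> a r (X r) dr - \<integral>\<^bsub>u\<^esub>\<^bsup>t\<^esup> \<epsilon> r dW r\<close>.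
\<close>

definition backward_sde ::
  "'w measure \<Rightarrow> (real \<Rightarrow> 'w measure) \<Rightarrow> (real \<Rightarrow> 'w \<Rightarrow> 'a::euclidean_space)
     \<Rightarrow> (real \<Rightarrow> 'a \<Rightarrow> 'a) \<Rightarrow> (real \<Rightarrow> real) \<Rightarrow> (real \<Rightarrow> 'w \<Rightarrow> 'a) \<Rightarrow> real \<Rightarrow> real \<Rightarrow> bool" where
  "backward_sde M G W a \<epsilon> X s t \<longleftrightarrow>
     backward_brownian_motion M G W s t \<and>
     (\<forall>r\<in>{s..t}. X r \<in> borel_measurable (G r)) \<and>
     (AE \<omega> in M. continuous_on {s..t} (\<lambda>r. X r \<omega>)) \<and>
     (AE \<omega> in M. (\<lambda>r. a r (X r \<omega>)) integrable_on {s..t}) \<and>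
     (\<forall>u\<in>{s..t}. has_backward_integral M (*\<^sub>R) (\<lambda>r _. \<epsilon> r) W u t
        (\<lambda>\<omega>. X t \<omega> - X u \<omega> - integral {u..t} (\<lambda>r. a r (X r \<omega>))))"

definition backward_sampler ::
  "'w measure \<Rightarrow> (real \<Rightarrow> 'w measure) \<Rightarrow> (real \<Rightarrow> 'w \<Rightarrow> 'a::euclidean_space)
     \<Rightarrow> (real \<Rightarrow> 'a \<Rightarrow> 'a) \<Rightarrow> (real \<Rightarrow> real) \<Rightarrow> ('a \<Rightarrow> real) \<Rightarrow> (real \<Rightarrow> 'w \<Rightarrow> 'a)
     \<Rightarrow> real \<Rightarrow> real \<Rightarrow> bool" where
  "backward_sampler M G W a \<epsilon> q X s t \<longleftrightarrow>
     backward_sde M G W a \<epsilon> X s t \<and> distributed M lborel (X t) (\<lambda>x. ennreal (q x))"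

section \<open>Path weights\<close>

text \<open>
  Drifts for which the forward and backward SDEs with diffusion coefficient \<open>\<epsilon>\<close> both have the
  marginal densities \<open>p\<close> of \<open>dX = f dt + \<sigma> dW\<close>.
\<close>

definition reversal_forward_drift ::
  "(real \<Rightarrow> 'a::euclidean_space \<Rightarrow> 'a) \<Rightarrow> (real \<Rightarrow> real) \<Rightarrow> (real \<Rightarrow> real)
     \<Rightarrow> (real \<Rightarrow> 'a \<Rightarrow> real) \<Rightarrow> real \<Rightarrow> 'a \<Rightarrow> 'a" where
  "reversal_forward_drift f \<sigma> \<epsilon> p t x =
     f t x + (((\<epsilon> t)\<^sup>2 - (\<sigma> t)\<^sup>2) / 2) *\<^sub>R grad (\<lambda>y. ln (p t y)) x"

definition reversal_backward_drift ::
  "(real \<Rightarrow> 'a::euclidean_space \<Rightarrow> 'a) \<Rightarrow> (real \<Rightarrow> real) \<Rightarrow> (real \<Rightarrow> real)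
     \<Rightarrow> (real \<Rightarrow> 'a \<Rightarrow> real) \<Rightarrow> real \<Rightarrow> 'a \<Rightarrow> 'a" where
  "reversal_backward_drift f \<sigma> \<epsilon> p t x =
     f t x - (((\<epsilon> t)\<^sup>2 + (\<sigma> t)\<^sup>2) / 2) *\<^sub>R grad (\<lambda>y. ln (p t y)) x"

text \<open>\<open>R\<close> with backward drift \<open>\<nu>\<close> (first argument) and forward drift \<open>\<mu>\<close>, on the interval \<open>[s, t]\<close>.\<close>

definition path_ratio ::
  "'w measure \<Rightarrow> (real \<Rightarrow> real) \<Rightarrow> (real \<Rightarrow> 'a::euclidean_space \<Rightarrow> 'a) \<Rightarrow> (real \<Rightarrow> 'a \<Rightarrow> 'a)
     \<Rightarrow> (real \<Rightarrow> 'w \<Rightarrow> 'a) \<Rightarrow> real \<Rightarrow> real \<Rightarrow> 'w \<Rightarrow> real" where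
  "path_ratio M \<epsilon> \<nu> \<mu> X s t \<omega> =
     exp (backward_integral M (\<lambda>r \<omega>. (1 / (\<epsilon> r)\<^sup>2) *\<^sub>R \<nu> r (X r \<omega>)) X s t \<omega>
        - forward_integral M (\<lambda>r \<omega>. (1 / (\<epsilon> r)\<^sup>2) *\<^sub>R \<mu> r (X r \<omega>)) X s t \<omega>
        + 1 / 2 * integral {s..t} (\<lambda>r. 1 / (\<epsilon> r)\<^sup>2 *
            ((norm (\<mu> r (X r \<omega>)))\<^sup>2 - (norm (\<nu> r (X r \<omega>)))\<^sup>2)))"

definition product_weight ::
  "'w measure \<Rightarrow> (real \<Rightarrow> real) \<Rightarrow> real
     \<Rightarrow> (real \<Rightarrow> 'a::euclidean_space \<Rightarrow> 'a) \<Rightarrow> (real \<Rightarrow> 'a \<Rightarrow> 'a)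
     \<Rightarrow> (real \<Rightarrow> 'a \<Rightarrow> 'a) \<Rightarrow> (real \<Rightarrow> 'a \<Rightarrow> 'a)
     \<Rightarrow> (real \<Rightarrow> 'a \<Rightarrow> 'a) \<Rightarrow> (real \<Rightarrow> 'a \<Rightarrow> 'a)
     \<Rightarrow> (real \<Rightarrow> 'w \<Rightarrow> 'a) \<Rightarrow> real \<Rightarrow> real \<Rightarrow> 'w \<Rightarrow> real" where
  "product_weight M \<epsilon> \<beta> \<nu>1 \<mu>1 \<nu>2 \<mu>2 a b X s t \<omega> =
     path_ratio M \<epsilon> \<nu>1 \<mu>1 X s t \<omega> powr \<beta> * path_ratio M \<epsilon> \<nu>2 \<mu>2 X s t \<omega> powr \<beta>
       * inverse (path_ratio M \<epsilon> a b X s t \<omega>)"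

definition product_target ::
  "real \<Rightarrow> (real \<Rightarrow> 'a::euclidean_space \<Rightarrow> real) \<Rightarrow> (real \<Rightarrow> 'a \<Rightarrow> real) \<Rightarrow> real \<Rightarrow> 'a \<Rightarrow> real" where
  "product_target \<beta> p1 p2 t x =
     (p1 t x * p2 t x) powr \<beta> / (\<integral>y. (p1 t y * p2 t y) powr \<beta> \<partial>lborel)"

end

theory Submission
  imports Defs
begin

text \<open>
  In the exponent of the product weight the choice of \<open>\<eta>\<close> and \<open>\<zeta>\<close> makes all score terms in the
  stochastic integrands cancel, leaving \<open>(2 \<beta> - 1) f / \<epsilon>\<^sup>2\<close> both in the backward and in the forward
  integral. The difference of the two integrals of one integrand \<open>h (X)\<close> is a quadratic covariation,
  equal to the time integral of \<open>\<epsilon>\<^sup>2 \<nabla> \<cdot> h\<close>; the remaining time integrals combine algebraically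
  to the stated rate.

  Existence of the backward integrals is a Cauchy argument in probability: two Riemann sums
  are compared on a common refinement, and a discrete martingale transform \<open>\<Sum> D Z\<close> is small in probability as
  soon as \<open>\<Sum> D\<^sup>2 v\<close> is, \<open>v\<close> bounding the variances of the increments \<open>Z\<close>; this needs no integrability of
  the integrand. The same estimate, applied to the centred products of Brownian
  increments, together with a pathwise Taylor expansion of \<open>h\<close> identifies the covariation, and the
  forward integral is the difference.
\<close>

section \<open>Convergence in probability and limits over partitions\<close>

text \<open>The diffusion runs downwards, so the available information decreases in time:
  right-endpoint sums are adapted to the reversed filtration, while left-endpoint sums evaluate the
  integrand at a time not yet reached. This is why the forward integral is obtained only through its
  difference from the backward one.

  The cancellation rests on the single relation 2 \<eta> = \<beta> (\<zeta>^2 + 1). It turns \<beta>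
  (\<epsilon>^2 + \<sigma>^2) / 2 into \<eta> \<sigma>^2 and \<beta> (\<epsilon>^2 - \<sigma>^2) / 2
  into \<epsilon>^2 \<beta> - \<eta> \<sigma>^2, the score coefficients of the two proposal drifts
  up to sign.

  Drift and scores carry no growth bound, so moments along the path are not at hand. Mesh limits
  range over all fine partitions, almost sure arguments over sequences; the bridge is that a limit
  in probability may be tested on subsequences. The stochastic integrals are chosen values, fixed up
  to null sets that depend on the interval, so the differential equation has to be carried by a
  pathwise version of the log weight.\<close>

definition vanishes_in_prob ::
  "'w measure \<Rightarrow> (nat \<Rightarrow> 'w \<Rightarrow> 'v::euclidean_space) \<Rightarrow> bool" where
  "vanishes_in_prob M S \<longleftrightarrow> (\<forall>m. S m \<in> borel_measurable M) \<and>
     (\<forall>e>0. (\<lambda>m. measure M {\<omega> \<in> space M. e < norm (S m \<omega>)}) \<longlonglongrightarrow> 0)"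

context prob_space
begin

text \<open>Dominated convergence for the indicators of the exceptional events, with the constant 1
  as majorant. This is how pathwise limits enter.\<close>

lemma vanishes_in_prob_AE:
  fixes S :: "nat \<Rightarrow> 'a \<Rightarrow> 'v::euclidean_space"
  assumes [measurable]: "\<And>m. S m \<in> borel_measurable M"
    and lim: "AE \<omega> in M. (\<lambda>m. S m \<omega>) \<longlonglongrightarrow> 0"
  shows "vanishes_in_prob M S"
  unfolding vanishes_in_prob_def
proof (intro conjI allI impI)
  fix e :: real assume e: "0 < e"
  define A where "A m = {\<omega> \<in> space M. e < norm (S m \<omega>)}" for m
  have [measurable]: "A m \<in> sets M" for m unfolding A_def by measurable
  have "(\<lambda>m. \<integral>\<omega>. indicator (A m) \<omega> \<partial>M) \<longlonglongrightarrow> (\<integral>\<omega>. (0::real) \<partial>M)"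
  proof (rule integral_dominated_convergence[where w = "\<lambda>_. 1"])
    show "AE \<omega> in M. (\<lambda>m. indicator (A m) \<omega> :: real) \<longlonglongrightarrow> 0"
      using lim
    proof eventually_elim
      case (elim \<omega>)
      have "\<forall>\<^sub>F m in sequentially. norm (S m \<omega>) < e"
        using tendstoD[OF elim e] by (simp add: dist_norm)
      then show ?case
        by (intro tendsto_eventually) (auto simp: A_def indicator_def elim!: eventually_mono)
    qed
  qed (auto simp: indicator_def)
  then show "(\<lambda>m. prob {\<omega> \<in> space M. e < norm (S m \<omega>)}) \<longlonglongrightarrow> 0"
    by (simp add: A_def[symmetric])
qed fact

lemma vanishes_in_prob_add:
  fixes S R :: "nat \<Rightarrow> 'a \<Rightarrow> 'v::euclidean_space"
  assumes S: "vanishes_in_prob M S" and R: "vanishes_in_prob M R"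
  shows "vanishes_in_prob M (\<lambda>m \<omega>. S m \<omega> + R m \<omega>)"
  unfolding vanishes_in_prob_def
proof (intro conjI allI impI)
  have [measurable]: "S m \<in> borel_measurable M" "R m \<in> borel_measurable M" for m
    using assms by (auto simp: vanishes_in_prob_def)
  show "(\<lambda>\<omega>. S m \<omega> + R m \<omega>) \<in> borel_measurable M" for m by measurable
  fix e :: real assume e: "0 < e"
  have "(\<lambda>m. prob {\<omega> \<in> space M. e/2 < norm (S m \<omega>)} + prob {\<omega> \<in> space M. e/2 < norm (R m \<omega>)})
      \<longlonglongrightarrow> 0 + 0"
    using S R e unfolding vanishes_in_prob_def by (intro tendsto_add) (meson half_gt_zero)+
  moreover have "prob {\<omega> \<in> space M. e < norm (S m \<omega> + R m \<omega>)}
     \<le> prob {\<omega> \<in> space M. e/2 < norm (S m \<omega>)} + prob {\<omega> \<in> space M. e/2 < norm (R m \<omega>)}" for m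
  proof -
    have "prob {\<omega> \<in> space M. e < norm (S m \<omega> + R m \<omega>)}
      \<le> prob ({\<omega> \<in> space M. e/2 < norm (S m \<omega>)} \<union> {\<omega> \<in> space M. e/2 < norm (R m \<omega>)})"
    proof (rule finite_measure_mono)
      show "{\<omega> \<in> space M. e < norm (S m \<omega> + R m \<omega>)}
        \<subseteq> {\<omega> \<in> space M. e/2 < norm (S m \<omega>)} \<union> {\<omega> \<in> space M. e/2 < norm (R m \<omega>)}"
      proof clarsimp
        fix \<omega> assume "e < norm (S m \<omega> + R m \<omega>)" "\<not> e < norm (R m \<omega>) * 2"
        then show "e < norm (S m \<omega>) * 2"
          using norm_triangle_ineq[of "S m \<omega>" "R m \<omega>"] by linarith
      qed
    qed measurable
    also have "\<dots> \<le> prob {\<omega> \<in> space M. e/2 < norm (S m \<omega>)} + prob {\<omega> \<in> space M. e/2 < norm (R m \<omega>)}"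
      by (rule measure_subadditive) (auto simp: emeasure_eq_measure)
    finally show ?thesis .
  qed
  ultimately show "(\<lambda>m. prob {\<omega> \<in> space M. e < norm (S m \<omega> + R m \<omega>)}) \<longlonglongrightarrow> 0"
    by (intro Lim_null_comparison[of "\<lambda>m. prob {\<omega> \<in> space M. e < norm (S m \<omega> + R m \<omega>)}"]) (auto simp: eventually_sequentially)
qed

lemma vanishes_in_prob_zero: "vanishes_in_prob M (\<lambda>m \<omega>. 0::'v::euclidean_space)"
  by (auto simp: vanishes_in_prob_def)

lemma vanishes_in_prob_sum:
  fixes S :: "'i \<Rightarrow> nat \<Rightarrow> 'a \<Rightarrow> 'v::euclidean_space"
  assumes "\<And>i. i \<in> A \<Longrightarrow> vanishes_in_prob M (S i)"
  shows "vanishes_in_prob M (\<lambda>m \<omega>. \<Sum>i\<in>A. S i m \<omega>)"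
  using assms
  by (induction A rule: infinite_finite_induct)
    (auto intro: vanishes_in_prob_add vanishes_in_prob_zero)

lemma vanishes_in_prob_scaleR:
  fixes S :: "nat \<Rightarrow> 'a \<Rightarrow> 'v::euclidean_space"
  assumes S: "vanishes_in_prob M S"
  shows "vanishes_in_prob M (\<lambda>m \<omega>. c *\<^sub>R S m \<omega>)"
proof (cases "c = 0")
  case True
  then show ?thesis by (simp add: vanishes_in_prob_zero)
next
  case False
  show ?thesis unfolding vanishes_in_prob_def
  proof (intro conjI allI impI)
    show "(\<lambda>\<omega>. c *\<^sub>R S m \<omega>) \<in> borel_measurable M" for m
      using S by (intro borel_measurable_scaleR) (auto simp: vanishes_in_prob_def)
    fix e :: real assume "0 < e"
    then have "(\<lambda>m. prob {\<omega> \<in> space M. e / \<bar>c\<bar> < norm (S m \<omega>)}) \<longlonglongrightarrow> 0"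
      using S False by (auto simp: vanishes_in_prob_def)
    then show "(\<lambda>m. prob {\<omega> \<in> space M. e < norm (c *\<^sub>R S m \<omega>)}) \<longlonglongrightarrow> 0"
      using False by (simp add: field_simps)
  qed
qed

section \<open>Almost sure convergence along subsequences\<close>

lemma ex_strict_mono_above: "\<exists>r::nat \<Rightarrow> nat. strict_mono r \<and> (\<forall>k. N k \<le> r k)"
proof (intro exI conjI allI)
  show "strict_mono (\<lambda>k. \<Sum>j\<le>k. Suc (N j))"
    by (rule strict_mono_Suc_iff[THEN iffD2]) simp
  show "N k \<le> (\<Sum>j\<le>k. Suc (N j))" for k
    by (rule order_trans[OF _ member_le_sum[of k]]) auto
qed

lemma summable_half_powers: "summable (\<lambda>k. (1/2::real)^k)"
  by (simp add: summable_geometric)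

text \<open>Borel-Cantelli. The same \<open>(1/2)^k\<close> as threshold and as probability is
  summable in both roles: for the events, and later for the norms of differences, which then form an
  absolutely convergent series.\<close>

lemma AE_eventually_le_half_power:
  fixes S :: "nat \<Rightarrow> 'a \<Rightarrow> 'v::euclidean_space"
  assumes [measurable]: "\<And>m. S m \<in> borel_measurable M"
    and p: "\<And>k. prob {\<omega> \<in> space M. (1/2)^k < norm (S k \<omega>)} \<le> (1/2)^k"
  shows "AE \<omega> in M. \<forall>\<^sub>F k in sequentially. norm (S k \<omega>) \<le> (1/2)^k"
proof -
  have "AE \<omega> in M. eventually (\<lambda>k. \<omega> \<in> space M - {\<omega> \<in> space M. (1/2)^k < norm (S k \<omega>)}) sequentially"
  proof (rule borel_cantelli_AE1)
    show "summable (\<lambda>k. prob {\<omega> \<in> space M. (1/2)^k < norm (S k \<omega>)})"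
      using p by (intro summable_comparison_test_ev[OF _ summable_half_powers] always_eventually) auto
  qed (auto simp: emeasure_eq_measure)
  then show ?thesis
    by eventually_elim (auto elim!: eventually_mono)
qed

lemma vanishes_in_prob_subseq:
  fixes S :: "nat \<Rightarrow> 'a \<Rightarrow> 'v::euclidean_space"
  assumes S: "vanishes_in_prob M S"
  obtains r :: "nat \<Rightarrow> nat" where "strict_mono r" "AE \<omega> in M. (\<lambda>m. S (r m) \<omega>) \<longlonglongrightarrow> 0"
proof -
  have "\<exists>N. \<forall>m\<ge>N. prob {\<omega> \<in> space M. (1/2)^k < norm (S m \<omega>)} \<le> (1/2)^k" for k :: nat
  proof -
    have "(\<lambda>m. prob {\<omega> \<in> space M. (1/2)^k < norm (S m \<omega>)}) \<longlonglongrightarrow> 0"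
      using S by (auto simp: vanishes_in_prob_def)
    then have "\<forall>\<^sub>F m in sequentially. prob {\<omega> \<in> space M. (1/2)^k < norm (S m \<omega>)} < (1/2)^k"
      by (rule order_tendstoD) simp
    then show ?thesis
      by (auto simp: eventually_sequentially intro: less_imp_le)
  qed
  then obtain N where N: "\<And>k m. N k \<le> m \<Longrightarrow> prob {\<omega> \<in> space M. (1/2)^k < norm (S m \<omega>)} \<le> (1/2)^k"
    by metis
  obtain r :: "nat \<Rightarrow> nat" where r: "strict_mono r" "\<And>k. N k \<le> r k"
    using ex_strict_mono_above by blast
  have "AE \<omega> in M. \<forall>\<^sub>F k in sequentially. norm (S (r k) \<omega>) \<le> (1/2)^k"
    using S r N by (intro AE_eventually_le_half_power) (auto simp: vanishes_in_prob_def)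
  then have "AE \<omega> in M. (\<lambda>m. S (r m) \<omega>) \<longlonglongrightarrow> 0"
  proof eventually_elim
    case (elim \<omega>)
    then show ?case
      by (rule Lim_null_comparison) (rule LIMSEQ_power_zero, simp)
  qed
  with r show ?thesis using that by blast
qed

lemma Cauchy_in_prob_imp_AE_convergent_subseq:
  fixes S :: "nat \<Rightarrow> 'a \<Rightarrow> 'v::euclidean_space"
  assumes [measurable]: "\<And>m. S m \<in> borel_measurable M"
    and C: "\<And>e. 0 < e \<Longrightarrow> \<exists>N. \<forall>m\<ge>N. \<forall>k\<ge>N. prob {\<omega> \<in> space M. e < norm (S m \<omega> - S k \<omega>)} \<le> e"
  obtains r :: "nat \<Rightarrow> nat" and I where "strict_mono r" "I \<in> borel_measurable M"
    "AE \<omega> in M. (\<lambda>m. S (r m) \<omega>) \<longlonglongrightarrow> I \<omega>"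
proof -
  have "\<exists>N. \<forall>m\<ge>N. \<forall>l\<ge>N. prob {\<omega> \<in> space M. (1/2)^k < norm (S m \<omega> - S l \<omega>)} \<le> (1/2)^k" for k :: nat
    by (rule C) simp
  then obtain N where N: "\<And>k m l. N k \<le> m \<Longrightarrow> N k \<le> l \<Longrightarrow>
      prob {\<omega> \<in> space M. (1/2)^k < norm (S m \<omega> - S l \<omega>)} \<le> (1/2)^k"
    by metis
  obtain r :: "nat \<Rightarrow> nat" where r: "strict_mono r" "\<And>k. N k \<le> r k"
    using ex_strict_mono_above by blast
  \<comment> \<open>Consecutive terms are compared at scale \<open>k\<close>, so both of their
    indices must lie beyond \<open>N k\<close>.\<close>
  have r2: "N k \<le> r (Suc k)" for k
    using r(2)[of k] strict_monoD[OF r(1), of k "Suc k"] by simp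
  have "AE \<omega> in M. \<forall>\<^sub>F k in sequentially. norm (S (r (Suc k)) \<omega> - S (r k) \<omega>) \<le> (1/2)^k"
    by (rule AE_eventually_le_half_power) (auto intro: N r r2)
  then have conv: "AE \<omega> in M. convergent (\<lambda>k. S (r k) \<omega>)"
  proof eventually_elim
    case (elim \<omega>)
    then have "summable (\<lambda>k. S (r (Suc k)) \<omega> - S (r k) \<omega>)"
      by (rule summable_comparison_test_ev) (rule summable_half_powers)
    then have "convergent (\<lambda>n. \<Sum>k<n. S (r (Suc k)) \<omega> - S (r k) \<omega>)"
      by (simp add: summable_iff_convergent)
    then have "convergent (\<lambda>n. S (r n) \<omega> - S (r 0) \<omega>)"
      by (subst (asm) sum_lessThan_telescope)
    then have "convergent (\<lambda>n. (S (r n) \<omega> - S (r 0) \<omega>) + S (r 0) \<omega>)"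
      by (rule convergent_add) (rule convergent_const)
    then show ?case by simp
  qed
  \<comment> \<open>\<open>lim\<close> has a fixed default value on divergent sequences, so
    \<open>I\<close> is measurable on the whole space and not merely defined almost
    everywhere.\<close>
  define I where "I \<omega> = lim (\<lambda>k. S (r k) \<omega>)" for \<omega>
  have "I \<in> borel_measurable M" unfolding I_def by measurable
  moreover have "AE \<omega> in M. (\<lambda>m. S (r m) \<omega>) \<longlonglongrightarrow> I \<omega>"
    using conv by eventually_elim (simp add: I_def convergent_LIMSEQ_iff)
  ultimately show ?thesis using r that by blast
qed

end

section \<open>Partitions of a time interval\<close>

lemma fine_partition_mono: "fine_partition d s t n u \<Longrightarrow> d \<le> d' \<Longrightarrow> fine_partition d' s t n u"
  by (force simp: fine_partition_def)

lemma fine_partition_le: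
  assumes "fine_partition d s t n u" "j \<le> k" "k \<le> n"
  shows "u j \<le> u k"
  using assms(2,3)
proof (induction k rule: dec_induct)
  case (step k)
  moreover have "u k \<le> u (Suc k)" using assms(1) step by (simp add: fine_partition_def)
  ultimately show ?case by simp
qed simp

lemma fine_partition_mem:
  assumes "fine_partition d s t n u" "k \<le> n"
  shows "u k \<in> {s..t}"
  using fine_partition_le[OF assms(1), of 0 k] fine_partition_le[OF assms(1), of k n] assms
  by (auto simp: fine_partition_def)

lemma sum_step_const:
  "(\<Sum>k<n. c * (u (Suc k) - u k)) = c * (u n - u 0 :: real)"
  by (simp add: sum_distrib_left[symmetric] sum_lessThan_telescope)

lemma uniform_fine_partition:
  fixes s t :: real
  assumes "s \<le> t" "0 < n" "(t - s) / real n < d"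
  shows "fine_partition d s t n (\<lambda>k. s + (t - s) * real k / real n)"
proof -
  have "(s + (t - s) * real (Suc k) / real n) - (s + (t - s) * real k / real n) = (t - s) / real n" for k
    by (simp add: diff_divide_distrib[symmetric] algebra_simps)
  moreover have "s + (t - s) * real k / real n \<le> s + (t - s) * real (Suc k) / real n" for k
    using assms by (intro add_left_mono divide_right_mono mult_left_mono) auto
  ultimately show ?thesis using assms by (simp add: fine_partition_def)
qed

lemma ex_fine_partition:
  assumes "s \<le> t" "0 < d"
  shows "\<exists>n u. fine_partition d s t n u"
proof -
  obtain n :: nat where n: "(t - s) / d < real n"
    using reals_Archimedean2 by blast
  \<comment> \<open>The case \<open>s = t\<close> is included: \<open>n\<close> is still positive,
    so a division into \<open>n\<close> equal steps makes sense.\<close>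
  have "0 \<le> (t - s) / d" using assms by simp
  with n have "0 < real n" by linarith
  then have "fine_partition d s t n (\<lambda>k. s + (t - s) * real k / real n)"
    using n assms by (intro uniform_fine_partition) (auto simp: field_simps)
  then show ?thesis by blast
qed

section \<open>Mesh limits as limits along sequences of partitions\<close>

context prob_space
begin

lemma mesh_limit_imp_vanishes:
  assumes L: "mesh_limit M S s t I"
  shows "\<exists>d>0. (\<forall>n u. fine_partition d s t n u \<longrightarrow> S n u \<in> borel_measurable M) \<and>
    (\<forall>n u. (\<forall>m. fine_partition (d / Suc m) s t (n m) (u m)) \<longrightarrow>
       vanishes_in_prob M (\<lambda>m \<omega>. S (n m) (u m) \<omega> - I \<omega>))"
proof -
  have [measurable]: "I \<in> borel_measurable M" using L by (auto simp: mesh_limit_def)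
  obtain D where D: "\<And>e. e > 0 \<Longrightarrow> D e > 0"
    "\<And>e n u. e > 0 \<Longrightarrow> fine_partition (D e) s t n u \<Longrightarrow>
        S n u \<in> borel_measurable M \<and>
        prob {\<omega> \<in> space M. norm (S n u \<omega> - I \<omega>) > e} < e"
    using L unfolding mesh_limit_def by metis
  \<comment> \<open>\<open>D 1\<close> already secures measurability of every sum of the sequence;
    the scale \<open>D e\<close> for smaller \<open>e\<close> is reached eventually, because the
    mesh \<open>D 1 / Suc m\<close> tends to zero.\<close>
  show ?thesis
  proof (intro exI[of _ "D 1"] conjI allI impI)
    fix n u assume "\<forall>m. fine_partition (D 1 / Suc m) s t (n m) (u m)"
    then have fp: "\<And>m. fine_partition (D 1 / Suc m) s t (n m) (u m)" by blast
    have fp1: "fine_partition (D 1) s t (n m) (u m)" for m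
      using D(1)[of 1] by (intro fine_partition_mono[OF fp[of m]]) (simp add: field_simps)
    show "vanishes_in_prob M (\<lambda>m \<omega>. S (n m) (u m) \<omega> - I \<omega>)"
      unfolding vanishes_in_prob_def
    proof (intro conjI allI impI)
      have [measurable]: "S (n m) (u m) \<in> borel_measurable M" for m
        using D(2)[OF _ fp1[of m]] by simp
      show "(\<lambda>\<omega>. S (n m) (u m) \<omega> - I \<omega>) \<in> borel_measurable M" for m by measurable
      fix e :: real assume e: "0 < e"
      show "(\<lambda>m. prob {\<omega> \<in> space M. e < norm (S (n m) (u m) \<omega> - I \<omega>)}) \<longlonglongrightarrow> 0"
      proof (rule LIMSEQ_I)
        fix e' :: real assume e': "0 < e'"
        \<comment> \<open>\<open>mesh_limit\<close> uses one number both as tolerance and as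
          probability bound; the minimum serves the given tolerance \<open>e\<close> and the wanted
          bound \<open>e'\<close> together.\<close>
        define e2 where "e2 = min e e'"
        have e2: "0 < e2" "e2 \<le> e" "e2 \<le> e'" using e e' by (auto simp: e2_def)
        obtain N :: nat where N: "D 1 / D e2 < real N"
          using reals_Archimedean2 by blast
        have "norm (prob {\<omega> \<in> space M. e < norm (S (n m) (u m) \<omega> - I \<omega>)} - 0) < e'" if "m \<ge> N" for m
        proof -
          have "D 1 < real N * D e2" using N D(1)[OF e2(1)] by (simp add: field_simps)
          also have "\<dots> \<le> real (Suc m) * D e2"
            using that D(1)[OF e2(1)] by (intro mult_right_mono) auto
          finally have "D 1 / Suc m \<le> D e2" by (simp add: field_simps)
          then have "fine_partition (D e2) s t (n m) (u m)"
            by (rule fine_partition_mono[OF fp])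
          then have "prob {\<omega> \<in> space M. e2 < norm (S (n m) (u m) \<omega> - I \<omega>)} < e2"
            using D(2) e2 by blast
          moreover have "prob {\<omega> \<in> space M. e < norm (S (n m) (u m) \<omega> - I \<omega>)} \<le>
              prob {\<omega> \<in> space M. e2 < norm (S (n m) (u m) \<omega> - I \<omega>)}"
            using e2 by (intro finite_measure_mono) auto
          ultimately show ?thesis using e2 by simp
        qed
        then show "\<exists>N. \<forall>m\<ge>N. norm (prob {\<omega> \<in> space M. e < norm (S (n m) (u m) \<omega> - I \<omega>)} - 0) < e'"
          by blast
      qed
    qed
  qed (use D(1)[of 1] D(2)[of 1] in auto)
qed

text \<open>By contradiction: if some tolerance failed at every mesh, one bad partition of each mesh
  \<open>d / Suc m\<close> would give a sequence none of whose subsequences vanishes in probability.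
  Since \<open>L\<close> asks for a subsequence only, almost sure limits along subsequences suffice
  to prove a limit over all partitions.\<close>

lemma mesh_limitI:
  fixes I :: "'a \<Rightarrow> 'v::euclidean_space"
  assumes I[measurable]: "I \<in> borel_measurable M" and d: "0 < d"
    and S: "\<And>n u. fine_partition d s t n u \<Longrightarrow> S n u \<in> borel_measurable M"
    and L: "\<And>n u. (\<And>m. fine_partition (d / Suc m) s t (n m) (u m)) \<Longrightarrow>
       \<exists>r. strict_mono r \<and> vanishes_in_prob M (\<lambda>m \<omega>. S (n (r m)) (u (r m)) \<omega> - I \<omega>)"
  shows "mesh_limit M S s t I"
  unfolding mesh_limit_def
proof (intro conjI allI impI)
  fix e :: real assume e: "0 < e"
  show "\<exists>d>0. \<forall>n u. fine_partition d s t n u \<longrightarrow> S n u \<in> borel_measurable M \<and>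
                 prob {\<omega> \<in> space M. e < norm (S n u \<omega> - I \<omega>)} < e"
  proof (rule ccontr)
    assume neg: "\<not> ?thesis"
    have "\<exists>n u. fine_partition (d / Suc m) s t n u \<and> \<not> prob {\<omega> \<in> space M. e < norm (S n u \<omega> - I \<omega>)} < e" for m
    proof -
      have "0 < d / Suc m" using d by simp
      then obtain n u where fp: "fine_partition (d / Suc m) s t n u"
        and n: "\<not> (S n u \<in> borel_measurable M \<and> prob {\<omega> \<in> space M. e < norm (S n u \<omega> - I \<omega>)} < e)"
        using neg by blast
      have "fine_partition d s t n u"
        using d by (intro fine_partition_mono[OF fp]) (simp add: field_simps)
      then show ?thesis using S fp n by blast
    qed
    then obtain n u where fp: "\<And>m. fine_partition (d / Suc m) s t (n m) (u m)"
      and bad: "\<And>m. \<not> prob {\<omega> \<in> space M. e < norm (S (n m) (u m) \<omega> - I \<omega>)} < e"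
      by metis
    obtain r where r: "vanishes_in_prob M (\<lambda>m \<omega>. S (n (r m)) (u (r m)) \<omega> - I \<omega>)"
      using L[OF fp] by blast
    then have "(\<lambda>m. prob {\<omega> \<in> space M. e < norm (S (n (r m)) (u (r m)) \<omega> - I \<omega>)}) \<longlonglongrightarrow> 0"
      using e by (auto simp: vanishes_in_prob_def)
    then have "\<forall>\<^sub>F m in sequentially. prob {\<omega> \<in> space M. e < norm (S (n (r m)) (u (r m)) \<omega> - I \<omega>)} < e"
      using e by (rule order_tendstoD)
    then obtain m where "prob {\<omega> \<in> space M. e < norm (S (n (r m)) (u (r m)) \<omega> - I \<omega>)} < e"
      unfolding eventually_sequentially by blast
    with bad[of "r m"] show False by simp
  qed
qed fact

lemma mesh_limit_add:
  fixes I J :: "'a \<Rightarrow> 'v::euclidean_space"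
  assumes "mesh_limit M S s t I" "mesh_limit M R s t J"
  shows "mesh_limit M (\<lambda>n u \<omega>. S n u \<omega> + R n u \<omega>) s t (\<lambda>\<omega>. I \<omega> + J \<omega>)"
proof -
  obtain d1 where d1: "0 < d1" "\<And>n u. fine_partition d1 s t n u \<Longrightarrow> S n u \<in> borel_measurable M"
    "\<And>n u. (\<And>m. fine_partition (d1 / Suc m) s t (n m) (u m)) \<Longrightarrow>
       vanishes_in_prob M (\<lambda>m \<omega>. S (n m) (u m) \<omega> - I \<omega>)"
    using mesh_limit_imp_vanishes[OF assms(1)] by (elim exE conjE) (rule that, auto)
  obtain d2 where d2: "0 < d2" "\<And>n u. fine_partition d2 s t n u \<Longrightarrow> R n u \<in> borel_measurable M"
    "\<And>n u. (\<And>m. fine_partition (d2 / Suc m) s t (n m) (u m)) \<Longrightarrow>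
       vanishes_in_prob M (\<lambda>m \<omega>. R (n m) (u m) \<omega> - J \<omega>)"
    using mesh_limit_imp_vanishes[OF assms(2)] by (elim exE conjE) (rule that, auto)
  have [measurable]: "I \<in> borel_measurable M" "J \<in> borel_measurable M"
    using assms by (auto simp: mesh_limit_def)
  define d where "d = min d1 d2"
  have d: "0 < d" "d \<le> d1" "d \<le> d2" using d1 d2 by (auto simp: d_def)
  show ?thesis
  proof (rule mesh_limitI[OF _ d(1)])
    fix n u assume "fine_partition d s t n u"
    then have "fine_partition d1 s t n u" "fine_partition d2 s t n u"
      using d by (auto intro: fine_partition_mono)
    then show "(\<lambda>\<omega>. S n u \<omega> + R n u \<omega>) \<in> borel_measurable M"
      using d1 d2 by (intro borel_measurable_add) auto
  next
    fix n u assume fp: "\<And>m. fine_partition (d / real (Suc m)) s t (n m) (u m)"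
    have "fine_partition (d1 / real (Suc m)) s t (n m) (u m)" "fine_partition (d2 / real (Suc m)) s t (n m) (u m)" for m
      using d by (auto intro!: fine_partition_mono[OF fp] divide_right_mono)
    then have "vanishes_in_prob M (\<lambda>m \<omega>. (S (n m) (u m) \<omega> - I \<omega>) + (R (n m) (u m) \<omega> - J \<omega>))"
      using d1 d2 by (intro vanishes_in_prob_add) auto
    then have "vanishes_in_prob M (\<lambda>m \<omega>. (S (n m) (u m) \<omega> + R (n m) (u m) \<omega>) - (I \<omega> + J \<omega>))"
      by (simp add: algebra_simps)
    then show "\<exists>r. strict_mono r \<and> vanishes_in_prob M (\<lambda>m \<omega>. (S (n (r m)) (u (r m)) \<omega> + R (n (r m)) (u (r m)) \<omega>) - (I \<omega> + J \<omega>))"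
      by (intro exI[of _ "\<lambda>x. x"]) (auto simp: strict_mono_def)
  qed measurable
qed

lemma mesh_limit_scaleR:
  fixes I :: "'a \<Rightarrow> 'v::euclidean_space"
  assumes "mesh_limit M S s t I"
  shows "mesh_limit M (\<lambda>n u \<omega>. c *\<^sub>R S n u \<omega>) s t (\<lambda>\<omega>. c *\<^sub>R I \<omega>)"
proof -
  obtain d where d: "0 < d" "\<And>n u. fine_partition d s t n u \<Longrightarrow> S n u \<in> borel_measurable M"
    "\<And>n u. (\<And>m. fine_partition (d / Suc m) s t (n m) (u m)) \<Longrightarrow>
       vanishes_in_prob M (\<lambda>m \<omega>. S (n m) (u m) \<omega> - I \<omega>)"
    using mesh_limit_imp_vanishes[OF assms(1)] by (elim exE conjE) (rule that, auto)
  have [measurable]: "I \<in> borel_measurable M"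
    using assms by (auto simp: mesh_limit_def)
  show ?thesis
  proof (rule mesh_limitI[OF _ d(1)])
    fix n u assume fp: "\<And>m. fine_partition (d / real (Suc m)) s t (n m) (u m)"
    have "vanishes_in_prob M (\<lambda>m \<omega>. c *\<^sub>R (S (n m) (u m) \<omega> - I \<omega>))"
      using d fp by (intro vanishes_in_prob_scaleR) auto
    then show "\<exists>r. strict_mono r \<and> vanishes_in_prob M (\<lambda>m \<omega>. c *\<^sub>R S (n (r m)) (u (r m)) \<omega> - c *\<^sub>R I \<omega>)"
      by (intro exI[of _ "\<lambda>x. x"]) (auto simp: strict_mono_def algebra_simps)
  qed (use d(2) in auto)
qed

text \<open>The difference of the two limits is the limit of sums that are identically zero. For
  \<open>s > t\<close> there would be no partition at all and every measurable function would be a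
  limit, whence \<open>s \<le> t\<close>.\<close>

lemma mesh_limit_unique:
  fixes I J :: "'a \<Rightarrow> 'v::euclidean_space"
  assumes "s \<le> t" "mesh_limit M S s t I" "mesh_limit M S s t J"
  shows "AE \<omega> in M. I \<omega> = J \<omega>"
proof -
  have "mesh_limit M (\<lambda>n u \<omega>. S n u \<omega> + (-1) *\<^sub>R S n u \<omega>) s t (\<lambda>\<omega>. I \<omega> + (-1) *\<^sub>R J \<omega>)"
    by (intro mesh_limit_add mesh_limit_scaleR assms)
  then have L: "mesh_limit M (\<lambda>n u \<omega>. 0) s t (\<lambda>\<omega>. I \<omega> - J \<omega>)"
    by simp
  obtain d where d: "0 < d"
    "\<forall>n u. (\<forall>m. fine_partition (d / Suc m) s t (n m) (u m)) \<longrightarrow>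
       vanishes_in_prob M (\<lambda>m \<omega>. 0 - (I \<omega> - J \<omega>))"
    using mesh_limit_imp_vanishes[OF L] by blast
  have "\<exists>n u. fine_partition (d / Suc m) s t n u" for m
    using assms d by (intro ex_fine_partition) auto
  then obtain n u where "\<And>m. fine_partition (d / Suc m) s t (n m) (u m)"
    by metis
  then have "vanishes_in_prob M (\<lambda>m \<omega>. 0 - (I \<omega> - J \<omega>))" using d(2) by blast
  then obtain r where "AE \<omega> in M. (\<lambda>m::nat. 0 - (I \<omega> - J \<omega>)) \<longlonglongrightarrow> 0"
    by (rule vanishes_in_prob_subseq)
  then show ?thesis
    by eventually_elim (simp add: LIMSEQ_const_iff)
qed

end

section \<open>Discrete martingale transforms\<close>

context prob_space
begin

text \<open>Turns independence of an increment from the past into independence of two variables, the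
  form in which expectations of products factorise: the preimages under \<open>D\<close> already
  belong to \<open>F\<close>.\<close>

lemma indep_var_subalgebra:
  fixes D :: "'a \<Rightarrow> 'b::topological_space" and Z :: "'a \<Rightarrow> 'b"
  assumes F: "subalgebra M F" and D: "D \<in> borel_measurable F" and Z: "Z \<in> borel_measurable M"
    and ind: "indep_set (sets F) (sets (vimage_algebra (space M) Z borel))"
  shows "indep_var borel D borel Z"
  unfolding indep_var_eq
proof (intro conjI)
  show "random_variable borel D"
    using measurable_from_subalg[OF F D] .
  have 1: "sigma_sets (space M) {D -` A \<inter> space M | A. A \<in> sets borel} \<subseteq> sets F"
  proof -
    have "{D -` A \<inter> space M | A. A \<in> sets borel} \<subseteq> sets F"
      using D F by (auto simp: measurable_def subalgebra_def)
    then show ?thesis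
      using F sets.sigma_sets_subset[of _ F] by (simp add: subalgebra_def)
  qed
  have 2: "sigma_sets (space M) {Z -` A \<inter> space M | A. A \<in> sets borel} = sets (vimage_algebra (space M) Z borel)"
    by (simp add: sets_vimage_algebra)
  show "indep_set (sigma_sets (space M) {D -` A \<inter> space M | A. A \<in> sets borel})
      (sigma_sets (space M) {Z -` A \<inter> space M | A. A \<in> sets borel})"
    unfolding 2 using ind 1 unfolding indep_set_def
    by (elim indep_sets_mono_sets) (auto split: bool.splits)
qed fact

text \<open>
  The integrands are cut off as soon as the weighted sum of their squares exceeds \<open>\<delta>\<close>; this
  keeps them square integrable against the increments and leaves the sum unchanged off the
  event that the total exceeds \<open>\<delta>\<close>.
\<close>

lemma prob_martingale_transform_le:
  fixes D Z :: "nat \<Rightarrow> 'a \<Rightarrow> real" and v :: "nat \<Rightarrow> real"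
  assumes F: "\<And>k. k \<le> n \<Longrightarrow> subalgebra M (F k)"
    and mono: "\<And>j k. j \<le> k \<Longrightarrow> k \<le> n \<Longrightarrow> sets (F j) \<subseteq> sets (F k)"
    and D: "\<And>k. k < n \<Longrightarrow> D k \<in> borel_measurable (F k)"
    and Z: "\<And>k. k < n \<Longrightarrow> Z k \<in> borel_measurable (F (Suc k))"
    and ind: "\<And>k. k < n \<Longrightarrow> indep_set (sets (F k)) (sets (vimage_algebra (space M) (Z k) borel))"
    and mean: "\<And>k. k < n \<Longrightarrow> expectation (Z k) = 0"
    and sq: "\<And>k. k < n \<Longrightarrow> integrable M (\<lambda>\<omega>. (Z k \<omega>)\<^sup>2)"
    and var: "\<And>k. k < n \<Longrightarrow> expectation (\<lambda>\<omega>. (Z k \<omega>)\<^sup>2) \<le> v k"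
    and v: "\<And>k. k < n \<Longrightarrow> 0 < v k \<or> (\<forall>\<omega>. Z k \<omega> = 0)"
    and e: "0 < e" and \<delta>: "0 \<le> \<delta>"
  shows "prob {\<omega> \<in> space M. e < \<bar>\<Sum>k<n. D k \<omega> * Z k \<omega>\<bar>}
    \<le> prob {\<omega> \<in> space M. \<delta> < (\<Sum>k<n. (D k \<omega>)\<^sup>2 * v k)} + \<delta> / e\<^sup>2"
proof -
  have v0: "0 \<le> v k" if "k < n" for k
    by (rule order_trans[OF _ var[OF that]]) simp
  define V where "V k \<omega> = (\<Sum>j<k. (D j \<omega>)\<^sup>2 * v j)" for k \<omega>
  \<comment> \<open>\<open>V (Suc k)\<close> involves \<open>D\<close> up to index \<open>k\<close>
    only, so the cutoff is decided by the information in \<open>F k\<close>. The condition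
    \<open>0 < v k\<close> bounds the square of \<open>D' k\<close> by
    \<open>\<delta> / v k\<close>.\<close>
  define D' where "D' k \<omega> = (if 0 < v k \<and> V (Suc k) \<omega> \<le> \<delta> then D k \<omega> else 0)" for k \<omega>
  define Q where "Q k \<omega> = (\<Sum>j<k. D' j \<omega> * Z j \<omega>)" for k \<omega>
  have DF: "D j \<in> borel_measurable (F k)" if "j \<le> k" "j < n" "k \<le> n" for j k
    using D[OF that(2)] mono[of j k] F[of j] F[of k] that
    by (auto simp: measurable_def subalgebra_def)
  have ZF: "Z j \<in> borel_measurable (F k)" if "j < k" "k \<le> n" for j k
    using Z[of j] mono[of "Suc j" k] F[of "Suc j"] F[of k] that
    by (auto simp: measurable_def subalgebra_def)
  have D'F: "D' j \<in> borel_measurable (F k)" if "j \<le> k" "j < n" "k \<le> n" for j k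
  proof -
    have [measurable]: "D i \<in> borel_measurable (F k)" if "i < Suc j" for i
      using DF[of i k] that \<open>j \<le> k\<close> \<open>j < n\<close> \<open>k \<le> n\<close> by auto
    have [measurable]: "V (Suc j) \<in> borel_measurable (F k)"
      unfolding V_def by (intro borel_measurable_sum borel_measurable_times borel_measurable_power) auto
    have [measurable]: "D j \<in> borel_measurable (F k)" using DF that by auto
    show ?thesis unfolding D'_def by measurable
  qed
  have QF: "Q k \<in> borel_measurable (F k)" if "k \<le> n" for k
    unfolding Q_def using D'F ZF that by (intro borel_measurable_sum borel_measurable_times) auto
  have MF: "g \<in> borel_measurable M" if "g \<in> borel_measurable (F k)" "k \<le> n" for g :: "'a \<Rightarrow> real" and k
    using measurable_from_subalg[OF F that(1)] that by auto
  have V_mono: "V j \<omega> \<le> V k \<omega>" if "j \<le> k" "k \<le> n" for j k \<omega>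
    unfolding V_def using that v0 by (intro sum_mono2) auto
  \<comment> \<open>Where the running total has passed \<open>\<delta>\<close>, the new term is
    zero; elsewhere the truncated sum is dominated by \<open>V\<close>. The bound therefore holds
    for every path.\<close>
  have sumD': "(\<Sum>j<k. (D' j \<omega>)\<^sup>2 * v j) \<le> \<delta>" if "k \<le> n" for k \<omega>
    using that
  proof (induction k)
    case (Suc k)
    show ?case
    proof (cases "V (Suc k) \<omega> \<le> \<delta>")
      case True
      have "(\<Sum>j<Suc k. (D' j \<omega>)\<^sup>2 * v j) \<le> V (Suc k) \<omega>"
        unfolding V_def D'_def using v0 Suc.prems by (intro sum_mono) auto
      with True show ?thesis by simp
    next
      case False
      then have "D' k \<omega> = 0" by (simp add: D'_def)
      with Suc show ?thesis by simp
    qed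
  qed (use \<delta> in simp)
  have D'v: "(D' j \<omega>)\<^sup>2 * v j \<le> \<delta>" if "j < n" for j \<omega>
    using sumD'[of n \<omega>] member_le_sum[of j "{..<n}" "\<lambda>j. (D' j \<omega>)\<^sup>2 * v j"] v0 that by auto
  have D'2: "(D' j \<omega>)\<^sup>2 \<le> (if 0 < v j then \<delta> / v j else 0)" if "j < n" for j \<omega>
    using D'v[OF that, of \<omega>] by (auto simp: D'_def field_simps)
  have D'int: "integrable M (\<lambda>\<omega>. (D' j \<omega>)\<^sup>2)" if "j < n" for j
    using D'F[of j j] D'2 that
    by (intro integrable_const_bound[where B = "if 0 < v j then \<delta> / v j else 0"])
      (auto intro!: MF[of _ j])
  \<comment> \<open>Orthogonality of the increments: the cross term is a function of the past times
    an independent centred variable. Only an inequality remains, because \<open>v\<close> is merely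
    a bound for the variances.\<close>
  have Qint: "integrable M (\<lambda>\<omega>. (Q k \<omega>)\<^sup>2) \<and>
      expectation (\<lambda>\<omega>. (Q k \<omega>)\<^sup>2) \<le> expectation (\<lambda>\<omega>. \<Sum>j<k. (D' j \<omega>)\<^sup>2 * v j)" if "k \<le> n" for k
    using that
  proof (induction k)
    case 0
    then show ?case by (simp add: Q_def)
  next
    case (Suc k)
    then have k: "k < n" and IH: "integrable M (\<lambda>\<omega>. (Q k \<omega>)\<^sup>2)"
      "expectation (\<lambda>\<omega>. (Q k \<omega>)\<^sup>2) \<le> expectation (\<lambda>\<omega>. \<Sum>j<k. (D' j \<omega>)\<^sup>2 * v j)" by auto
    have Qk[measurable]: "Q k \<in> borel_measurable (F k)" and D'k[measurable]: "D' k \<in> borel_measurable (F k)"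
      using QF D'F k by auto
    have Zk[measurable]: "Z k \<in> borel_measurable M" using MF[OF Z[OF k]] k by auto
    have [measurable]: "Q k \<in> borel_measurable M" "D' k \<in> borel_measurable M"
      using MF[OF Qk] MF[OF D'k] k by auto
    have iv: "indep_var borel g borel (Z k)" if "g \<in> borel_measurable (F k)" for g :: "'a \<Rightarrow> real"
      using that k F by (intro indep_var_subalgebra[of "F k"] ind Zk) auto
    have iv2: "indep_var borel g borel (\<lambda>\<omega>. (Z k \<omega>)\<^sup>2)" if "g \<in> borel_measurable (F k)" for g :: "'a \<Rightarrow> real"
      using indep_var_compose[OF iv[OF that], of "\<lambda>x. x" borel "\<lambda>x. x\<^sup>2" borel]
      by (simp add: comp_def)
    have Zint: "integrable M (Z k)"
      by (rule square_integrable_imp_integrable[OF Zk sq[OF k]])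
    \<comment> \<open>A product of two square integrable functions; its integrability is what allows
      the expectation of the cross term to factorise.\<close>
    have QD: "integrable M (\<lambda>\<omega>. Q k \<omega> * D' k \<omega>)"
    proof (rule Bochner_Integration.integrable_bound)
      show "integrable M (\<lambda>\<omega>. (Q k \<omega>)\<^sup>2 + (D' k \<omega>)\<^sup>2)"
        using IH D'int[OF k] by simp
      show "AE \<omega> in M. norm (Q k \<omega> * D' k \<omega>) \<le> norm ((Q k \<omega>)\<^sup>2 + (D' k \<omega>)\<^sup>2)"
      proof (rule AE_I2)
        fix \<omega>
        have "2 * (\<bar>Q k \<omega>\<bar> * \<bar>D' k \<omega>\<bar>) \<le> (Q k \<omega>)\<^sup>2 + (D' k \<omega>)\<^sup>2"
          using sum_squares_bound[of "\<bar>Q k \<omega>\<bar>" "\<bar>D' k \<omega>\<bar>"] by simp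
        moreover have "0 \<le> \<bar>Q k \<omega>\<bar> * \<bar>D' k \<omega>\<bar>" by simp
        ultimately have "\<bar>Q k \<omega>\<bar> * \<bar>D' k \<omega>\<bar> \<le> (Q k \<omega>)\<^sup>2 + (D' k \<omega>)\<^sup>2"
          by linarith
        then show "norm (Q k \<omega> * D' k \<omega>) \<le> norm ((Q k \<omega>)\<^sup>2 + (D' k \<omega>)\<^sup>2)"
          by (simp add: abs_mult)
      qed
    qed measurable
    have cross: "integrable M (\<lambda>\<omega>. (Q k \<omega> * D' k \<omega>) * Z k \<omega>)"
      "expectation (\<lambda>\<omega>. (Q k \<omega> * D' k \<omega>) * Z k \<omega>) = 0"
      using indep_var_integrable[OF iv, of "\<lambda>\<omega>. Q k \<omega> * D' k \<omega>"]
        indep_var_lebesgue_integral[OF iv, of "\<lambda>\<omega>. Q k \<omega> * D' k \<omega>"] QD Zint mean[OF k]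
      by auto
    have sqr: "integrable M (\<lambda>\<omega>. (D' k \<omega>)\<^sup>2 * (Z k \<omega>)\<^sup>2)"
      "expectation (\<lambda>\<omega>. (D' k \<omega>)\<^sup>2 * (Z k \<omega>)\<^sup>2) = expectation (\<lambda>\<omega>. (D' k \<omega>)\<^sup>2) * expectation (\<lambda>\<omega>. (Z k \<omega>)\<^sup>2)"
      using indep_var_integrable[OF iv2, of "\<lambda>\<omega>. (D' k \<omega>)\<^sup>2"]
        indep_var_lebesgue_integral[OF iv2, of "\<lambda>\<omega>. (D' k \<omega>)\<^sup>2"] D'int[OF k] sq[OF k]
      by auto
    have eq: "(Q (Suc k) \<omega>)\<^sup>2 = (Q k \<omega>)\<^sup>2 + 2 * ((Q k \<omega> * D' k \<omega>) * Z k \<omega>) + (D' k \<omega>)\<^sup>2 * (Z k \<omega>)\<^sup>2" for \<omega>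
      by (simp add: Q_def power2_eq_square algebra_simps)
    have "expectation (\<lambda>\<omega>. (Q (Suc k) \<omega>)\<^sup>2)
        = expectation (\<lambda>\<omega>. (Q k \<omega>)\<^sup>2) + expectation (\<lambda>\<omega>. (D' k \<omega>)\<^sup>2) * expectation (\<lambda>\<omega>. (Z k \<omega>)\<^sup>2)"
      unfolding eq using IH cross sqr by simp
    also have "\<dots> \<le> expectation (\<lambda>\<omega>. \<Sum>j<k. (D' j \<omega>)\<^sup>2 * v j) + expectation (\<lambda>\<omega>. (D' k \<omega>)\<^sup>2) * v k"
      using IH var[OF k] by (intro add_mono mult_left_mono) auto
    also have "\<dots> = expectation (\<lambda>\<omega>. \<Sum>j<Suc k. (D' j \<omega>)\<^sup>2 * v j)"
    proof -
      have "integrable M (\<lambda>\<omega>. \<Sum>j<k. (D' j \<omega>)\<^sup>2 * v j)"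
        using D'int k by (intro Bochner_Integration.integrable_sum) auto
      then show ?thesis using D'int k by simp
    qed
    finally show ?case unfolding eq using IH cross sqr by simp
  qed
  have "expectation (\<lambda>\<omega>. \<Sum>j<n. (D' j \<omega>)\<^sup>2 * v j) \<le> expectation (\<lambda>_. \<delta>)"
    using D'int sumD' by (intro integral_mono) auto
  then have EQ: "integrable M (\<lambda>\<omega>. (Q n \<omega>)\<^sup>2)" "expectation (\<lambda>\<omega>. (Q n \<omega>)\<^sup>2) \<le> \<delta>"
    using Qint[of n] by (auto simp: prob_space)
  have [measurable]: "D k \<in> borel_measurable M" "Z k \<in> borel_measurable M" if "k < n" for k
    using MF[OF D[OF that]] MF[OF Z[OF that]] that by auto
  have [measurable]: "V n \<in> borel_measurable M" "(\<lambda>\<omega>. \<Sum>k<n. D k \<omega> * Z k \<omega>) \<in> borel_measurable M"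
    "Q n \<in> borel_measurable M"
    using MF[OF QF[of n]] unfolding V_def
    by (auto intro!: borel_measurable_sum borel_measurable_times borel_measurable_power)
  \<comment> \<open>Below the threshold nothing is cut off and \<open>Q n\<close> is the full sum;
    indices with \<open>v k = 0\<close> contribute nothing, as \<open>Z k\<close> vanishes there.
    Chebyshev's inequality for \<open>Q n\<close> then produces the term
    \<open>\<delta> / e\<^sup>2\<close>.\<close>
  have "{\<omega> \<in> space M. e < \<bar>\<Sum>k<n. D k \<omega> * Z k \<omega>\<bar>} \<subseteq>
      {\<omega> \<in> space M. \<delta> < V n \<omega>} \<union> {\<omega> \<in> space M. e\<^sup>2 \<le> (Q n \<omega>)\<^sup>2}"
  proof clarify
    fix \<omega> assume "\<omega> \<in> space M" and big: "e < \<bar>\<Sum>k<n. D k \<omega> * Z k \<omega>\<bar>"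
      and small: "\<not> e\<^sup>2 \<le> (Q n \<omega>)\<^sup>2"
    have "\<delta> < V n \<omega>"
    proof (rule ccontr)
      assume "\<not> \<delta> < V n \<omega>"
      then have "V (Suc k) \<omega> \<le> \<delta>" if "k < n" for k
        using V_mono[of "Suc k" n \<omega>] that by auto
      then have "D' k \<omega> * Z k \<omega> = D k \<omega> * Z k \<omega>" if "k < n" for k
        using that v[OF that] by (auto simp: D'_def)
      then have "Q n \<omega> = (\<Sum>k<n. D k \<omega> * Z k \<omega>)"
        unfolding Q_def by (intro sum.cong) auto
      with big have "e < \<bar>Q n \<omega>\<bar>" by simp
      then have "e\<^sup>2 \<le> \<bar>Q n \<omega>\<bar>\<^sup>2" using e by (intro power_mono) auto
      with small show False by simp
    qed
    then show "\<delta> < V n \<omega>" .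
  qed
  then have "prob {\<omega> \<in> space M. e < \<bar>\<Sum>k<n. D k \<omega> * Z k \<omega>\<bar>} \<le>
      prob ({\<omega> \<in> space M. \<delta> < V n \<omega>} \<union> {\<omega> \<in> space M. e\<^sup>2 \<le> (Q n \<omega>)\<^sup>2})"
    by (rule finite_measure_mono) measurable
  also have "\<dots> \<le> prob {\<omega> \<in> space M. \<delta> < V n \<omega>} + prob {\<omega> \<in> space M. e\<^sup>2 \<le> (Q n \<omega>)\<^sup>2}"
    by (rule measure_subadditive) (auto simp: emeasure_eq_measure)
  also have "prob {\<omega> \<in> space M. e\<^sup>2 \<le> (Q n \<omega>)\<^sup>2} \<le> expectation (\<lambda>\<omega>. (Q n \<omega>)\<^sup>2) / e\<^sup>2"
    using EQ(1) e by (intro integral_Markov_inequality_measure[where A = "{}"]) auto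
  also have "\<dots> \<le> \<delta> / e\<^sup>2"
    using EQ(2) by (intro divide_right_mono) auto
  finally show ?thesis unfolding V_def by simp
qed

end

section \<open>Moments of isotropic normal vectors\<close>

text \<open>\<open>lborel\<close> on a Euclidean space is the image of a product of one-dimensional
  Lebesgue measures under the coordinate expansion, so Fubini's theorem separates the
  factors.\<close>

lemma integral_prod_normal_density:
  fixes \<phi> :: "'a::euclidean_space \<Rightarrow> real \<Rightarrow> real"
  assumes \<phi>[measurable]: "\<And>b. b \<in> Basis \<Longrightarrow> \<phi> b \<in> borel_measurable borel"
    and int: "\<And>b. b \<in> Basis \<Longrightarrow> integrable lborel (\<lambda>x. normal_density 0 \<sigma> x * \<phi> b x)"
  shows "integrable lborel (\<lambda>x::'a. (\<Prod>b\<in>Basis. normal_density 0 \<sigma> (x \<bullet> b)) * (\<Prod>b\<in>Basis. \<phi> b (x \<bullet> b)))"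
    and "(\<integral>x. (\<Prod>b\<in>Basis. normal_density 0 \<sigma> (x \<bullet> b)) * (\<Prod>b\<in>Basis. \<phi> b (x \<bullet> b)) \<partial>(lborel :: 'a measure))
      = (\<Prod>b\<in>Basis. \<integral>x. normal_density 0 \<sigma> x * \<phi> b x \<partial>lborel)"
proof -
  interpret product_sigma_finite "\<lambda>b::'a. lborel :: real measure" ..
  let ?g = "\<lambda>x::'a. (\<Prod>b\<in>Basis. normal_density 0 \<sigma> (x \<bullet> b)) * (\<Prod>b\<in>Basis. \<phi> b (x \<bullet> b))"
  have g: "?g \<in> borel_measurable borel"
    by (intro borel_measurable_times borel_measurable_prod) auto
  have c: "(\<Sum>b\<in>Basis. f b *\<^sub>R b) \<bullet> b' = f b'" if "b' \<in> Basis" for b' :: 'a and f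
    using that by (simp add: inner_sum_left inner_Basis if_distrib cong: if_cong)
  have eq: "?g (\<Sum>b\<in>Basis. f b *\<^sub>R b) = (\<Prod>b\<in>Basis. normal_density 0 \<sigma> (f b) * \<phi> b (f b))" for f
    by (simp add: c prod.distrib)
  have m: "(\<lambda>f. \<Sum>b\<in>Basis. f b *\<^sub>R b) \<in> (\<Pi>\<^sub>M b\<in>Basis. lborel) \<rightarrow>\<^sub>M (borel :: 'a measure)"
    by measurable
  show "integrable lborel ?g"
    unfolding lborel_eq[where 'a='a]
    by (subst integrable_distr_eq[OF m g]) (auto simp only: eq intro!: product_integrable_prod int finite_Basis)
  show "(\<integral>x. ?g x \<partial>lborel) = (\<Prod>b\<in>Basis. \<integral>x. normal_density 0 \<sigma> x * \<phi> b x \<partial>lborel)"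
    unfolding lborel_eq[where 'a='a]
    by (subst integral_distr[OF m g]) (auto simp only: eq intro!: product_integral_prod int finite_Basis)
qed

lemma normal_moment_4:
  assumes "0 < \<sigma>"
  shows "(\<integral>x. normal_density 0 \<sigma> x * x^4 \<partial>lborel) = 3 * \<sigma>^4"
  using integral_normal_moment_even[OF assms, of 0 2] assms
  by (simp add: fact_numeral field_simps power2_eq_square eval_nat_numeral)

lemma normal_moment_2:
  assumes "0 < \<sigma>"
  shows "(\<integral>x. normal_density 0 \<sigma> x * x\<^sup>2 \<partial>lborel) = \<sigma>\<^sup>2"
  using integral_normal_moment_even[OF assms, of 0 1] assms
  by (simp add: field_simps power2_eq_square)

context prob_space
begin

lemma isotropic_normal_coordinate_moments:
  fixes Z :: "'a \<Rightarrow> 'b::euclidean_space"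
  assumes Z: "distributed M lborel Z (\<lambda>x. ennreal (\<Prod>b\<in>Basis. normal_density 0 \<sigma> (x \<bullet> b)))"
    and \<sigma>: "0 < \<sigma>" and i: "i \<in> Basis"
  shows "integrable M (\<lambda>\<omega>. (Z \<omega> \<bullet> i)^k)"
    and "expectation (\<lambda>\<omega>. (Z \<omega> \<bullet> i)^k) = (\<integral>x. normal_density 0 \<sigma> x * x^k \<partial>lborel)"
proof -
  \<comment> \<open>The test function is 1 in all directions other than \<open>i\<close>, where the
    factors become total masses of normal densities.\<close>
  define \<phi> where "\<phi> b x = (if b = i then x^k else 1 :: real)" for b :: 'b and x :: real
  have prod: "(\<Prod>b\<in>Basis. \<phi> b (x \<bullet> b)) = (x \<bullet> i)^k" for x
    using i by (simp add: \<phi>_def prod.delta)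
  have meas: "\<phi> b \<in> borel_measurable borel" for b unfolding \<phi>_def by measurable
  have int: "integrable lborel (\<lambda>x. normal_density 0 \<sigma> x * \<phi> b x)" for b
    using integrable_normal_moment[OF \<sigma>, of 0 k] integrable_normal_density[OF \<sigma>, of 0]
    by (cases "b = i") (auto simp: \<phi>_def)
  have "(\<Prod>b\<in>Basis. \<integral>x. normal_density 0 \<sigma> x * \<phi> b x \<partial>lborel)
      = (\<Prod>b\<in>(Basis::'b set). if b = i then \<integral>x. normal_density 0 \<sigma> x * x^k \<partial>lborel else 1)"
    by (intro prod.cong) (auto simp: \<phi>_def \<sigma>)
  then have pe: "(\<Prod>b\<in>Basis. \<integral>x. normal_density 0 \<sigma> x * \<phi> b x \<partial>lborel) = (\<integral>x. normal_density 0 \<sigma> x * x^k \<partial>lborel)"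
    using i by (simp add: prod.delta)
  have nn: "0 \<le> (\<Prod>b\<in>Basis. normal_density 0 \<sigma> (x \<bullet> b))" for x :: 'b
    by (intro prod_nonneg) auto
  have m: "(\<lambda>x. (x \<bullet> i)^k) \<in> borel_measurable lborel" by measurable
  show "integrable M (\<lambda>\<omega>. (Z \<omega> \<bullet> i)^k)"
    using integral_prod_normal_density(1)[of \<phi>, OF meas int, unfolded prod]
    by (subst distributed_integrable[OF Z m nn, symmetric]) auto
  show "expectation (\<lambda>\<omega>. (Z \<omega> \<bullet> i)^k) = (\<integral>x. normal_density 0 \<sigma> x * x^k \<partial>lborel)"
    using integral_prod_normal_density(2)[of \<phi>, OF meas int, unfolded prod pe]
    by (subst distributed_integral[OF Z m nn, symmetric]) auto
qed

lemma isotropic_normal_uncorrelated: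
  fixes Z :: "'a \<Rightarrow> 'b::euclidean_space"
  assumes Z: "distributed M lborel Z (\<lambda>x. ennreal (\<Prod>b\<in>Basis. normal_density 0 \<sigma> (x \<bullet> b)))"
    and \<sigma>: "0 < \<sigma>" and i: "i \<in> Basis" and j: "j \<in> Basis" and ij: "i \<noteq> j"
  shows "expectation (\<lambda>\<omega>. (Z \<omega> \<bullet> i) * (Z \<omega> \<bullet> j)) = 0"
proof -
  define \<phi> where "\<phi> b x = (if b = i \<or> b = j then x else 1 :: real)" for b :: 'b and x :: real
  have prod: "(\<Prod>b\<in>Basis. \<phi> b (x \<bullet> b)) = (x \<bullet> i) * (x \<bullet> j)" for x
  proof -
    have "(\<Prod>b\<in>Basis. \<phi> b (x \<bullet> b)) = (\<Prod>b\<in>{i,j}. \<phi> b (x \<bullet> b))"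
      using i j by (intro prod.mono_neutral_right) (auto simp: \<phi>_def)
    then show ?thesis using ij by (simp add: \<phi>_def)
  qed
  have meas: "\<phi> b \<in> borel_measurable borel" for b unfolding \<phi>_def by measurable
  have int: "integrable lborel (\<lambda>x. normal_density 0 \<sigma> x * \<phi> b x)" for b
    using integrable_normal_moment[OF \<sigma>, of 0 1] integrable_normal_density[OF \<sigma>, of 0]
    by (cases "b = i \<or> b = j") (auto simp: \<phi>_def)
  \<comment> \<open>The factor in direction \<open>i\<close> is a first moment, hence zero, and
    annihilates the whole product.\<close>
  have "(\<integral>x. normal_density 0 \<sigma> x * \<phi> i x \<partial>lborel) = 0"
    using integral_normal_moment_odd[OF \<sigma>, of 0 0] by (simp add: \<phi>_def)
  then have pe: "(\<Prod>b\<in>Basis. \<integral>x. normal_density 0 \<sigma> x * \<phi> b x \<partial>lborel) = 0"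
    using i by auto
  have nn: "0 \<le> (\<Prod>b\<in>Basis. normal_density 0 \<sigma> (x \<bullet> b))" for x :: 'b
    by (intro prod_nonneg) auto
  have m: "(\<lambda>x. (x \<bullet> i) * (x \<bullet> j)) \<in> borel_measurable lborel" by measurable
  show ?thesis
    using integral_prod_normal_density(2)[of \<phi>, OF meas int, unfolded prod pe]
    by (subst distributed_integral[OF Z m nn, symmetric]) auto
qed

text \<open>Controls the fluctuation of products of Brownian increments. The second moment is of
  second order in \<open>v\<close>, so its sum over a partition is of the order of the mesh. The
  constant is 8 = 3 + 3 + 2: a fourth moment \<open>3 * v\<^sup>2\<close> for each coordinate and
  \<open>2 * v\<^sup>2\<close> from the centring.\<close>

lemma isotropic_normal_product_deviation:
  fixes Z :: "'a \<Rightarrow> 'b::euclidean_space" and v :: real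
  assumes Z: "distributed M lborel Z (\<lambda>x. ennreal (\<Prod>b\<in>Basis. normal_density 0 (sqrt v) (x \<bullet> b)))"
    and v: "0 < v" and i: "i \<in> Basis" and j: "j \<in> Basis"
  defines "Y \<equiv> \<lambda>\<omega>. (Z \<omega> \<bullet> i) * (Z \<omega> \<bullet> j) - (if i = j then v else 0)"
  shows "expectation Y = 0" "integrable M (\<lambda>\<omega>. (Y \<omega>)\<^sup>2)" "expectation (\<lambda>\<omega>. (Y \<omega>)\<^sup>2) \<le> 8 * v\<^sup>2"
proof -
  have s: "0 < sqrt v" using v by simp
  have [measurable]: "Z \<in> borel_measurable M"
    using distributed_measurable[OF Z] by simp
  note mom = isotropic_normal_coordinate_moments[OF Z s]
  have m2: "integrable M (\<lambda>\<omega>. (Z \<omega> \<bullet> b)\<^sup>2)" "expectation (\<lambda>\<omega>. (Z \<omega> \<bullet> b)\<^sup>2) = v" if "b \<in> Basis" for b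
    using mom[OF that, of 2] v by (auto simp: normal_moment_2)
  have m4: "integrable M (\<lambda>\<omega>. (Z \<omega> \<bullet> b)^4)" "expectation (\<lambda>\<omega>. (Z \<omega> \<bullet> b)^4) = 3 * v\<^sup>2" if "b \<in> Basis" for b
  proof -
    have "sqrt v ^ 4 = ((sqrt v)\<^sup>2)\<^sup>2" by (simp only: power_mult[symmetric]) simp
    then show "integrable M (\<lambda>\<omega>. (Z \<omega> \<bullet> b)^4)" "expectation (\<lambda>\<omega>. (Z \<omega> \<bullet> b)^4) = 3 * v\<^sup>2"
      using mom[OF that, of 4] v by (auto simp: normal_moment_4)
  qed
  have ab: "\<bar>x * y\<bar> \<le> x\<^sup>2 + y\<^sup>2" for x y :: real
  proof -
    have "2 * (\<bar>x\<bar> * \<bar>y\<bar>) \<le> x\<^sup>2 + y\<^sup>2"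
      using sum_squares_bound[of "\<bar>x\<bar>" "\<bar>y\<bar>"] by simp
    moreover have "0 \<le> \<bar>x\<bar> * \<bar>y\<bar>" by simp
    ultimately have "\<bar>x\<bar> * \<bar>y\<bar> \<le> x\<^sup>2 + y\<^sup>2" by linarith
    then show ?thesis by (simp add: abs_mult)
  qed
  have ZZ: "integrable M (\<lambda>\<omega>. (Z \<omega> \<bullet> i) * (Z \<omega> \<bullet> j))"
  proof (rule Bochner_Integration.integrable_bound)
    show "integrable M (\<lambda>\<omega>. (Z \<omega> \<bullet> i)\<^sup>2 + (Z \<omega> \<bullet> j)\<^sup>2)"
      using m2 i j by simp
  qed (auto intro!: ab AE_I2 order_trans[OF ab])
  show "expectation Y = 0"
  proof (cases "i = j")
    case True
    then show ?thesis using m2[OF i] by (simp add: Y_def power2_eq_square prob_space)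
  next
    case False
    then show ?thesis using isotropic_normal_uncorrelated[OF Z s i j] by (simp add: Y_def)
  qed
  have Y2: "(Y \<omega>)\<^sup>2 \<le> (Z \<omega> \<bullet> i)^4 + (Z \<omega> \<bullet> j)^4 + 2 * v\<^sup>2" for \<omega>
  proof -
    define x where "x = Z \<omega> \<bullet> i"
    define y where "y = Z \<omega> \<bullet> j"
    define c where "c = (if i = j then v else 0)"
    have "(x * y - c)\<^sup>2 \<le> 2 * (x * y)\<^sup>2 + 2 * c\<^sup>2"
      using zero_le_power2[of "x * y + c"] by (simp add: power2_eq_square algebra_simps)
    moreover have "2 * (x * y)\<^sup>2 \<le> x^4 + y^4"
      using zero_le_power2[of "x\<^sup>2 - y\<^sup>2"] by (simp add: power2_eq_square power4_eq_xxxx algebra_simps)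
    moreover have "c\<^sup>2 \<le> v\<^sup>2" by (simp add: c_def)
    ultimately have "(x * y - c)\<^sup>2 \<le> x^4 + y^4 + 2 * v\<^sup>2" by linarith
    then show ?thesis by (simp only: Y_def x_def y_def c_def)
  qed
  have dom: "integrable M (\<lambda>\<omega>. (Z \<omega> \<bullet> i)^4 + (Z \<omega> \<bullet> j)^4 + 2 * v\<^sup>2)"
    using m4 i j by simp
  have [measurable]: "Y \<in> borel_measurable M" unfolding Y_def by measurable
  show int: "integrable M (\<lambda>\<omega>. (Y \<omega>)\<^sup>2)"
    using Y2 by (intro Bochner_Integration.integrable_bound[OF dom]) (auto intro!: AE_I2 order_trans[OF Y2])
  have "expectation (\<lambda>\<omega>. (Y \<omega>)\<^sup>2) \<le> expectation (\<lambda>\<omega>. (Z \<omega> \<bullet> i)^4 + (Z \<omega> \<bullet> j)^4 + 2 * v\<^sup>2)"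
    by (rule integral_mono[OF int dom Y2])
  also have "\<dots> = 8 * v\<^sup>2"
    using m4 i j by (simp add: prob_space)
  finally show "expectation (\<lambda>\<omega>. (Y \<omega>)\<^sup>2) \<le> 8 * v\<^sup>2" .
qed

end

section \<open>Common refinements\<close>

text \<open>Partitions may repeat points. Listing the finite set of all points in increasing order
  removes the repetitions, and strict growth lets a time point of the refinement determine its
  index.\<close>

lemma common_refinement:
  fixes u v :: "nat \<Rightarrow> real"
  assumes u: "fine_partition d s t n u" and v: "fine_partition d' s t m v"
  obtains N w where "w 0 = s" "w N = t" "\<And>k. k < N \<Longrightarrow> w k < w (Suc k)"
    "u ` {..n} \<subseteq> w ` {..N}" "v ` {..m} \<subseteq> w ` {..N}"
proof -
  define P where "P = u ` {..n} \<union> v ` {..m}"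
  have P: "finite P" "P \<noteq> {}" by (auto simp: P_def)
  define xs where "xs = sorted_list_of_set P"
  have xs: "set xs = P" "sorted_wrt (<) xs" "xs \<noteq> []"
    using P by (auto simp: xs_def)
  define N where "N = length xs - 1"
  have len: "length xs = Suc N" using xs by (cases xs) (auto simp: N_def)
  have img: "(!) xs ` {..N} = P"
    using xs(1) len by (auto simp: set_conv_nth less_Suc_eq_le)
  have st: "s \<in> P" "t \<in> P" "P \<subseteq> {s..t}"
    using u v fine_partition_mem[OF u] fine_partition_mem[OF v]
    by (force simp: P_def fine_partition_def)+
  have less: "xs ! i < xs ! j" if "i < j" "j \<le> N" for i j
    using xs(2) that len by (simp add: sorted_wrt_iff_nth_less)
  have le: "xs ! i \<le> xs ! j" if "i \<le> j" "j \<le> N" for i j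
    using less[of i j] that by (cases "i = j") auto
  have w0: "xs ! 0 = s"
  proof -
    obtain i where "i \<le> N" "xs ! i = s" using st(1) img by force
    then have "xs ! 0 \<le> s" using le[of 0 i] by simp
    moreover have "xs ! 0 \<in> P" using img by force
    ultimately show ?thesis using st(3) by force
  qed
  have wN: "xs ! N = t"
  proof -
    obtain i where "i \<le> N" "xs ! i = t" using st(2) img by force
    then have "t \<le> xs ! N" using le[of i N] by simp
    moreover have "xs ! N \<in> P" using img by force
    ultimately show ?thesis using st(3) by force
  qed
  show ?thesis
    by (rule that[of "(!) xs" N, OF w0 wN]) (use less img in \<open>auto simp: P_def\<close>)
qed

text \<open>Cells are open on the left and closed on the right, with the value taken at the right
  end. At the right end of a finer cell this returns the value that the coarse right sum uses, and
  repeated points give empty cells.\<close>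

definition step_process :: "(real \<Rightarrow> 'w \<Rightarrow> 'v::real_vector) \<Rightarrow> nat \<Rightarrow> (nat \<Rightarrow> real) \<Rightarrow> real \<Rightarrow> 'w \<Rightarrow> 'v" where
  "step_process H n u r \<omega> = (\<Sum>k<n. if u k < r \<and> r \<le> u (Suc k) then H (u (Suc k)) \<omega> else 0)"

lemma step_process_eq:
  fixes H :: "real \<Rightarrow> 'w \<Rightarrow> 'v::real_vector"
  assumes "fine_partition d s t n u" "s < r" "r \<le> t"
  obtains k where "k < n" "u k < r" "r \<le> u (Suc k)"
    "\<And>\<omega>. step_process H n u r \<omega> = H (u (Suc k)) \<omega>"
proof -
  \<comment> \<open>The earliest cell whose right end reaches \<open>r\<close>; minimality yields
    \<open>u k < r\<close>, and monotonicity of \<open>u\<close> yields uniqueness.\<close>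
  define k where "k = (LEAST k. r \<le> u (Suc k))"
  have n: "n \<noteq> 0" using assms by (cases n) (auto simp: fine_partition_def)
  then have ex: "r \<le> u (Suc (n - 1))" using assms by (simp add: fine_partition_def)
  have 1: "r \<le> u (Suc k)" unfolding k_def by (rule LeastI[of "\<lambda>k. r \<le> u (Suc k)", OF ex])
  have kn: "k < n" using Least_le[of "\<lambda>k. r \<le> u (Suc k)", OF ex] n unfolding k_def by simp
  have 2: "u k < r"
  proof (cases k)
    case 0
    then show ?thesis using assms by (simp add: fine_partition_def)
  next
    case (Suc l)
    then have "\<not> r \<le> u (Suc l)" using not_less_Least[of l "\<lambda>k. r \<le> u (Suc k)"] by (simp add: k_def)
    with Suc show ?thesis by simp
  qed
  have uniq: "j = k" if "j < n" "u j < r" "r \<le> u (Suc j)" for j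
  proof (rule antisym)
    show "k \<le> j" unfolding k_def by (rule Least_le) fact
    show "j \<le> k"
    proof (rule ccontr)
      assume "\<not> j \<le> k"
      then have "u (Suc k) \<le> u j" using fine_partition_le[OF assms(1), of "Suc k" j] that by simp
      with 1 that show False by simp
    qed
  qed
  have "step_process H n u r \<omega> = (\<Sum>j<n. if j = k then H (u (Suc k)) \<omega> else 0)" for \<omega>
    unfolding step_process_def
  proof (rule sum.cong[OF refl])
    fix j assume "j \<in> {..<n}"
    then show "(if u j < r \<and> r \<le> u (Suc j) then H (u (Suc j)) \<omega> else 0) = (if j = k then H (u (Suc k)) \<omega> else 0)"
      using uniq[of j] 1 2 by (cases "j = k") auto
  qed
  then have "step_process H n u r \<omega> = H (u (Suc k)) \<omega>" for \<omega>
    using kn by simp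
  then show ?thesis by (rule that[OF kn 2 1])
qed

text \<open>A coarse increment telescopes over the fine cells inside it. Membership is expressed by
  conditions on time points rather than on index ranges, so that exchanging the two sums directly
  yields the step process.\<close>

lemma right_sum_refinement:
  fixes H X :: "real \<Rightarrow> 'w \<Rightarrow> 'a::euclidean_space"
  assumes u: "fine_partition d s t n u"
    and w: "\<And>k. k < N \<Longrightarrow> w k < w (Suc k)" and sub: "u ` {..n} \<subseteq> w ` {..N}"
  shows "right_sum (\<bullet>) H X n u \<omega> = right_sum (\<bullet>) (step_process H n u) X N w \<omega>"
proof -
  have less: "w i < w j" if "i < j" "j \<le> N" for i j
    using that
  proof (induction j)
    case (Suc j)
    then show ?case using w[of j] by (cases "i = j") (auto intro: less_trans)
  qed simp
  \<comment> \<open>All increments are measured from the common origin \<open>w 0\<close>; a coarse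
    increment is then a difference of two such sums over the same index set.\<close>
  have inc: "(\<Sum>i<N. if w (Suc i) \<le> r then X (w (Suc i)) \<omega> - X (w i) \<omega> else 0) = X r \<omega> - X (w 0) \<omega>"
    if r: "r \<in> w ` {..N}" for r
  proof -
    obtain j where j: "j \<le> N" "r = w j" using r by auto
    have iff: "w (Suc i) \<le> r \<longleftrightarrow> i < j" if "i < N" for i
      using less[of "Suc i" j] less[of j "Suc i"] that j by (cases "Suc i" j rule: linorder_cases) auto
    have "(\<Sum>i<N. if w (Suc i) \<le> r then X (w (Suc i)) \<omega> - X (w i) \<omega> else 0)
        = (\<Sum>i<N. if i < j then X (w (Suc i)) \<omega> - X (w i) \<omega> else 0)"
      using iff by (intro sum.cong) auto
    also have "\<dots> = (\<Sum>i<j. X (w (Suc i)) \<omega> - X (w i) \<omega>)"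
      using j by (intro sum.mono_neutral_cong_right) auto
    also have "\<dots> = X r \<omega> - X (w 0) \<omega>"
      by (subst sum_lessThan_telescope) (simp add: j)
    finally show ?thesis .
  qed
  have "right_sum (\<bullet>) H X n u \<omega> = (\<Sum>k<n. \<Sum>i<N.
      (if u k < w (Suc i) \<and> w (Suc i) \<le> u (Suc k) then H (u (Suc k)) \<omega> else 0) \<bullet> (X (w (Suc i)) \<omega> - X (w i) \<omega>))"
    unfolding right_sum_def
  proof (rule sum.cong[OF refl])
    fix k assume k: "k \<in> {..<n}"
    then have uk: "u k \<le> u (Suc k)" using u by (simp add: fine_partition_def)
    have "X (u (Suc k)) \<omega> - X (u k) \<omega> = (X (u (Suc k)) \<omega> - X (w 0) \<omega>) - (X (u k) \<omega> - X (w 0) \<omega>)"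
      by simp
    also have "\<dots> = (\<Sum>i<N. if w (Suc i) \<le> u (Suc k) then X (w (Suc i)) \<omega> - X (w i) \<omega> else 0)
        - (\<Sum>i<N. if w (Suc i) \<le> u k then X (w (Suc i)) \<omega> - X (w i) \<omega> else 0)"
      using sub k by (subst (1 2) inc) auto
    also have "\<dots> = (\<Sum>i<N. if u k < w (Suc i) \<and> w (Suc i) \<le> u (Suc k) then X (w (Suc i)) \<omega> - X (w i) \<omega> else 0)"
      unfolding sum_subtractf[symmetric] using uk by (intro sum.cong) auto
    finally show "H (u (Suc k)) \<omega> \<bullet> (X (u (Suc k)) \<omega> - X (u k) \<omega>) = (\<Sum>i<N.
      (if u k < w (Suc i) \<and> w (Suc i) \<le> u (Suc k) then H (u (Suc k)) \<omega> else 0) \<bullet> (X (w (Suc i)) \<omega> - X (w i) \<omega>))"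
      by (simp add: inner_sum_right if_distrib if_distribR cong: if_cong)
  qed
  also have "\<dots> = right_sum (\<bullet>) (step_process H n u) X N w \<omega>"
    unfolding right_sum_def step_process_def inner_sum_left by (rule sum.swap)
  finally show ?thesis .
qed

section \<open>Backward integrals along a reversed diffusion\<close>

lemma continuous_on_interval_bound:
  fixes f :: "real \<Rightarrow> 'b::real_normed_vector"
  assumes "continuous_on {s..t} f"
  obtains B where "\<And>r. r \<in> {s..t} \<Longrightarrow> norm (f r) \<le> B"
proof -
  have "bounded (f ` {s..t})"
    by (intro compact_imp_bounded compact_continuous_image assms) simp
  then show ?thesis using that unfolding bounded_iff by blast
qed

context prob_space
begin

text \<open>For partition steps of length zero: there the Brownian increment is constant, while the
  independence in the definition of Brownian motion concerns strictly increasing times.\<close>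

lemma indep_set_const:
  assumes "A \<subseteq> events"
  shows "indep_set A (sets (vimage_algebra (space M) (\<lambda>_. c) borel))"
proof -
  let ?V = "sets (vimage_algebra (space M) (\<lambda>_. c) borel)"
  have B: "b = {} \<or> b = space M" if "b \<in> ?V" for b
  proof -
    have "?V = {(\<lambda>_. c) -` B \<inter> space M | B. B \<in> sets borel}"
      by (rule sets_vimage_algebra2) simp
    with that obtain B where "b = (\<lambda>_. c) -` B \<inter> space M" by blast
    then show ?thesis by (cases "c \<in> B") auto
  qed
  have "?V \<subseteq> events" using B by blast
  moreover have "prob (a \<inter> b) = prob a * prob b" if "a \<in> A" "b \<in> ?V" for a b
  proof -
    have "a \<inter> space M = a" using assms sets.sets_into_space that(1) by blast
    then show ?thesis using B[OF that(2)] by (elim disjE) (simp_all add: prob_space)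
  qed
  ultimately show ?thesis unfolding indep_sets2_eq using assms by blast
qed

lemma indep_set_vimage_compose:
  assumes ind: "indep_set A (sets (vimage_algebra (space M) Z borel))"
    and g: "g \<in> borel_measurable borel"
  shows "indep_set A (sets (vimage_algebra (space M) (\<lambda>\<omega>. g (Z \<omega>)) borel))"
proof -
  have "sets (vimage_algebra (space M) (\<lambda>\<omega>. g (Z \<omega>)) borel) \<subseteq> sets (vimage_algebra (space M) Z borel)"
  proof
    fix b assume "b \<in> sets (vimage_algebra (space M) (\<lambda>\<omega>. g (Z \<omega>)) borel)"
    then obtain B where B: "B \<in> sets borel" "b = (\<lambda>\<omega>. g (Z \<omega>)) -` B \<inter> space M"
      by (subst (asm) sets_vimage_algebra2) auto
    have "g -` B \<in> sets borel" using measurable_sets[OF g B(1)] by simp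
    moreover have "b = Z -` (g -` B) \<inter> space M" using B by auto
    ultimately show "b \<in> sets (vimage_algebra (space M) Z borel)"
      by (subst sets_vimage_algebra2) auto
  qed
  with ind show ?thesis
    unfolding indep_set_def by (elim indep_sets_mono_sets) (auto split: bool.splits)
qed

end

text \<open>
  Of the stochastic differential equation for \<open>X\<close> only \<open>X_increment\<close> is kept: up to an error that is
  linear in the length of the time step, with a random constant \<open>C\<close>, an increment of \<open>X\<close> is the
  increment of \<open>W\<close> scaled by \<open>\<epsilon>\<close> at the later time point, the one at which backward sums evaluate.
\<close>

locale reversed_diffusion = prob_space M
  for M :: "'w measure" +
  fixes G :: "real \<Rightarrow> 'w measure" and W X :: "real \<Rightarrow> 'w \<Rightarrow> 'a::euclidean_space"
    and \<epsilon> :: "real \<Rightarrow> real" and s t :: real and C :: "'w \<Rightarrow> real"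
  assumes interval: "s \<le> t"
    and sub: "subalgebra M (G r)"
    and anti: "r \<le> u \<Longrightarrow> sets (G u) \<subseteq> sets (G r)"
    and W_adapted: "r \<in> {s..t} \<Longrightarrow> W r \<in> borel_measurable (G r)"
    and X_adapted: "r \<in> {s..t} \<Longrightarrow> X r \<in> borel_measurable (G r)"
    and W_cont: "AE \<omega> in M. continuous_on {s..t} (\<lambda>r. W r \<omega>)"
    and X_cont: "AE \<omega> in M. continuous_on {s..t} (\<lambda>r. X r \<omega>)"
    and W_normal: "s \<le> r \<Longrightarrow> r < u \<Longrightarrow> u \<le> t \<Longrightarrow> distributed M lborel (\<lambda>\<omega>. W r \<omega> - W u \<omega>)
          (\<lambda>x. ennreal (\<Prod>b\<in>Basis. normal_density 0 (sqrt (u - r)) (x \<bullet> b)))"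
    and W_indep: "s \<le> r \<Longrightarrow> r < u \<Longrightarrow> u \<le> t \<Longrightarrow>
        indep_set (sets (G u)) (sets (vimage_algebra (space M) (\<lambda>\<omega>. W r \<omega> - W u \<omega>) borel))"
    and \<epsilon>_cont: "continuous_on {s..t} \<epsilon>"
    and C_nonneg: "0 \<le> C \<omega>"
    and X_increment: "s \<le> r \<Longrightarrow> r \<le> u \<Longrightarrow> u \<le> t \<Longrightarrow>
        AE \<omega> in M. norm (X u \<omega> - X r \<omega> - \<epsilon> u *\<^sub>R (W u \<omega> - W r \<omega>)) \<le> C \<omega> * (u - r)"
begin

text \<open>The weight is studied on every interval ending at the terminal time; one and the same
  random constant \<open>C\<close> serves all of them.\<close>

lemma subinterval:
  assumes "s \<le> s'" "s' \<le> t"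
  shows "reversed_diffusion M G W X \<epsilon> s' t C"
proof (unfold_locales)
  have sub': "{s'..t} \<subseteq> {s..t}" using assms by auto
  show "AE \<omega> in M. continuous_on {s'..t} (\<lambda>r. W r \<omega>)"
    using W_cont by eventually_elim (rule continuous_on_subset[OF _ sub'])
  show "AE \<omega> in M. continuous_on {s'..t} (\<lambda>r. X r \<omega>)"
    using X_cont by eventually_elim (rule continuous_on_subset[OF _ sub'])
  show "continuous_on {s'..t} \<epsilon>"
    by (rule continuous_on_subset[OF \<epsilon>_cont sub'])
  show "s' \<le> t" by fact
  show "subalgebra M (G r)" for r by (rule sub)
  show "r \<le> u \<Longrightarrow> sets (G u) \<subseteq> sets (G r)" for r u by (rule anti)
  show "W r \<in> borel_measurable (G r)" "X r \<in> borel_measurable (G r)" if "r \<in> {s'..t}" for r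
    using that sub' W_adapted X_adapted by blast+
  show "distributed M lborel (\<lambda>\<omega>. W r \<omega> - W u \<omega>)
      (\<lambda>x. ennreal (\<Prod>b\<in>Basis. normal_density 0 (sqrt (u - r)) (x \<bullet> b)))"
    "indep_set (sets (G u)) (sets (vimage_algebra (space M) (\<lambda>\<omega>. W r \<omega> - W u \<omega>) borel))"
    if "s' \<le> r" "r < u" "u \<le> t" for r u
    using order_trans[OF assms(1) that(1)] that(2,3) W_normal W_indep by blast+
  show "0 \<le> C \<omega>" for \<omega> by (rule C_nonneg)
  show "AE \<omega> in M. norm (X u \<omega> - X r \<omega> - \<epsilon> u *\<^sub>R (W u \<omega> - W r \<omega>)) \<le> C \<omega> * (u - r)"
    if "s' \<le> r" "r \<le> u" "u \<le> t" for r u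
    using order_trans[OF assms(1) that(1)] that(2,3) by (rule X_increment)
qed

section \<open>Martingale estimates in reversed time\<close>

lemma adapted_mono:
  assumes "g \<in> borel_measurable (G u)" "r \<le> u"
  shows "g \<in> borel_measurable (G r)"
  using assms anti[of r u] sub[of r] sub[of u] by (auto simp: measurable_def subalgebra_def)

lemma adapted_measurable: "g \<in> borel_measurable (G u) \<Longrightarrow> g \<in> borel_measurable M"
  by (rule measurable_from_subalg[OF sub])

lemma W_measurable: "r \<in> {s..t} \<Longrightarrow> W r \<in> borel_measurable M"
  and X_measurable: "r \<in> {s..t} \<Longrightarrow> X r \<in> borel_measurable M"
  using adapted_measurable W_adapted X_adapted by blast+

lemma W_indep_compose:
  assumes "s \<le> r" "r \<le> u" "u \<le> t" and g: "g \<in> borel_measurable borel"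
  shows "indep_set (sets (G u)) (sets (vimage_algebra (space M) (\<lambda>\<omega>. g (W r \<omega> - W u \<omega>)) borel))"
proof (cases "r = u")
  case True
  then show ?thesis using sub[of u] by (auto simp: subalgebra_def intro: indep_set_const)
next
  case False
  then show ?thesis
    using assms by (intro indep_set_vimage_compose[where g = g] W_indep) auto
qed

text \<open>With \<open>F k = G (w (n - k))\<close> the filtration increases in \<open>k\<close>,
  and the order of summation is reversed accordingly. The integrand at the right end
  \<open>w (Suc k)\<close> is known before the increment down to \<open>w k\<close> is seen.\<close>

lemma prob_backward_transform_le:
  fixes D Z :: "nat \<Rightarrow> 'w \<Rightarrow> real" and v w :: "nat \<Rightarrow> real"
  assumes w: "\<And>k. k < n \<Longrightarrow> w k \<le> w (Suc k)"
    and D: "\<And>k. k < n \<Longrightarrow> D k \<in> borel_measurable (G (w (Suc k)))"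
    and Z: "\<And>k. k < n \<Longrightarrow> Z k \<in> borel_measurable (G (w k))"
    and ind: "\<And>k. k < n \<Longrightarrow> indep_set (sets (G (w (Suc k)))) (sets (vimage_algebra (space M) (Z k) borel))"
    and mean: "\<And>k. k < n \<Longrightarrow> expectation (Z k) = 0"
    and sq: "\<And>k. k < n \<Longrightarrow> integrable M (\<lambda>\<omega>. (Z k \<omega>)\<^sup>2)"
    and var: "\<And>k. k < n \<Longrightarrow> expectation (\<lambda>\<omega>. (Z k \<omega>)\<^sup>2) \<le> v k"
    and v: "\<And>k. k < n \<Longrightarrow> 0 < v k \<or> (\<forall>\<omega>. Z k \<omega> = 0)"
    and e: "0 < e" and \<delta>: "0 \<le> \<delta>"
  shows "prob {\<omega> \<in> space M. e < \<bar>\<Sum>k<n. D k \<omega> * Z k \<omega>\<bar>}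
    \<le> prob {\<omega> \<in> space M. \<delta> < (\<Sum>k<n. (D k \<omega>)\<^sup>2 * v k)} + \<delta> / e\<^sup>2"
proof -
  have w_mono: "w j \<le> w k" if "j \<le> k" "k \<le> n" for j k
    using that
  proof (induction k rule: dec_induct)
    case (step i)
    then show ?case using w[of i] by simp
  qed simp
  have rev: "(\<Sum>k<n. g (n - Suc k)) = (\<Sum>k<n. g k)" for g :: "nat \<Rightarrow> real"
    by (rule sum.nat_diff_reindex)
  have S: "Suc (n - Suc k) = n - k" if "k < n" for k using that by simp
  have "prob {\<omega> \<in> space M. e < \<bar>\<Sum>k<n. D (n - Suc k) \<omega> * Z (n - Suc k) \<omega>\<bar>}
    \<le> prob {\<omega> \<in> space M. \<delta> < (\<Sum>k<n. (D (n - Suc k) \<omega>)\<^sup>2 * v (n - Suc k))} + \<delta> / e\<^sup>2"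
  proof (rule prob_martingale_transform_le[where F = "\<lambda>k. G (w (n - k))"])
    fix k assume k: "k < n"
    then have k': "n - Suc k < n" by simp
    show "D (n - Suc k) \<in> borel_measurable (G (w (n - k)))" using D[OF k'] S[OF k] by simp
    show "Z (n - Suc k) \<in> borel_measurable (G (w (n - Suc k)))" using Z[OF k'] .
    show "indep_set (sets (G (w (n - k)))) (sets (vimage_algebra (space M) (Z (n - Suc k)) borel))"
      using ind[OF k'] S[OF k] by simp
    show "expectation (Z (n - Suc k)) = 0" "integrable M (\<lambda>\<omega>. (Z (n - Suc k) \<omega>)\<^sup>2)"
      "expectation (\<lambda>\<omega>. (Z (n - Suc k) \<omega>)\<^sup>2) \<le> v (n - Suc k)"
      "0 < v (n - Suc k) \<or> (\<forall>\<omega>. Z (n - Suc k) \<omega> = 0)"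
      using mean sq var v k' by blast+
  qed (use w_mono e \<delta> sub anti in auto)
  then show ?thesis
    by (simp only: rev[of "\<lambda>k. D k \<omega> * Z k \<omega>" for \<omega>] rev[of "\<lambda>k. (D k \<omega>)\<^sup>2 * v k" for \<omega>])
qed

lemma vanishes_in_prob_backward_transform:
  fixes D Z :: "nat \<Rightarrow> nat \<Rightarrow> 'w \<Rightarrow> real" and v w :: "nat \<Rightarrow> nat \<Rightarrow> real"
  assumes w: "\<And>m k. k < n m \<Longrightarrow> w m k \<le> w m (Suc k)"
    and D: "\<And>m k. k < n m \<Longrightarrow> D m k \<in> borel_measurable (G (w m (Suc k)))"
    and Z: "\<And>m k. k < n m \<Longrightarrow> Z m k \<in> borel_measurable (G (w m k))"
    and ind: "\<And>m k. k < n m \<Longrightarrow> indep_set (sets (G (w m (Suc k)))) (sets (vimage_algebra (space M) (Z m k) borel))"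
    and mean: "\<And>m k. k < n m \<Longrightarrow> expectation (Z m k) = 0"
    and sq: "\<And>m k. k < n m \<Longrightarrow> integrable M (\<lambda>\<omega>. (Z m k \<omega>)\<^sup>2)"
    and var: "\<And>m k. k < n m \<Longrightarrow> expectation (\<lambda>\<omega>. (Z m k \<omega>)\<^sup>2) \<le> v m k"
    and v: "\<And>m k. k < n m \<Longrightarrow> 0 < v m k \<or> (\<forall>\<omega>. Z m k \<omega> = 0)"
    and lim: "AE \<omega> in M. (\<lambda>m. \<Sum>k<n m. (D m k \<omega>)\<^sup>2 * v m k) \<longlonglongrightarrow> 0"
  shows "vanishes_in_prob M (\<lambda>m \<omega>. \<Sum>k<n m. D m k \<omega> * Z m k \<omega>)"
  unfolding vanishes_in_prob_def
proof (intro conjI allI impI)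
  have DM: "D m k \<in> borel_measurable M" "Z m k \<in> borel_measurable M" if "k < n m" for m k
    using D[OF that] Z[OF that] adapted_measurable by blast+
  show "(\<lambda>\<omega>. \<Sum>k<n m. D m k \<omega> * Z m k \<omega>) \<in> borel_measurable M" for m
    using DM by (intro borel_measurable_sum borel_measurable_times) auto
  fix e :: real assume e: "0 < e"
  define V where "V m \<omega> = (\<Sum>k<n m. (D m k \<omega>)\<^sup>2 * v m k)" for m \<omega>
  have V0: "0 \<le> V m \<omega>" for m \<omega>
    unfolding V_def
  proof (intro sum_nonneg mult_nonneg_nonneg)
    fix k assume "k \<in> {..<n m}"
    then show "0 \<le> v m k" by (intro order_trans[OF _ var]) auto
  qed auto
  have "vanishes_in_prob M V"
    unfolding V_def using DM lim
    by (intro vanishes_in_prob_AE borel_measurable_sum borel_measurable_times borel_measurable_power) auto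
  then have V: "(\<lambda>m. prob {\<omega> \<in> space M. \<delta> < V m \<omega>}) \<longlonglongrightarrow> 0" if "0 < \<delta>" for \<delta>
    using that V0 by (simp add: vanishes_in_prob_def)
  show "(\<lambda>m. prob {\<omega> \<in> space M. e < norm (\<Sum>k<n m. D m k \<omega> * Z m k \<omega>)}) \<longlonglongrightarrow> 0"
  proof (rule LIMSEQ_I)
    fix \<eta> :: real assume \<eta>: "0 < \<eta>"
    \<comment> \<open>Chosen so that the Chebyshev term equals \<open>\<eta> / 2\<close>; with this
      \<open>\<delta>\<close> fixed, the other term tends to zero.\<close>
    define \<delta> where "\<delta> = \<eta> / 2 * e\<^sup>2"
    have \<delta>: "0 < \<delta>" using \<eta> e by (simp add: \<delta>_def)
    obtain N where N: "\<And>m. m \<ge> N \<Longrightarrow> prob {\<omega> \<in> space M. \<delta> < V m \<omega>} < \<eta> / 2"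
      using order_tendstoD(2)[OF V[OF \<delta>], of "\<eta> / 2"] \<eta> by (auto simp: eventually_sequentially)
    have "norm (prob {\<omega> \<in> space M. e < norm (\<Sum>k<n m. D m k \<omega> * Z m k \<omega>)} - 0) < \<eta>" if "m \<ge> N" for m
    proof -
      have "prob {\<omega> \<in> space M. e < \<bar>\<Sum>k<n m. D m k \<omega> * Z m k \<omega>\<bar>}
          \<le> prob {\<omega> \<in> space M. \<delta> < V m \<omega>} + \<delta> / e\<^sup>2"
        unfolding V_def
        by (rule prob_backward_transform_le[where w = "w m"])
          (use w D Z ind mean sq var v e \<delta> in auto)
      also have "\<dots> < \<eta> / 2 + \<eta> / 2"
        using N[OF that] e by (simp add: \<delta>_def)
      finally show ?thesis by simp
    qed
    then show "\<exists>N. \<forall>m\<ge>N. norm (prob {\<omega> \<in> space M. e < norm (\<Sum>k<n m. D m k \<omega> * Z m k \<omega>)} - 0) < \<eta>"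
      by blast
  qed
qed

lemma W_increment_moments:
  assumes "s \<le> r" "r \<le> u" "u \<le> t" and b: "b \<in> Basis"
  shows "expectation (\<lambda>\<omega>. (W r \<omega> - W u \<omega>) \<bullet> b) = 0"
    "integrable M (\<lambda>\<omega>. ((W r \<omega> - W u \<omega>) \<bullet> b)\<^sup>2)"
    "expectation (\<lambda>\<omega>. ((W r \<omega> - W u \<omega>) \<bullet> b)\<^sup>2) \<le> u - r"
proof -
  consider "r = u" | "r < u" using assms by linarith
  then have "expectation (\<lambda>\<omega>. (W r \<omega> - W u \<omega>) \<bullet> b) = 0 \<and>
    integrable M (\<lambda>\<omega>. ((W r \<omega> - W u \<omega>) \<bullet> b)\<^sup>2) \<and>
    expectation (\<lambda>\<omega>. ((W r \<omega> - W u \<omega>) \<bullet> b)\<^sup>2) \<le> u - r"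
  proof cases
    case 2
    then have s: "0 < sqrt (u - r)" by simp
    have Z: "distributed M lborel (\<lambda>\<omega>. W r \<omega> - W u \<omega>)
          (\<lambda>x. ennreal (\<Prod>b\<in>Basis. normal_density 0 (sqrt (u - r)) (x \<bullet> b)))"
      using W_normal assms 2 by blast
    note mom = isotropic_normal_coordinate_moments[OF Z s b]
    have "(\<integral>x. normal_density 0 (sqrt (u - r)) x * x ^ 1 \<partial>lborel) = 0"
      using integral_normal_moment_odd[OF s, of 0 0] by simp
    then show ?thesis
      using mom[of 1] mom[of 2] 2 by (simp add: normal_moment_2[OF s])
  qed simp
  then show "expectation (\<lambda>\<omega>. (W r \<omega> - W u \<omega>) \<bullet> b) = 0"
    "integrable M (\<lambda>\<omega>. ((W r \<omega> - W u \<omega>) \<bullet> b)\<^sup>2)"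
    "expectation (\<lambda>\<omega>. ((W r \<omega> - W u \<omega>) \<bullet> b)\<^sup>2) \<le> u - r" by auto
qed

lemma W_product_deviation:
  fixes i j :: 'a
  assumes "s \<le> r" "r \<le> u" "u \<le> t" and i: "i \<in> Basis" and j: "j \<in> Basis"
  defines "Y \<equiv> \<lambda>\<omega>. ((W r \<omega> - W u \<omega>) \<bullet> i) * ((W r \<omega> - W u \<omega>) \<bullet> j) - (if i = j then u - r else 0)"
  shows "expectation Y = 0" "integrable M (\<lambda>\<omega>. (Y \<omega>)\<^sup>2)" "expectation (\<lambda>\<omega>. (Y \<omega>)\<^sup>2) \<le> 8 * (u - r)\<^sup>2"
proof -
  consider "r = u" | "r < u" using assms by linarith
  then have "expectation Y = 0 \<and> integrable M (\<lambda>\<omega>. (Y \<omega>)\<^sup>2) \<and> expectation (\<lambda>\<omega>. (Y \<omega>)\<^sup>2) \<le> 8 * (u - r)\<^sup>2"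
  proof cases
    case 1
    then have "Y = (\<lambda>_. 0)" by (auto simp: Y_def)
    then show ?thesis by simp
  next
    case 2
    have Z: "distributed M lborel (\<lambda>\<omega>. W r \<omega> - W u \<omega>)
          (\<lambda>x. ennreal (\<Prod>b\<in>Basis. normal_density 0 (sqrt (u - r)) (x \<bullet> b)))"
      using W_normal assms 2 by blast
    show ?thesis
      using isotropic_normal_product_deviation[OF Z _ i j] 2 unfolding Y_def by simp
  qed
  then show "expectation Y = 0" "integrable M (\<lambda>\<omega>. (Y \<omega>)\<^sup>2)" "expectation (\<lambda>\<omega>. (Y \<omega>)\<^sup>2) \<le> 8 * (u - r)\<^sup>2"
    by auto
qed

text \<open>An increment of \<open>X\<close> is \<open>\<epsilon>\<close> times a Brownian
  increment, treated coordinatewise as a martingale transform, plus a remainder of order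
  \<open>C \<omega>\<close> times the step, which is summed path by path. Uniform smallness of the
  integrand makes both parts small.\<close>

lemma right_sum_vanishes:
  fixes D :: "nat \<Rightarrow> real \<Rightarrow> 'w \<Rightarrow> 'a" and w :: "nat \<Rightarrow> nat \<Rightarrow> real"
  assumes w: "\<And>m k. k < n m \<Longrightarrow> w m k \<le> w m (Suc k)" and w0: "\<And>m. w m 0 = s" and wn: "\<And>m. w m (n m) = t"
    and D: "\<And>m k. k < n m \<Longrightarrow> D m (w m (Suc k)) \<in> borel_measurable (G (w m (Suc k)))"
    and small: "AE \<omega> in M. \<forall>e>0. \<forall>\<^sub>F m in sequentially. \<forall>k<n m. norm (D m (w m (Suc k)) \<omega>) \<le> e"
  shows "vanishes_in_prob M (\<lambda>m \<omega>. right_sum (\<bullet>) (D m) X (n m) (w m) \<omega>)"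
proof -
  have w_mono: "w m j \<le> w m k" if "j \<le> k" "k \<le> n m" for m j k
    using that
  proof (induction k rule: dec_induct)
    case (step i)
    then show ?case using w[of i m] by (meson order_trans Suc_le_lessD less_imp_le)
  qed simp
  have w_mem: "w m k \<in> {s..t}" if "k \<le> n m" for m k
    using w_mono[of 0 k m] w_mono[of k "n m" m] that w0 wn by auto
  have steps: "(\<Sum>k<n m. c * (w m (Suc k) - w m k)) = c * (t - s)" for m c
    using sum_step_const[of c "w m" "n m"] by (simp add: w0 wn)
  obtain E where E: "\<And>r. r \<in> {s..t} \<Longrightarrow> \<bar>\<epsilon> r\<bar> \<le> E"
    using continuous_on_interval_bound[OF \<epsilon>_cont] unfolding real_norm_def by blast
  have E0: "0 \<le> E" using E[of s] interval by simp
  \<comment> \<open>The minus sign compensates for \<open>Z1\<close>, which is oriented downwards in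
    time, from the later value of \<open>W\<close> to the earlier one.\<close>
  define D1 where "D1 b m k \<omega> = - \<epsilon> (w m (Suc k)) * (D m (w m (Suc k)) \<omega> \<bullet> b)" for b m k \<omega>
  define Z1 where "Z1 b m k \<omega> = (W (w m k) \<omega> - W (w m (Suc k)) \<omega>) \<bullet> b" for b m k \<omega>
  define Q where "Q m \<omega> = (\<Sum>b\<in>Basis. \<Sum>k<n m. D1 b m k \<omega> * Z1 b m k \<omega>)" for m \<omega>
  define R where "R m \<omega> = right_sum (\<bullet>) (D m) X (n m) (w m) \<omega> - Q m \<omega>" for m \<omega>
  have Q: "vanishes_in_prob M Q"
    unfolding Q_def
  proof (intro vanishes_in_prob_sum vanishes_in_prob_backward_transform[where v = "\<lambda>m k. w m (Suc k) - w m k" and w = w])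
    fix b :: 'a and m k assume b: "b \<in> Basis" and k: "k < n m"
    have mem: "s \<le> w m k" "w m k \<le> w m (Suc k)" "w m (Suc k) \<le> t"
      using w_mem[of k m] w_mem[of "Suc k" m] w k by auto
    show "D1 b m k \<in> borel_measurable (G (w m (Suc k)))"
      unfolding D1_def using D[OF k] by (intro borel_measurable_times borel_measurable_inner) auto
    show "Z1 b m k \<in> borel_measurable (G (w m k))"
      unfolding Z1_def using W_adapted[of "w m k"] adapted_mono[OF W_adapted[of "w m (Suc k)"], of "w m k"] mem
      by (intro borel_measurable_inner borel_measurable_diff) auto
    show "indep_set (sets (G (w m (Suc k)))) (sets (vimage_algebra (space M) (Z1 b m k) borel))"
      unfolding Z1_def by (rule W_indep_compose[where g = "\<lambda>x. x \<bullet> b"]) (use mem in auto)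
    show "expectation (Z1 b m k) = 0" "integrable M (\<lambda>\<omega>. (Z1 b m k \<omega>)\<^sup>2)"
      "expectation (\<lambda>\<omega>. (Z1 b m k \<omega>)\<^sup>2) \<le> w m (Suc k) - w m k"
      unfolding Z1_def using W_increment_moments[OF mem b] by auto
    show "0 < w m (Suc k) - w m k \<or> (\<forall>\<omega>. Z1 b m k \<omega> = 0)"
      using mem by (cases "w m k = w m (Suc k)") (auto simp: Z1_def)
  next
    fix b :: 'a assume b: "b \<in> Basis"
    show "AE \<omega> in M. (\<lambda>m. \<Sum>k<n m. (D1 b m k \<omega>)\<^sup>2 * (w m (Suc k) - w m k)) \<longlonglongrightarrow> 0"
      using small
    proof eventually_elim
      case (elim \<omega>)
      show ?case
      proof (rule LIMSEQ_I)
        fix \<eta> :: real assume \<eta>: "0 < \<eta>"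
        \<comment> \<open>The summand 1 avoids a division by zero when \<open>E\<close> or the
          length of the interval vanishes.\<close>
        define e where "e = sqrt (\<eta> / (2 * (1 + E\<^sup>2 * (t - s))))"
        have pos: "0 < 1 + E\<^sup>2 * (t - s)" using interval by (intro add_pos_nonneg) auto
        have e: "0 < e" "e\<^sup>2 * (E\<^sup>2 * (t - s)) < \<eta>"
        proof -
          show "0 < e" using pos \<eta> by (simp add: e_def)
          have "e\<^sup>2 * (E\<^sup>2 * (t - s)) \<le> e\<^sup>2 * (1 + E\<^sup>2 * (t - s))"
            by (intro mult_left_mono) auto
          also have "\<dots> = \<eta> / 2" using pos \<eta> unfolding e_def by (subst real_sqrt_pow2) (auto simp: field_simps)
          finally show "e\<^sup>2 * (E\<^sup>2 * (t - s)) < \<eta>" using \<eta> by simp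
        qed
        obtain N where N: "\<And>m k. m \<ge> N \<Longrightarrow> k < n m \<Longrightarrow> norm (D m (w m (Suc k)) \<omega>) \<le> e"
          using elim e(1) unfolding eventually_sequentially by metis
        have "norm ((\<Sum>k<n m. (D1 b m k \<omega>)\<^sup>2 * (w m (Suc k) - w m k)) - 0) < \<eta>" if m: "m \<ge> N" for m
        proof -
          have "(\<Sum>k<n m. (D1 b m k \<omega>)\<^sup>2 * (w m (Suc k) - w m k)) \<le> (\<Sum>k<n m. (E * e)\<^sup>2 * (w m (Suc k) - w m k))"
          proof (intro sum_mono mult_right_mono)
            fix k assume "k \<in> {..<n m}"
            then have k: "k < n m" by simp
            have "\<bar>D m (w m (Suc k)) \<omega> \<bullet> b\<bar> \<le> e"
              using Basis_le_norm[OF b, of "D m (w m (Suc k)) \<omega>"] N[OF m k] by simp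
            then have "\<bar>D1 b m k \<omega>\<bar> \<le> E * e"
              unfolding D1_def using E E0 w_mem[of "Suc k" m] k by (simp add: abs_mult mult_mono)
            then have "\<bar>D1 b m k \<omega>\<bar>\<^sup>2 \<le> (E * e)\<^sup>2" by (intro power_mono) auto
            then show "(D1 b m k \<omega>)\<^sup>2 \<le> (E * e)\<^sup>2" by simp
            show "0 \<le> w m (Suc k) - w m k" using w[OF k] by simp
          qed
          also have "\<dots> = e\<^sup>2 * (E\<^sup>2 * (t - s))" by (simp only: steps power_mult_distrib) (simp add: ac_simps)
          also have "\<dots> < \<eta>" by fact
          finally have "(\<Sum>k<n m. (D1 b m k \<omega>)\<^sup>2 * (w m (Suc k) - w m k)) < \<eta>" .
          moreover have "0 \<le> (\<Sum>k<n m. (D1 b m k \<omega>)\<^sup>2 * (w m (Suc k) - w m k))"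
            using w by (intro sum_nonneg) auto
          ultimately show ?thesis by simp
        qed
        then show "\<exists>N. \<forall>m\<ge>N. norm ((\<Sum>k<n m. (D1 b m k \<omega>)\<^sup>2 * (w m (Suc k) - w m k)) - 0) < \<eta>"
          by blast
      qed
    qed
  qed (use w in auto)
  have R_eq: "R m \<omega> = (\<Sum>k<n m. D m (w m (Suc k)) \<omega> \<bullet>
      (X (w m (Suc k)) \<omega> - X (w m k) \<omega> - \<epsilon> (w m (Suc k)) *\<^sub>R (W (w m (Suc k)) \<omega> - W (w m k) \<omega>)))" for m \<omega>
  proof -
    have "(\<Sum>b\<in>Basis. D1 b m k \<omega> * Z1 b m k \<omega>) =
        D m (w m (Suc k)) \<omega> \<bullet> (\<epsilon> (w m (Suc k)) *\<^sub>R (W (w m (Suc k)) \<omega> - W (w m k) \<omega>))" for k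
    proof -
      have "(\<Sum>b\<in>Basis. D1 b m k \<omega> * Z1 b m k \<omega>) = (\<Sum>b\<in>Basis. (D m (w m (Suc k)) \<omega> \<bullet> b) *
          ((\<epsilon> (w m (Suc k)) *\<^sub>R (W (w m (Suc k)) \<omega> - W (w m k) \<omega>)) \<bullet> b))"
        by (intro sum.cong) (auto simp: D1_def Z1_def inner_diff_left algebra_simps)
      then show ?thesis by (subst euclidean_inner) simp
    qed
    then have "Q m \<omega> = (\<Sum>k<n m. D m (w m (Suc k)) \<omega> \<bullet> (\<epsilon> (w m (Suc k)) *\<^sub>R (W (w m (Suc k)) \<omega> - W (w m k) \<omega>)))"
      unfolding Q_def by (subst sum.swap) simp
    then show ?thesis
      unfolding R_def right_sum_def by (simp add: sum_subtractf inner_diff_right)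
  qed
  have "vanishes_in_prob M R"
  proof (rule vanishes_in_prob_AE)
    show "R m \<in> borel_measurable M" for m
      unfolding R_eq using adapted_measurable[OF D] X_measurable[OF w_mem] W_measurable[OF w_mem]
      by (intro borel_measurable_sum borel_measurable_inner borel_measurable_diff borel_measurable_scaleR) auto
    \<comment> \<open>\<open>X_increment\<close> has its own null set for each pair of times; only
      the countably many pairs from the given partitions occur, so a single null set
      suffices.\<close>
    have "AE \<omega> in M. \<forall>m. \<forall>k\<in>{..<n m}. norm (X (w m (Suc k)) \<omega> - X (w m k) \<omega> - \<epsilon> (w m (Suc k)) *\<^sub>R (W (w m (Suc k)) \<omega> - W (w m k) \<omega>))
        \<le> C \<omega> * (w m (Suc k) - w m k)"
      unfolding AE_all_countable
    proof (intro allI AE_finite_allI)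
      fix m k assume "k \<in> {..<n m}"
      then show "AE \<omega> in M. norm (X (w m (Suc k)) \<omega> - X (w m k) \<omega> - \<epsilon> (w m (Suc k)) *\<^sub>R (W (w m (Suc k)) \<omega> - W (w m k) \<omega>))
        \<le> C \<omega> * (w m (Suc k) - w m k)"
        using w_mem[of k m] w_mem[of "Suc k" m] w by (intro X_increment) auto
    qed simp
    with small show "AE \<omega> in M. (\<lambda>m. R m \<omega>) \<longlonglongrightarrow> 0"
    proof eventually_elim
      case (elim \<omega>)
      show ?case
      proof (rule LIMSEQ_I)
        fix \<eta> :: real assume \<eta>: "0 < \<eta>"
        define e where "e = \<eta> / (2 * (1 + C \<omega> * (t - s)))"
        have pos: "0 < 1 + C \<omega> * (t - s)" using interval C_nonneg by (intro add_pos_nonneg) auto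
        have e: "0 < e" using pos \<eta> by (simp add: e_def)
        have e2: "e * (C \<omega> * (t - s)) < \<eta>"
        proof -
          have "e * (C \<omega> * (t - s)) \<le> e * (1 + C \<omega> * (t - s))"
            using e by (intro mult_left_mono) auto
          also have "\<dots> = \<eta> / 2" using pos unfolding e_def by (simp add: field_simps)
          finally show ?thesis using \<eta> by simp
        qed
        obtain N where N: "\<And>m k. m \<ge> N \<Longrightarrow> k < n m \<Longrightarrow> norm (D m (w m (Suc k)) \<omega>) \<le> e"
          using elim(1) e unfolding eventually_sequentially by metis
        have "norm (R m \<omega> - 0) < \<eta>" if m: "m \<ge> N" for m
        proof -
          have "norm (R m \<omega>) \<le> (\<Sum>k<n m. (e * C \<omega>) * (w m (Suc k) - w m k))"
            unfolding R_eq
          proof (rule sum_norm_le)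
            fix k assume k: "k \<in> {..<n m}"
            let ?\<rho> = "X (w m (Suc k)) \<omega> - X (w m k) \<omega> - \<epsilon> (w m (Suc k)) *\<^sub>R (W (w m (Suc k)) \<omega> - W (w m k) \<omega>)"
            have "norm (D m (w m (Suc k)) \<omega> \<bullet> ?\<rho>) \<le> norm (D m (w m (Suc k)) \<omega>) * norm ?\<rho>"
              by (simp add: Cauchy_Schwarz_ineq2)
            also have "\<dots> \<le> e * (C \<omega> * (w m (Suc k) - w m k))"
              using elim(2) k N[OF m] e by (intro mult_mono) auto
            finally show "norm (D m (w m (Suc k)) \<omega> \<bullet> ?\<rho>) \<le> (e * C \<omega>) * (w m (Suc k) - w m k)"
              by (simp add: ac_simps)
          qed
          also have "\<dots> = e * (C \<omega> * (t - s))" unfolding steps by (rule mult.assoc)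
          finally show ?thesis using e2 by simp
        qed
        then show "\<exists>N. \<forall>m\<ge>N. norm (R m \<omega> - 0) < \<eta>" by blast
      qed
    qed
  qed
  from vanishes_in_prob_add[OF Q this] show ?thesis by (simp add: R_def)
qed

lemma right_sum_measurable:
  assumes H: "\<And>r. r \<in> {s..t} \<Longrightarrow> H r \<in> borel_measurable (G r)"
    and u: "fine_partition d s t n u"
  shows "right_sum (\<bullet>) H X n u \<in> borel_measurable M"
  unfolding right_sum_def using adapted_measurable[OF H] X_measurable fine_partition_mem[OF u]
  by (intro borel_measurable_sum borel_measurable_inner borel_measurable_diff) auto

text \<open>Over the common refinement both sums become right sums of step processes. Their
  difference compares a path of \<open>H\<close> at two times less than one mesh apart, so uniform
  continuity makes it uniformly small.\<close>

lemma right_sum_difference_vanishes: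
  fixes H :: "real \<Rightarrow> 'w \<Rightarrow> 'a"
  assumes H: "\<And>r. r \<in> {s..t} \<Longrightarrow> H r \<in> borel_measurable (G r)"
    and cont: "AE \<omega> in M. continuous_on {s..t} (\<lambda>r. H r \<omega>)"
    and u: "\<And>m. fine_partition (1 / Suc m) s t (n m) (u m)"
    and v: "\<And>m. fine_partition (1 / Suc m) s t (n' m) (v m)"
  shows "vanishes_in_prob M (\<lambda>m \<omega>. right_sum (\<bullet>) H X (n m) (u m) \<omega> - right_sum (\<bullet>) H X (n' m) (v m) \<omega>)"
proof -
  have "\<exists>N w. w 0 = s \<and> w N = t \<and> (\<forall>k<N. w k < w (Suc k)) \<and>
      u m ` {..n m} \<subseteq> w ` {..N} \<and> v m ` {..n' m} \<subseteq> w ` {..N}" for m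
    by (rule common_refinement[OF u[of m] v[of m]]) blast
  then obtain N w where w: "\<And>m. w m 0 = s" "\<And>m. w m (N m) = t" "\<And>m k. k < N m \<Longrightarrow> w m k < w m (Suc k)"
    "\<And>m. u m ` {..n m} \<subseteq> w m ` {..N m}" "\<And>m. v m ` {..n' m} \<subseteq> w m ` {..N m}"
    by metis
  have less: "w m i < w m j" if "i < j" "j \<le> N m" for m i j
    using that
  proof (induction j)
    case (Suc j)
    then show ?case using w(3)[of j m] by (cases "i = j") (auto intro: less_trans)
  qed simp
  have mem: "s < w m (Suc k) \<and> w m (Suc k) \<le> t" if "k < N m" for m k
    using less[of 0 "Suc k" m] less[of "Suc k" "N m" m] that w(1,2)[of m]
    by (cases "Suc k = N m") auto
  define D where "D m r \<omega> = step_process H (n m) (u m) r \<omega> - step_process H (n' m) (v m) r \<omega>" for m r \<omega>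
  have "vanishes_in_prob M (\<lambda>m \<omega>. right_sum (\<bullet>) (D m) X (N m) (w m) \<omega>)"
  proof (rule right_sum_vanishes)
    fix m k assume k: "k < N m"
    show "w m k \<le> w m (Suc k)" using w(3)[OF k] by simp
    \<comment> \<open>The value is taken at a later time, and later information is contained in
      \<open>G (w m (Suc k))\<close> because \<open>G\<close> decreases.\<close>
    have step: "step_process H n u (w m (Suc k)) \<in> borel_measurable (G (w m (Suc k)))"
      if fp: "fine_partition d s t n u" for d n u
    proof -
      obtain j where j: "j < n" "u j < w m (Suc k)" "w m (Suc k) \<le> u (Suc j)"
        "\<And>\<omega>. step_process H n u (w m (Suc k)) \<omega> = H (u (Suc j)) \<omega>"
        using step_process_eq[OF fp, of "w m (Suc k)" H] mem[OF k] by blast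
      then have "step_process H n u (w m (Suc k)) = H (u (Suc j))" by (intro ext) simp
      moreover have "H (u (Suc j)) \<in> borel_measurable (G (w m (Suc k)))"
        using H[of "u (Suc j)"] fine_partition_mem[OF fp, of "Suc j"] j by (intro adapted_mono[OF _ j(3)]) auto
      ultimately show ?thesis by simp
    qed
    show "D m (w m (Suc k)) \<in> borel_measurable (G (w m (Suc k)))"
      unfolding D_def by (intro borel_measurable_diff step[OF u] step[OF v])
  next
    show "AE \<omega> in M. \<forall>e>0. \<forall>\<^sub>F m in sequentially. \<forall>k<N m. norm (D m (w m (Suc k)) \<omega>) \<le> e"
      using cont
    proof eventually_elim
      case (elim \<omega>)
      show ?case
      proof (intro allI impI)
        fix e :: real assume e: "0 < e"
        have "uniformly_continuous_on {s..t} (\<lambda>r. H r \<omega>)"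
          by (rule compact_uniformly_continuous[OF elim]) simp
        then obtain \<delta> where \<delta>: "0 < \<delta>" "\<And>r r'. r \<in> {s..t} \<Longrightarrow> r' \<in> {s..t} \<Longrightarrow> dist r' r < \<delta> \<Longrightarrow> dist (H r' \<omega>) (H r \<omega>) < e"
          unfolding uniformly_continuous_on_def using e by blast
        obtain m0 :: nat where m0: "1 / \<delta> < real m0" using reals_Archimedean2 by blast
        have "norm (D m (w m (Suc k)) \<omega>) \<le> e" if m: "m0 \<le> m" and k: "k < N m" for m k
        proof -
          have "1 / \<delta> < real (Suc m)" using m0 m by simp
          then have md: "1 / real (Suc m) < \<delta>" using \<delta>(1) by (simp add: field_simps)
          obtain j where j: "j < n m" "u m j < w m (Suc k)" "w m (Suc k) \<le> u m (Suc j)"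
            "\<And>\<omega>. step_process H (n m) (u m) (w m (Suc k)) \<omega> = H (u m (Suc j)) \<omega>"
            using step_process_eq[OF u, of "w m (Suc k)" m H] mem[OF k] by blast
          obtain l where l: "l < n' m" "v m l < w m (Suc k)" "w m (Suc k) \<le> v m (Suc l)"
            "\<And>\<omega>. step_process H (n' m) (v m) (w m (Suc k)) \<omega> = H (v m (Suc l)) \<omega>"
            using step_process_eq[OF v, of "w m (Suc k)" m H] mem[OF k] by blast
          have "u m (Suc j) - u m j < 1 / real (Suc m)" "v m (Suc l) - v m l < 1 / real (Suc m)"
            using u[of m] v[of m] j l by (auto simp: fine_partition_def)
          \<comment> \<open>Both right ends lie within one mesh to the right of the common point
            \<open>w m (Suc k)\<close>.\<close>
          then have "dist (u m (Suc j)) (v m (Suc l)) < \<delta>"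
            using j l md by (auto simp: dist_real_def)
          moreover have "u m (Suc j) \<in> {s..t}" "v m (Suc l) \<in> {s..t}"
            using fine_partition_mem[OF u, of "Suc j" m] fine_partition_mem[OF v, of "Suc l" m] j l by auto
          ultimately have "dist (H (u m (Suc j)) \<omega>) (H (v m (Suc l)) \<omega>) < e" by (intro \<delta>(2))
          then show ?thesis unfolding D_def j(4) l(4) by (simp add: dist_norm)
        qed
        then show "\<forall>\<^sub>F m in sequentially. \<forall>k<N m. norm (D m (w m (Suc k)) \<omega>) \<le> e"
          unfolding eventually_sequentially by blast
      qed
    qed
  qed (use w in auto)
  moreover have "right_sum (\<bullet>) (D m) X (N m) (w m) \<omega> =
      right_sum (\<bullet>) H X (n m) (u m) \<omega> - right_sum (\<bullet>) H X (n' m) (v m) \<omega>" for m \<omega>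
  proof -
    have "right_sum (\<bullet>) (D m) X (N m) (w m) \<omega> = right_sum (\<bullet>) (step_process H (n m) (u m)) X (N m) (w m) \<omega>
        - right_sum (\<bullet>) (step_process H (n' m) (v m)) X (N m) (w m) \<omega>"
      unfolding right_sum_def D_def by (simp add: inner_diff_left sum_subtractf)
    then show ?thesis
      by (simp add: right_sum_refinement[OF u w(3,4)] right_sum_refinement[OF v w(3,5)])
  qed
  ultimately show ?thesis by simp
qed

lemma has_backward_integral_exists:
  fixes H :: "real \<Rightarrow> 'w \<Rightarrow> 'a"
  assumes H: "\<And>r. r \<in> {s..t} \<Longrightarrow> H r \<in> borel_measurable (G r)"
    and cont: "AE \<omega> in M. continuous_on {s..t} (\<lambda>r. H r \<omega>)"
  shows "\<exists>I. has_backward_integral M (\<bullet>) H X s t I"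
proof -
  have "\<exists>n u. fine_partition (1 / Suc m) s t n u" for m
    using interval by (intro ex_fine_partition) auto
  then obtain n u where u: "\<And>m. fine_partition (1 / Suc m) s t (n m) (u m)" by metis
  have u': "fine_partition (1 / Suc m) s t (n k) (u k)" if "m \<le> k" for m k
    using that by (intro fine_partition_mono[OF u[of k]] divide_left_mono) auto
  define S where "S m = right_sum (\<bullet>) H X (n m) (u m)" for m
  have S: "S m \<in> borel_measurable M" for m
    unfolding S_def by (rule right_sum_measurable[OF H u])
  \<comment> \<open>If the Cauchy property failed, two bad indices beyond each \<open>N\<close>
    would give two sequences of partitions with vanishing mesh whose sums stay apart, against
    \<open>right_sum_difference_vanishes\<close>.\<close>
  have "\<exists>N. \<forall>m\<ge>N. \<forall>k\<ge>N. prob {\<omega> \<in> space M. e < norm (S m \<omega> - S k \<omega>)} \<le> e" if e: "0 < e" for e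
  proof (rule ccontr)
    assume "\<not> ?thesis"
    then have "\<forall>N. \<exists>m k. m \<ge> N \<and> k \<ge> N \<and> \<not> prob {\<omega> \<in> space M. e < norm (S m \<omega> - S k \<omega>)} \<le> e"
      by blast
    then obtain p q where pq: "\<And>N. N \<le> p N" "\<And>N. N \<le> q N"
      "\<And>N. \<not> prob {\<omega> \<in> space M. e < norm (S (p N) \<omega> - S (q N) \<omega>)} \<le> e"
      by metis
    have "vanishes_in_prob M (\<lambda>N \<omega>. S (p N) \<omega> - S (q N) \<omega>)"
      unfolding S_def by (rule right_sum_difference_vanishes[OF H cont u'[OF pq(1)] u'[OF pq(2)]])
    then have "(\<lambda>N. prob {\<omega> \<in> space M. e < norm (S (p N) \<omega> - S (q N) \<omega>)}) \<longlonglongrightarrow> 0"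
      using e by (simp add: vanishes_in_prob_def)
    then have "\<forall>\<^sub>F N in sequentially. prob {\<omega> \<in> space M. e < norm (S (p N) \<omega> - S (q N) \<omega>)} < e"
      by (rule order_tendstoD) fact
    then obtain N where "prob {\<omega> \<in> space M. e < norm (S (p N) \<omega> - S (q N) \<omega>)} < e"
      unfolding eventually_sequentially by blast
    with pq(3)[of N] show False by simp
  qed
  then obtain r I where r: "strict_mono r" and I: "I \<in> borel_measurable M"
    "AE \<omega> in M. (\<lambda>m. S (r m) \<omega>) \<longlonglongrightarrow> I \<omega>"
    using Cauchy_in_prob_imp_AE_convergent_subseq[of S] S by blast
  have "mesh_limit M (right_sum (\<bullet>) H X) s t I"
  proof (rule mesh_limitI[OF I(1), of 1])
    fix n' v assume v: "\<And>m. fine_partition (1 / Suc m) s t (n' m) (v m)"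
    \<comment> \<open>An arbitrary sequence of partitions is compared with the chosen one;
      \<open>m \<le> r m\<close> makes the subsequence at least as fine as required.\<close>
    have 1: "vanishes_in_prob M (\<lambda>m \<omega>. right_sum (\<bullet>) H X (n' m) (v m) \<omega> - S (r m) \<omega>)"
      unfolding S_def
      by (rule right_sum_difference_vanishes[OF H cont v u'[OF strict_mono_imp_increasing[OF r]]])
    have 2: "vanishes_in_prob M (\<lambda>m \<omega>. S (r m) \<omega> - I \<omega>)"
    proof (rule vanishes_in_prob_AE)
      show "AE \<omega> in M. (\<lambda>m. S (r m) \<omega> - I \<omega>) \<longlonglongrightarrow> 0"
        using I(2) by eventually_elim (simp add: LIM_zero)
    qed (use S I in auto)
    have "vanishes_in_prob M (\<lambda>m \<omega>. right_sum (\<bullet>) H X (n' m) (v m) \<omega> - I \<omega>)"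
      using vanishes_in_prob_add[OF 1 2] by simp
    then show "\<exists>r. strict_mono r \<and> vanishes_in_prob M (\<lambda>m \<omega>. right_sum (\<bullet>) H X (n' (r m)) (v (r m)) \<omega> - I \<omega>)"
      by (intro exI[of _ "\<lambda>x. x"]) (auto simp: strict_mono_def)
  qed (auto intro: right_sum_measurable[OF H])
  then show ?thesis unfolding has_backward_integral_def by blast
qed

end

section \<open>Quadratic covariation\<close>

lemma fine_partition_steps:
  assumes "fine_partition d s t n u"
  shows "(\<Sum>k<n. c * (u (Suc k) - u k)) = c * (t - s)"
  using assms by (simp add: sum_step_const fine_partition_def)

lemma integral_fine_partition:
  fixes \<phi> :: "real \<Rightarrow> real"
  assumes u: "fine_partition d s t n u" and \<phi>: "continuous_on {s..t} \<phi>"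
  shows "integral {s..t} \<phi> = (\<Sum>k<n. integral {u k..u (Suc k)} \<phi>)"
proof -
  have "integral {u 0..u k} \<phi> = (\<Sum>j<k. integral {u j..u (Suc j)} \<phi>)" if "k \<le> n" for k
    using that
  proof (induction k)
    case (Suc k)
    have "integral {u 0..u (Suc k)} \<phi> = integral {u 0..u k} \<phi> + integral {u k..u (Suc k)} \<phi>"
    proof (rule Henstock_Kurzweil_Integration.integral_combine[symmetric])
      show "u 0 \<le> u k" "u k \<le> u (Suc k)" using fine_partition_le[OF u] Suc.prems by auto
      show "\<phi> integrable_on {u 0..u (Suc k)}"
        using fine_partition_mem[OF u, of 0] fine_partition_mem[OF u, of "Suc k"] Suc.prems
        by (intro integrable_continuous_real continuous_on_subset[OF \<phi>]) auto
    qed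
    with Suc show ?case by simp
  qed simp
  from this[of n] show ?thesis using u by (simp add: fine_partition_def)
qed

lemma right_Riemann_sum_tendsto:
  fixes \<phi> :: "real \<Rightarrow> real"
  assumes u: "\<And>m. fine_partition (d m) s t (n m) (u m)" and d: "d \<longlonglongrightarrow> 0" and st: "s \<le> t"
    and \<phi>: "continuous_on {s..t} \<phi>"
  shows "(\<lambda>m. \<Sum>k<n m. \<phi> (u m (Suc k)) * (u m (Suc k) - u m k)) \<longlonglongrightarrow> integral {s..t} \<phi>"
proof (rule LIMSEQ_I)
  fix \<eta> :: real assume \<eta>: "0 < \<eta>"
  define e where "e = \<eta> / (2 * (1 + (t - s)))"
  have e: "0 < e" using st \<eta> by (simp add: e_def)
  have e2: "e * (t - s) < \<eta>"
  proof -
    have "e * (t - s) \<le> e * (1 + (t - s))" using e by (intro mult_left_mono) auto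
    also have "\<dots> = \<eta> / 2" using st unfolding e_def by (simp add: field_simps)
    finally show ?thesis using \<eta> by simp
  qed
  have "uniformly_continuous_on {s..t} \<phi>"
    by (rule compact_uniformly_continuous[OF \<phi>]) simp
  then obtain \<delta> where \<delta>: "0 < \<delta>" "\<And>r r'. r \<in> {s..t} \<Longrightarrow> r' \<in> {s..t} \<Longrightarrow> dist r' r < \<delta> \<Longrightarrow> dist (\<phi> r') (\<phi> r) < e"
    unfolding uniformly_continuous_on_def using e by blast
  obtain N where N: "\<And>m. m \<ge> N \<Longrightarrow> d m < \<delta>"
    using order_tendstoD(2)[OF d \<delta>(1)] unfolding eventually_sequentially by blast
  have "norm ((\<Sum>k<n m. \<phi> (u m (Suc k)) * (u m (Suc k) - u m k)) - integral {s..t} \<phi>) < \<eta>" if m: "m \<ge> N" for m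
  proof -
    have "(\<Sum>k<n m. \<phi> (u m (Suc k)) * (u m (Suc k) - u m k)) - integral {s..t} \<phi> =
        (\<Sum>k<n m. \<phi> (u m (Suc k)) * (u m (Suc k) - u m k) - integral {u m k..u m (Suc k)} \<phi>)"
      by (simp add: integral_fine_partition[OF u[of m] \<phi>] sum_subtractf)
    also have "norm \<dots> \<le> (\<Sum>k<n m. e * (u m (Suc k) - u m k))"
    proof (rule sum_norm_le)
      fix k assume "k \<in> {..<n m}"
      then have k: "k < n m" by simp
      have le: "u m k \<le> u m (Suc k)" and gap: "u m (Suc k) - u m k < d m"
        using u[of m] k by (auto simp: fine_partition_def)
      have mem: "u m k \<in> {s..t}" "u m (Suc k) \<in> {s..t}"
        using fine_partition_mem[OF u[of m]] k by auto
      have cont: "continuous_on {u m k..u m (Suc k)} \<phi>"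
        using mem by (intro continuous_on_subset[OF \<phi>]) auto
      have "\<phi> (u m (Suc k)) * (u m (Suc k) - u m k) - integral {u m k..u m (Suc k)} \<phi>
          = integral {u m k..u m (Suc k)} (\<lambda>r. \<phi> (u m (Suc k)) - \<phi> r)"
        using integrable_continuous_real[OF cont] le
        by (subst Henstock_Kurzweil_Integration.integral_diff) auto
      also have "norm \<dots> \<le> e * (u m (Suc k) - u m k)"
      proof (rule integral_bound[OF le])
        show "continuous_on {u m k..u m (Suc k)} (\<lambda>r. \<phi> (u m (Suc k)) - \<phi> r)"
          by (intro continuous_intros cont)
        show "norm (\<phi> (u m (Suc k)) - \<phi> r) \<le> e" if r: "r \<in> {u m k..u m (Suc k)}" for r
        proof -
          have "dist (\<phi> (u m (Suc k))) (\<phi> r) < e"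
            using r mem gap N[OF m] by (intro \<delta>(2)) (auto simp: dist_real_def)
          then show "norm (\<phi> (u m (Suc k)) - \<phi> r) \<le> e" by (simp add: dist_norm)
        qed
      qed
      finally show "norm (\<phi> (u m (Suc k)) * (u m (Suc k) - u m k) - integral {u m k..u m (Suc k)} \<phi>)
          \<le> e * (u m (Suc k) - u m k)" .
    qed
    also have "\<dots> = e * (t - s)" by (rule fine_partition_steps[OF u])
    finally show ?thesis using e2 by simp
  qed
  then show "\<exists>N. \<forall>m\<ge>N. norm ((\<Sum>k<n m. \<phi> (u m (Suc k)) * (u m (Suc k) - u m k)) - integral {s..t} \<phi>) < \<eta>"
    by blast
qed

section \<open>Pathwise Taylor expansion of covariation sums\<close>

lemma inner_norm_bound:
  fixes a b :: "'a::real_inner"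
  assumes "norm a \<le> A" "norm b \<le> B"
  shows "\<bar>a \<bullet> b\<bar> \<le> A * B"
  by (rule order_trans[OF Cauchy_Schwarz_ineq2 mult_mono'[OF assms]]) auto

text \<open>One partition step. With \<open>y = z + \<rho>\<close>, where
  \<open>z = \<epsilon> *\<^sub>R v\<close> and \<open>\<rho>\<close> is of order \<open>p\<close>,
  everything except the quadratic form in \<open>v\<close> carries the small factor
  \<open>\<theta>\<close> times either \<open>p\<close> or the squared norm of \<open>v\<close>;
  over a partition both have bounded sums.\<close>

lemma covariation_taylor_step:
  fixes h :: "real \<times> 'a \<Rightarrow> 'a::euclidean_space" and J :: "(real \<times> 'a) \<Rightarrow>\<^sub>L 'a"
  assumes lin: "norm (h z1 - h z0 - J (p, y)) \<le> \<theta> * (p + norm y)"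
    and J: "norm J \<le> B" and p: "0 \<le> p" "p \<le> \<theta>" and y: "norm y \<le> \<theta>" and \<theta>: "\<theta> \<le> 1"
    and inc: "norm (y - \<epsilon> *\<^sub>R v) \<le> C * p" and C: "0 \<le> C" and E: "\<bar>\<epsilon>\<bar> \<le> E"
  shows "\<bar>(h z1 - h z0) \<bullet> y - \<epsilon>\<^sup>2 * (J (0, v) \<bullet> v)\<bar>
    \<le> \<theta> * (1 + 2 * C\<^sup>2 + B + B * C * (2 + C)) * p + \<theta> * (2 * E\<^sup>2) * (norm v)\<^sup>2"
proof -
  define z where "z = \<epsilon> *\<^sub>R v"
  define \<rho> where "\<rho> = y - z"
  have \<theta>0: "0 \<le> \<theta>" and B0: "0 \<le> B" using p J norm_ge_zero[of J] by linarith+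
  have \<rho>: "norm \<rho> \<le> C * p" using inc by (simp add: \<rho>_def z_def)
  have Jb: "norm (J q) \<le> B * norm q" for q
    using norm_blinfun[of J q] J by (meson mult_right_mono norm_ge_zero order_trans)
  have z: "norm z \<le> \<theta> + C * \<theta>"
  proof -
    have "norm z \<le> norm y + norm \<rho>"
      using norm_triangle_ineq4[of y \<rho>] by (simp add: \<rho>_def)
    also have "\<dots> \<le> \<theta> + C * p" using y \<rho> by linarith
    also have "\<dots> \<le> \<theta> + C * \<theta>" using p C by (intro add_left_mono mult_left_mono)
    finally show ?thesis .
  qed
  have y2: "(norm y)\<^sup>2 \<le> 2 * E\<^sup>2 * (norm v)\<^sup>2 + 2 * C\<^sup>2 * \<theta> * p"
  proof -
    have "norm y \<le> norm z + norm \<rho>" using norm_triangle_ineq[of z \<rho>] by (simp add: \<rho>_def)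
    then have "(norm y)\<^sup>2 \<le> (norm z + norm \<rho>)\<^sup>2" by (intro power_mono) auto
    also have "\<dots> \<le> 2 * (norm z)\<^sup>2 + 2 * (norm \<rho>)\<^sup>2"
      using sum_squares_bound[of "norm z" "norm \<rho>"] by (simp add: power2_sum)
    also have "(norm z)\<^sup>2 \<le> E\<^sup>2 * (norm v)\<^sup>2"
    proof -
      have "norm z \<le> E * norm v" using E by (simp add: z_def mult_right_mono)
      then have "(norm z)\<^sup>2 \<le> (E * norm v)\<^sup>2" by (intro power_mono) auto
      then show ?thesis by (simp add: power_mult_distrib)
    qed
    also have "(norm \<rho>)\<^sup>2 \<le> C\<^sup>2 * \<theta> * p"
    proof -
      have "(norm \<rho>)\<^sup>2 \<le> (C * p)\<^sup>2" using \<rho> by (intro power_mono) auto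
      also have "\<dots> = C\<^sup>2 * (p * p)" by (simp add: power2_eq_square)
      also have "\<dots> \<le> C\<^sup>2 * (\<theta> * p)" using p by (intro mult_left_mono mult_right_mono) auto
      finally show ?thesis by (simp add: ac_simps)
    qed
    finally show ?thesis by simp
  qed
  have split: "(p, y) = (p, 0) + ((0::real), y)" by simp
  \<comment> \<open>Splits off the linearisation error, the time derivative and the two mixed terms
    that involve \<open>\<rho>\<close>; the part cancelled on the left is
    \<open>J (0, z) \<bullet> z\<close>.\<close>
  have eq: "(h z1 - h z0) \<bullet> y - \<epsilon>\<^sup>2 * (J (0, v) \<bullet> v) =
      (h z1 - h z0 - J (p, y)) \<bullet> y + J (p, 0) \<bullet> y + (J (0, y) \<bullet> \<rho> + J (0, \<rho>) \<bullet> z)"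
  proof -
    have 1: "J (p, y) = J (p, 0) + J (0, y)" by (subst split) (simp only: blinfun.add_right)
    have 2: "J (0, \<rho>) = J (0, y) - J (0, z)"
      by (simp add: \<rho>_def blinfun.diff_right[symmetric])
    have "J (0, z) = \<epsilon> *\<^sub>R J (0, v)"
      by (simp add: z_def blinfun.scaleR_right[symmetric])
    then have 3: "\<epsilon>\<^sup>2 * (J (0, v) \<bullet> v) = J (0, z) \<bullet> z"
      by (simp add: z_def power2_eq_square)
    have 4: "y = \<rho> + z" by (simp add: \<rho>_def)
    show ?thesis
      unfolding 1 2 3 by (simp add: inner_diff_left inner_add_left) (simp add: 4 inner_add_right)
  qed
  have 1: "\<bar>(h z1 - h z0 - J (p, y)) \<bullet> y\<bar> \<le> \<theta> * p + \<theta> * (2 * E\<^sup>2 * (norm v)\<^sup>2 + 2 * C\<^sup>2 * p)"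
  proof -
    have "\<bar>(h z1 - h z0 - J (p, y)) \<bullet> y\<bar> \<le> \<theta> * (p + norm y) * norm y"
      by (rule inner_norm_bound[OF lin]) simp
    also have "\<dots> = \<theta> * (p * norm y) + \<theta> * (norm y)\<^sup>2" by (simp add: power2_eq_square algebra_simps)
    also have "\<dots> \<le> \<theta> * (p * 1) + \<theta> * (2 * E\<^sup>2 * (norm v)\<^sup>2 + 2 * C\<^sup>2 * \<theta> * p)"
      using p y \<theta> \<theta>0 by (intro add_mono mult_left_mono y2) auto
    also have "\<dots> \<le> \<theta> * (p * 1) + \<theta> * (2 * E\<^sup>2 * (norm v)\<^sup>2 + 2 * C\<^sup>2 * 1 * p)"
      using p \<theta> \<theta>0 by (intro add_mono mult_left_mono mult_right_mono) auto
    finally show ?thesis by simp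
  qed
  have 2: "\<bar>J (p, 0) \<bullet> y\<bar> \<le> \<theta> * B * p"
  proof -
    have "norm (J (p, 0)) \<le> B * p" using Jb[of "(p, 0)"] p by (simp add: norm_Pair)
    from inner_norm_bound[OF this y] show ?thesis by (simp add: ac_simps)
  qed
  have 3: "\<bar>J (0, y) \<bullet> \<rho>\<bar> \<le> \<theta> * (B * C) * p"
  proof -
    have "norm (J (0, y)) \<le> B * norm y" using Jb[of "(0, y)"] by (simp add: norm_Pair)
    also have "\<dots> \<le> B * \<theta>" using y B0 by (intro mult_left_mono)
    finally have "\<bar>J (0, y) \<bullet> \<rho>\<bar> \<le> B * \<theta> * (C * p)" using inner_norm_bound[OF _ \<rho>] by blast
    then show ?thesis by (simp add: ac_simps)
  qed
  have 4: "\<bar>J (0, \<rho>) \<bullet> z\<bar> \<le> \<theta> * (B * C * (1 + C)) * p"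
  proof -
    have "norm (J (0, \<rho>)) \<le> B * norm \<rho>" using Jb[of "(0, \<rho>)"] by (simp add: norm_Pair)
    also have "\<dots> \<le> B * (C * p)" using \<rho> B0 by (intro mult_left_mono)
    finally have "\<bar>J (0, \<rho>) \<bullet> z\<bar> \<le> B * (C * p) * (\<theta> + C * \<theta>)" using inner_norm_bound[OF _ z] by blast
    then show ?thesis by (simp add: algebra_simps)
  qed
  \<comment> \<open>The coefficients of \<theta> p: 1 and 2 C^2 from the linearisation, B from the
    time derivative, B C and B C (1 + C) from the mixed terms.\<close>
  have "\<bar>(h z1 - h z0) \<bullet> y - \<epsilon>\<^sup>2 * (J (0, v) \<bullet> v)\<bar> \<le>
     (\<theta> * p + \<theta> * (2 * E\<^sup>2 * (norm v)\<^sup>2 + 2 * C\<^sup>2 * p)) + \<theta> * B * p + (\<theta> * (B * C) * p + \<theta> * (B * C * (1 + C)) * p)"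
    unfolding eq using 1 2 3 4 by linarith
  also have "\<dots> = \<theta> * (1 + 2 * C\<^sup>2 + B + B * C * (2 + C)) * p + \<theta> * (2 * E\<^sup>2) * (norm v)\<^sup>2"
    by (simp add: algebra_simps)
  finally show ?thesis .
qed

lemma covariation_taylor:
  fixes h :: "real \<times> 'a \<Rightarrow> 'a::euclidean_space" and D :: "real \<times> 'a \<Rightarrow> (real \<times> 'a) \<Rightarrow>\<^sub>L 'a"
    and x v :: "real \<Rightarrow> 'a" and \<epsilon> :: "real \<Rightarrow> real"
  assumes deriv: "\<And>z. z \<in> {s..t} \<times> UNIV \<Longrightarrow> (h has_derivative blinfun_apply (D z)) (at z within {s..t} \<times> UNIV)"
    and D: "continuous_on ({s..t} \<times> UNIV) D"
    and x: "continuous_on {s..t} x" and st: "s \<le> t"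
    and u: "\<And>m. fine_partition (d m) s t (n m) (u m)" and d: "d \<longlonglongrightarrow> 0"
    and inc: "\<And>m k. k < n m \<Longrightarrow> norm (x (u m (Suc k)) - x (u m k) -
        \<epsilon> (u m (Suc k)) *\<^sub>R (v (u m (Suc k)) - v (u m k))) \<le> C * (u m (Suc k) - u m k)"
    and C: "0 \<le> C" and \<epsilon>: "\<And>r. r \<in> {s..t} \<Longrightarrow> \<bar>\<epsilon> r\<bar> \<le> E"
    and K: "\<And>m. (\<Sum>k<n m. (norm (v (u m (Suc k)) - v (u m k)))\<^sup>2) \<le> K"
  shows "(\<lambda>m. \<Sum>k<n m.
      (h (u m (Suc k), x (u m (Suc k))) - h (u m k, x (u m k))) \<bullet> (x (u m (Suc k)) - x (u m k))
      - (\<epsilon> (u m (Suc k)))\<^sup>2 * (D (u m (Suc k), x (u m (Suc k))) (0, v (u m (Suc k)) - v (u m k)) \<bullet>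
          (v (u m (Suc k)) - v (u m k)))) \<longlonglongrightarrow> 0" (is "?S \<longlonglongrightarrow> 0")
proof -
  obtain R where R: "\<And>r. r \<in> {s..t} \<Longrightarrow> norm (x r) \<le> R"
    using continuous_on_interval_bound[OF x] by blast
  \<comment> \<open>A box that contains the whole path in time and space. Compactness gives
    boundedness and uniform continuity of \<open>D\<close>; convexity keeps the segments between
    consecutive points inside.\<close>
  define Kc where "Kc = {s..t} \<times> cball (0::'a) R"
  have Kc: "compact Kc" "convex Kc" "Kc \<subseteq> {s..t} \<times> UNIV"
    by (auto simp: Kc_def intro!: compact_Times convex_Times)
  have DK: "continuous_on Kc D" by (rule continuous_on_subset[OF D Kc(3)])
  obtain B where B: "\<And>z. z \<in> Kc \<Longrightarrow> norm (D z) \<le> B"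
  proof -
    have "bounded (D ` Kc)"
      by (intro compact_imp_bounded compact_continuous_image DK Kc)
    then show ?thesis using that unfolding bounded_iff by blast
  qed
  have K0: "0 \<le> K" using order_trans[OF _ K[of 0]] by (simp add: sum_nonneg)
  have B0: "0 \<le> B"
  proof -
    have "(s, x s) \<in> Kc" using R[of s] st by (simp add: Kc_def)
    then show ?thesis using B norm_ge_zero order_trans by blast
  qed
  define A where "A = 1 + 2 * C\<^sup>2 + B + B * C * (2 + C)"
  \<comment> \<open>The summed error per unit of \<open>\<theta>\<close>: the length of the interval
    for the terms linear in the step, the bound \<open>K\<close> for the squared increments.\<close>
  define L where "L = A * (t - s) + 2 * E\<^sup>2 * K"
  have L0: "0 \<le> L" using B0 C K0 st by (auto simp: L_def A_def)
  show ?thesis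
  proof (rule LIMSEQ_I)
    fix \<eta> :: real assume \<eta>: "0 < \<eta>"
    define \<theta> where "\<theta> = min 1 (\<eta> / (2 * (1 + L)))"
    have \<theta>: "0 < \<theta>" "\<theta> \<le> 1" using \<eta> L0 by (auto simp: \<theta>_def)
    have \<theta>L: "\<theta> * L < \<eta>"
    proof -
      have "\<theta> * L \<le> (\<eta> / (2 * (1 + L))) * (1 + L)"
        using L0 \<eta> by (intro mult_mono) (auto simp: \<theta>_def)
      also have "\<dots> = \<eta> / 2" using L0 by (simp add: field_simps)
      finally show ?thesis using \<eta> by simp
    qed
    have "uniformly_continuous_on Kc D" by (rule compact_uniformly_continuous[OF DK Kc(1)])
    then obtain \<delta> where \<delta>: "0 < \<delta>" "\<And>z z'. z \<in> Kc \<Longrightarrow> z' \<in> Kc \<Longrightarrow> dist z' z < \<delta> \<Longrightarrow> dist (D z') (D z) < \<theta>"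
      unfolding uniformly_continuous_on_def using \<theta> by blast
    have "uniformly_continuous_on {s..t} x" by (rule compact_uniformly_continuous[OF x]) simp
    moreover have "0 < min (\<delta> / 2) \<theta>" using \<delta> \<theta> by simp
    ultimately obtain \<delta>' where \<delta>': "0 < \<delta>'" "\<And>r r'. r \<in> {s..t} \<Longrightarrow> r' \<in> {s..t} \<Longrightarrow> dist r' r < \<delta>' \<Longrightarrow>
        dist (x r') (x r) < min (\<delta> / 2) \<theta>"
      unfolding uniformly_continuous_on_def by blast
    have "0 < min (min (\<delta> / 2) \<theta>) \<delta>'" using \<delta> \<delta>' \<theta> by simp
    then obtain N where N: "\<And>m. m \<ge> N \<Longrightarrow> d m < min (min (\<delta> / 2) \<theta>) \<delta>'"
      using order_tendstoD(2)[OF d] unfolding eventually_sequentially by blast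
    have "norm (?S m - 0) < \<eta>" if m: "m \<ge> N" for m
    proof -
      have "norm (?S m) \<le> (\<Sum>k<n m. \<theta> * A * (u m (Suc k) - u m k) +
          \<theta> * (2 * E\<^sup>2) * (norm (v (u m (Suc k)) - v (u m k)))\<^sup>2)"
      proof (rule sum_norm_le)
        fix k assume "k \<in> {..<n m}"
        then have k: "k < n m" by simp
        have le: "u m k \<le> u m (Suc k)" and gap: "u m (Suc k) - u m k < d m"
          using u[of m] k by (auto simp: fine_partition_def)
        have mem: "u m k \<in> {s..t}" "u m (Suc k) \<in> {s..t}"
          using fine_partition_mem[OF u[of m]] k by auto
        define p where "p = u m (Suc k) - u m k"
        define y where "y = x (u m (Suc k)) - x (u m k)"
        define z0 where "z0 = (u m k, x (u m k))"
        define z1 where "z1 = (u m (Suc k), x (u m (Suc k)))"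
        have p: "0 \<le> p" "p < \<theta>" "p < \<delta> / 2" using le gap N[OF m] by (auto simp: p_def)
        have "dist (x (u m (Suc k))) (x (u m k)) < min (\<delta> / 2) \<theta>"
          using mem le gap N[OF m] by (intro \<delta>'(2)) (auto simp: dist_real_def)
        then have y: "norm y < \<theta>" "norm y < \<delta> / 2" by (auto simp: y_def dist_norm)
        have z: "z0 \<in> Kc" "z1 \<in> Kc" using mem R by (auto simp: z0_def z1_def Kc_def)
        have zz: "z1 - z0 = (p, y)" by (simp add: z0_def z1_def p_def y_def)
        have npy: "norm (p, y) \<le> p + norm y" using norm_Pair_le[of p y] p by simp
        have seg: "closed_segment z0 z1 \<subseteq> Kc" using z Kc(2) by (simp add: closed_segment_subset)
        \<comment> \<open>Linearised at the later point \<open>z1\<close> instead of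
          \<open>z0\<close>: in reversed time the coefficient is then known before the increment, as
          the martingale estimate for the quadratic form requires.\<close>
        have "norm (h z1 - h z0 - D z1 (z1 - z0)) \<le> norm (z1 - z0) * \<theta>"
        proof (rule differentiable_bound_linearization[where S = "closed_segment z0 z1" and f' = "\<lambda>z. blinfun_apply (D z)"])
          show "z0 + c *\<^sub>R (z1 - z0) \<in> closed_segment z0 z1" if "c \<in> {0..1}" for c
            using that by (auto simp: in_segment algebra_simps intro!: exI[of _ c])
          show "(h has_derivative blinfun_apply (D z)) (at z within closed_segment z0 z1)" if "z \<in> closed_segment z0 z1" for z
            using that seg Kc(3) by (intro has_derivative_subset[OF deriv]) auto
          show "onorm (blinfun_apply (D z) - blinfun_apply (D z1)) \<le> \<theta>" if zs: "z \<in> closed_segment z0 z1" for z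
          proof -
            have "dist z z1 \<le> dist z0 z1"
              using segment_bound(2)[OF zs] by (simp add: dist_norm norm_minus_commute)
            also have "\<dots> = norm (p, y)" by (simp add: dist_norm norm_minus_commute zz[symmetric])
            also have "\<dots> < \<delta>" using npy p y by simp
            finally have "dist (D z) (D z1) < \<theta>" using zs seg z by (intro \<delta>(2)) auto
            then show ?thesis by (simp add: dist_norm norm_blinfun.rep_eq minus_blinfun.rep_eq fun_diff_def)
          qed
        qed simp
        then have lin: "norm (h z1 - h z0 - D z1 (p, y)) \<le> \<theta> * (p + norm y)"
          using npy \<theta> unfolding zz by (smt (verit) mult.commute mult_left_mono)
        have "\<bar>(h z1 - h z0) \<bullet> y - (\<epsilon> (u m (Suc k)))\<^sup>2 * (D z1 (0, v (u m (Suc k)) - v (u m k)) \<bullet> (v (u m (Suc k)) - v (u m k)))\<bar>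
          \<le> \<theta> * (1 + 2 * C\<^sup>2 + B + B * C * (2 + C)) * p + \<theta> * (2 * E\<^sup>2) * (norm (v (u m (Suc k)) - v (u m k)))\<^sup>2"
          by (rule covariation_taylor_step[OF lin B[OF z(2)] p(1) _ _ \<theta>(2) _ C \<epsilon>[OF mem(2)]])
            (use p y inc[OF k] in \<open>auto simp: y_def p_def\<close>)
        then show "norm ((h (u m (Suc k), x (u m (Suc k))) - h (u m k, x (u m k))) \<bullet> (x (u m (Suc k)) - x (u m k))
            - (\<epsilon> (u m (Suc k)))\<^sup>2 * (D (u m (Suc k), x (u m (Suc k))) (0, v (u m (Suc k)) - v (u m k)) \<bullet>
              (v (u m (Suc k)) - v (u m k))))
          \<le> \<theta> * A * (u m (Suc k) - u m k) + \<theta> * (2 * E\<^sup>2) * (norm (v (u m (Suc k)) - v (u m k)))\<^sup>2"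
          by (simp add: z0_def z1_def y_def p_def A_def)
      qed
      also have "\<dots> = \<theta> * A * (t - s) + \<theta> * (2 * E\<^sup>2) * (\<Sum>k<n m. (norm (v (u m (Suc k)) - v (u m k)))\<^sup>2)"
        by (simp only: sum.distrib fine_partition_steps[OF u] sum_distrib_left)
      also have "\<dots> \<le> \<theta> * A * (t - s) + \<theta> * (2 * E\<^sup>2) * K"
        using \<theta> by (intro add_left_mono mult_left_mono K) auto
      also have "\<dots> = \<theta> * L" by (simp add: L_def algebra_simps)
      finally show ?thesis using \<theta>L by simp
    qed
    then show "\<exists>N. \<forall>m\<ge>N. norm (?S m - 0) < \<eta>" by blast
  qed
qed

text \<open>The slice of the slab at a fixed time is all of space, so restricting the derivative
  within the slab to it gives a full spatial derivative, even at the two end times.\<close>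

lemma C1_on_time_space:
  fixes h :: "real \<Rightarrow> 'a::euclidean_space \<Rightarrow> 'b::real_normed_vector"
  assumes "C1_on ({s..t} \<times> UNIV) (\<lambda>(r, x). h r x)"
  shows "\<exists>D. continuous_on ({s..t} \<times> UNIV) D \<and>
    (\<forall>z\<in>{s..t} \<times> UNIV.
      ((\<lambda>(r, x). h r x) has_derivative blinfun_apply (D z)) (at z within {s..t} \<times> UNIV)) \<and>
    (\<forall>r\<in>{s..t}. \<forall>x. (h r has_derivative (\<lambda>y. blinfun_apply (D (r, x)) (0, y))) (at x))"
proof -
  define h' where "h' = (\<lambda>(r, x). h r x)"
  obtain D where D: "continuous_on ({s..t} \<times> UNIV) D"
    and deriv: "\<And>z. z \<in> {s..t} \<times> UNIV \<Longrightarrow> (h' has_derivative blinfun_apply (D z)) (at z within {s..t} \<times> UNIV)"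
    using assms unfolding C1_on_def h'_def by blast
  have "(h r has_derivative (\<lambda>y. D (r, x) (0, y))) (at x)" if r: "r \<in> {s..t}" for r x
  proof -
    have 1: "(Pair r has_derivative (\<lambda>y. (0, y))) (at x)"
      by (auto intro!: derivative_eq_intros)
    have "(h' has_derivative blinfun_apply (D (r, x))) (at (r, x) within range (Pair r))"
      using r by (intro has_derivative_subset[OF deriv]) auto
    then have "(h' \<circ> Pair r has_derivative blinfun_apply (D (r, x)) \<circ> (\<lambda>y. (0, y))) (at x)"
      using diff_chain_within[of "Pair r" _ x UNIV h'] 1 by blast
    then show ?thesis by (simp add: h'_def comp_def)
  qed
  with D deriv show ?thesis unfolding h'_def by blast
qed

lemma divergence_eq:
  assumes "(h has_derivative h') (at x)"
  shows "divergence h x = (\<Sum>i\<in>Basis. h' i \<bullet> i)"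
  unfolding divergence_def frechet_derivative_at[OF assms, symmetric] ..

section \<open>Limits of the covariation sums and the forward integral\<close>

context reversed_diffusion
begin

text \<open>The centred products have variance of second order in the step, so the weighted sum of
  squares is at most the mesh times a constant that depends on the path alone.\<close>

lemma W_product_deviation_sum_vanishes:
  fixes i j :: 'a and c :: "real \<Rightarrow> 'w \<Rightarrow> real"
  assumes i: "i \<in> Basis" and j: "j \<in> Basis"
    and c: "\<And>r. r \<in> {s..t} \<Longrightarrow> c r \<in> borel_measurable (G r)"
    and cont: "AE \<omega> in M. continuous_on {s..t} (\<lambda>r. c r \<omega>)"
    and u: "\<And>m. fine_partition (1 / real (Suc m)) s t (n m) (u m)"
  shows "vanishes_in_prob M (\<lambda>m \<omega>. \<Sum>k<n m. c (u m (Suc k)) \<omega> *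
    (((W (u m k) \<omega> - W (u m (Suc k)) \<omega>) \<bullet> i) * ((W (u m k) \<omega> - W (u m (Suc k)) \<omega>) \<bullet> j)
      - (if i = j then u m (Suc k) - u m k else 0)))"
proof (rule vanishes_in_prob_backward_transform[where w = u and v = "\<lambda>m k. 8 * (u m (Suc k) - u m k)\<^sup>2"])
  fix m k assume k: "k < n m"
  have mem: "s \<le> u m k" "u m k \<le> u m (Suc k)" "u m (Suc k) \<le> t"
    using fine_partition_mem[OF u, of k m] fine_partition_mem[OF u, of "Suc k" m] fine_partition_le[OF u, of k "Suc k" m] k
    by auto
  show "u m k \<le> u m (Suc k)" by fact
  show "c (u m (Suc k)) \<in> borel_measurable (G (u m (Suc k)))" using mem by (intro c) auto
  have Wm: "W (u m k) \<in> borel_measurable (G (u m k))" "W (u m (Suc k)) \<in> borel_measurable (G (u m k))"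
    using W_adapted[of "u m k"] adapted_mono[OF W_adapted[of "u m (Suc k)"], of "u m k"] mem by auto
  define g where "g y = (y \<bullet> i) * (y \<bullet> j) - (if i = j then u m (Suc k) - u m k else 0)" for y :: 'a
  have g: "g \<in> borel_measurable borel" unfolding g_def by measurable
  show "(\<lambda>\<omega>. ((W (u m k) \<omega> - W (u m (Suc k)) \<omega>) \<bullet> i) * ((W (u m k) \<omega> - W (u m (Suc k)) \<omega>) \<bullet> j)
      - (if i = j then u m (Suc k) - u m k else 0)) \<in> borel_measurable (G (u m k))"
    using Wm by measurable
  show "indep_set (sets (G (u m (Suc k)))) (sets (vimage_algebra (space M)
     (\<lambda>\<omega>. ((W (u m k) \<omega> - W (u m (Suc k)) \<omega>) \<bullet> i) * ((W (u m k) \<omega> - W (u m (Suc k)) \<omega>) \<bullet> j)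
      - (if i = j then u m (Suc k) - u m k else 0)) borel))"
    using W_indep_compose[OF mem g] unfolding g_def .
  note W_product_deviation[OF mem i j]
  then show "expectation (\<lambda>\<omega>. ((W (u m k) \<omega> - W (u m (Suc k)) \<omega>) \<bullet> i) * ((W (u m k) \<omega> - W (u m (Suc k)) \<omega>) \<bullet> j)
      - (if i = j then u m (Suc k) - u m k else 0)) = 0"
    "integrable M (\<lambda>\<omega>. (((W (u m k) \<omega> - W (u m (Suc k)) \<omega>) \<bullet> i) * ((W (u m k) \<omega> - W (u m (Suc k)) \<omega>) \<bullet> j)
      - (if i = j then u m (Suc k) - u m k else 0))\<^sup>2)"
    "expectation (\<lambda>\<omega>. (((W (u m k) \<omega> - W (u m (Suc k)) \<omega>) \<bullet> i) * ((W (u m k) \<omega> - W (u m (Suc k)) \<omega>) \<bullet> j)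
      - (if i = j then u m (Suc k) - u m k else 0))\<^sup>2) \<le> 8 * (u m (Suc k) - u m k)\<^sup>2"
    by blast+
  show "0 < 8 * (u m (Suc k) - u m k)\<^sup>2 \<or> (\<forall>\<omega>. ((W (u m k) \<omega> - W (u m (Suc k)) \<omega>) \<bullet> i) * ((W (u m k) \<omega> - W (u m (Suc k)) \<omega>) \<bullet> j)
      - (if i = j then u m (Suc k) - u m k else 0) = 0)"
    using mem by (cases "u m k = u m (Suc k)") auto
next
  show "AE \<omega> in M. (\<lambda>m. \<Sum>k<n m. (c (u m (Suc k)) \<omega>)\<^sup>2 * (8 * (u m (Suc k) - u m k)\<^sup>2)) \<longlonglongrightarrow> 0"
    using cont
  proof eventually_elim
    case (elim \<omega>)
    obtain B where B: "\<And>r. r \<in> {s..t} \<Longrightarrow> \<bar>c r \<omega>\<bar> \<le> B"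
      using continuous_on_interval_bound[OF elim] unfolding real_norm_def by blast
    have "(\<lambda>m. B\<^sup>2 * 8 * (t - s) * (1 / real (Suc m))) \<longlonglongrightarrow> B\<^sup>2 * 8 * (t - s) * 0"
      by (intro tendsto_mult_left lim_1_over_n[THEN LIMSEQ_Suc])
    then have lim: "(\<lambda>m. B\<^sup>2 * 8 * (t - s) * (1 / real (Suc m))) \<longlonglongrightarrow> 0" by simp
    have "norm (\<Sum>k<n m. (c (u m (Suc k)) \<omega>)\<^sup>2 * (8 * (u m (Suc k) - u m k)\<^sup>2)) \<le> B\<^sup>2 * 8 * (t - s) * (1 / real (Suc m))" for m
    proof -
      have "norm (\<Sum>k<n m. (c (u m (Suc k)) \<omega>)\<^sup>2 * (8 * (u m (Suc k) - u m k)\<^sup>2))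
          \<le> (\<Sum>k<n m. B\<^sup>2 * 8 * (1 / real (Suc m)) * (u m (Suc k) - u m k))"
      proof (rule sum_norm_le)
        fix k assume "k \<in> {..<n m}"
        then have k: "k < n m" by simp
        have p: "0 \<le> u m (Suc k) - u m k" "u m (Suc k) - u m k \<le> 1 / real (Suc m)"
          using u[of m] k by (auto simp: fine_partition_def intro: less_imp_le)
        have "\<bar>c (u m (Suc k)) \<omega>\<bar>\<^sup>2 \<le> B\<^sup>2"
          using B[OF fine_partition_mem[OF u, of "Suc k" m]] k by (intro power_mono) auto
        then have "(c (u m (Suc k)) \<omega>)\<^sup>2 * (8 * (u m (Suc k) - u m k)\<^sup>2) \<le> B\<^sup>2 * (8 * (1 / real (Suc m) * (u m (Suc k) - u m k)))"
          using p unfolding power2_eq_square[of "u m (Suc k) - u m k"]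
          by (intro mult_mono mult_left_mono mult_right_mono) auto
        moreover have "0 \<le> (c (u m (Suc k)) \<omega>)\<^sup>2 * (8 * (u m (Suc k) - u m k)\<^sup>2)" by simp
        ultimately show "norm ((c (u m (Suc k)) \<omega>)\<^sup>2 * (8 * (u m (Suc k) - u m k)\<^sup>2)) \<le> B\<^sup>2 * 8 * (1 / real (Suc m)) * (u m (Suc k) - u m k)"
          by (simp only: real_norm_def abs_of_nonneg mult.assoc)
      qed
      also have "\<dots> = B\<^sup>2 * 8 * (1 / real (Suc m)) * (t - s)" by (rule fine_partition_steps[OF u])
      finally show ?thesis by (simp add: ac_simps)
    qed
    then show ?case by (intro Lim_null_comparison[OF _ lim] always_eventually) blast
  qed
qed

lemma X_increment_partitions:
  fixes n :: "nat \<Rightarrow> nat"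
  assumes u: "\<And>m. fine_partition (d m) s t (n m) (u m)"
  shows "AE \<omega> in M. \<forall>m. \<forall>k\<in>{..<n m}. norm (X (u m (Suc k)) \<omega> - X (u m k) \<omega>
        - \<epsilon> (u m (Suc k)) *\<^sub>R (W (u m (Suc k)) \<omega> - W (u m k) \<omega>)) \<le> C \<omega> * (u m (Suc k) - u m k)"
  unfolding AE_all_countable
proof (intro allI AE_finite_allI)
  fix m k assume "k \<in> {..<n m}"
  then show "AE \<omega> in M. norm (X (u m (Suc k)) \<omega> - X (u m k) \<omega>
        - \<epsilon> (u m (Suc k)) *\<^sub>R (W (u m (Suc k)) \<omega> - W (u m k) \<omega>)) \<le> C \<omega> * (u m (Suc k) - u m k)"
    using fine_partition_mem[OF u, of k m] fine_partition_mem[OF u, of "Suc k" m] fine_partition_le[OF u, of k "Suc k" m]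
    by (intro X_increment) auto
qed simp

text \<open>Convergence in probability gives almost sure limits along subsequences only, which is
  what \<open>mesh_limitI\<close> accepts. The limit does not depend on the partitions.\<close>

lemma covariation_subseq:
  fixes h :: "real \<times> 'a \<Rightarrow> 'a" and D :: "real \<times> 'a \<Rightarrow> (real \<times> 'a) \<Rightarrow>\<^sub>L 'a"
  assumes deriv: "\<And>z. z \<in> {s..t} \<times> UNIV \<Longrightarrow> (h has_derivative blinfun_apply (D z)) (at z within {s..t} \<times> UNIV)"
    and D: "continuous_on ({s..t} \<times> UNIV) D"
    and u: "\<And>m. fine_partition (1 / real (Suc m)) s t (n m) (u m)"
  obtains r :: "nat \<Rightarrow> nat" where "strict_mono r"
    "AE \<omega> in M. (\<lambda>m. \<Sum>k<n (r m). (h (u (r m) (Suc k), X (u (r m) (Suc k)) \<omega>) - h (u (r m) k, X (u (r m) k) \<omega>))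
          \<bullet> (X (u (r m) (Suc k)) \<omega> - X (u (r m) k) \<omega>))
        \<longlonglongrightarrow> integral {s..t} (\<lambda>q. (\<epsilon> q)\<^sup>2 * (\<Sum>i\<in>Basis. D (q, X q \<omega>) (0, i) \<bullet> i))"
proof -
  define c where "c i j q \<omega> = (\<epsilon> q)\<^sup>2 * (D (q, X q \<omega>) (0, i) \<bullet> j)" for i j q \<omega>
  have c_meas: "c i j q \<in> borel_measurable (G q)" if q: "q \<in> {s..t}" for i j q
  proof -
    have "continuous_on UNIV (\<lambda>x. (\<epsilon> q)\<^sup>2 * (D (q, x) (0, i) \<bullet> j))"
      by (intro continuous_intros continuous_on_compose2[OF D]) (use q in auto)
    then have "(\<lambda>x. (\<epsilon> q)\<^sup>2 * (D (q, x) (0, i) \<bullet> j)) \<in> borel_measurable borel"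
      by (rule borel_measurable_continuous_onI)
    from measurable_compose[OF X_adapted[OF q] this] show ?thesis unfolding c_def .
  qed
  have c_cont: "AE \<omega> in M. continuous_on {s..t} (\<lambda>q. c i j q \<omega>)" for i j
    using X_cont
  proof eventually_elim
    case (elim \<omega>)
    show ?case unfolding c_def
      by (intro continuous_intros \<epsilon>_cont continuous_on_compose2[OF D] elim) auto
  qed
  define dev where "dev m k i j \<omega> = ((W (u m k) \<omega> - W (u m (Suc k)) \<omega>) \<bullet> i) * ((W (u m k) \<omega> - W (u m (Suc k)) \<omega>) \<bullet> j)
      - (if i = j then u m (Suc k) - u m k else 0)" for m k i j \<omega>
  \<comment> \<open>\<open>P\<close> is the deviation of the quadratic forms from their traces.
    \<open>Q\<close> is the deviation of the squared norms of the Brownian increments from their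
    means; its convergence keeps the sums of these squares bounded, as the Taylor estimate
    needs.\<close>
  define P where "P m \<omega> = (\<Sum>i\<in>Basis. \<Sum>j\<in>Basis. \<Sum>k<n m. c i j (u m (Suc k)) \<omega> * dev m k i j \<omega>)" for m \<omega>
  define Q where "Q m \<omega> = (\<Sum>i\<in>Basis. \<Sum>k<n m. 1 * dev m k i i \<omega>)" for m \<omega>
  have "vanishes_in_prob M P"
    unfolding P_def dev_def
    by (intro vanishes_in_prob_sum W_product_deviation_sum_vanishes c_meas c_cont u)
  then obtain r1 where r1: "strict_mono r1" "AE \<omega> in M. (\<lambda>m. P (r1 m) \<omega>) \<longlonglongrightarrow> 0"
    by (rule vanishes_in_prob_subseq)
  have u1: "fine_partition (1 / real (Suc m)) s t (n (r1 m)) (u (r1 m))" for m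
    using strict_mono_imp_increasing[OF r1(1), of m]
    by (intro fine_partition_mono[OF u[of "r1 m"]] divide_left_mono) auto
  have "vanishes_in_prob M (\<lambda>m. Q (r1 m))"
    unfolding Q_def dev_def
    by (intro vanishes_in_prob_sum W_product_deviation_sum_vanishes[where c = "\<lambda>_ _. 1"] u1) auto
  then obtain r2 where r2: "strict_mono r2" "AE \<omega> in M. (\<lambda>m. Q (r1 (r2 m)) \<omega>) \<longlonglongrightarrow> 0"
    by (rule vanishes_in_prob_subseq)
  define r where "r m = r1 (r2 m)" for m
  have r: "strict_mono r" using r1(1) r2(1) unfolding r_def by (simp add: strict_mono_def)
  have ur: "fine_partition (1 / real (Suc m)) s t (n (r m)) (u (r m))" for m
    using strict_mono_imp_increasing[OF r, of m]
    by (intro fine_partition_mono[OF u[of "r m"]] divide_left_mono) auto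
  have P: "AE \<omega> in M. (\<lambda>m. P (r m) \<omega>) \<longlonglongrightarrow> 0"
    using r1(2) by eventually_elim (use LIMSEQ_subseq_LIMSEQ[OF _ r2(1)] in \<open>auto simp: r_def comp_def\<close>)
  have Q: "AE \<omega> in M. (\<lambda>m. Q (r m) \<omega>) \<longlonglongrightarrow> 0"
    using r2(2) by (simp add: r_def)
  have mesh: "(\<lambda>m. 1 / real (Suc m)) \<longlonglongrightarrow> 0" by (rule lim_1_over_n[THEN LIMSEQ_Suc])
  obtain E where E: "\<And>q. q \<in> {s..t} \<Longrightarrow> \<bar>\<epsilon> q\<bar> \<le> E"
    using continuous_on_interval_bound[OF \<epsilon>_cont] unfolding real_norm_def by blast
  have inc: "AE \<omega> in M. \<forall>m. \<forall>k\<in>{..<n (r m)}. norm (X (u (r m) (Suc k)) \<omega> - X (u (r m) k) \<omega>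
        - \<epsilon> (u (r m) (Suc k)) *\<^sub>R (W (u (r m) (Suc k)) \<omega> - W (u (r m) k) \<omega>))
        \<le> C \<omega> * (u (r m) (Suc k) - u (r m) k)"
    by (rule X_increment_partitions[OF ur])
  have "AE \<omega> in M. (\<lambda>m. \<Sum>k<n (r m). (h (u (r m) (Suc k), X (u (r m) (Suc k)) \<omega>) - h (u (r m) k, X (u (r m) k) \<omega>))
          \<bullet> (X (u (r m) (Suc k)) \<omega> - X (u (r m) k) \<omega>))
        \<longlonglongrightarrow> integral {s..t} (\<lambda>q. (\<epsilon> q)\<^sup>2 * (\<Sum>i\<in>Basis. D (q, X q \<omega>) (0, i) \<bullet> i))"
    using X_cont P Q inc
  proof eventually_elim
    case (elim \<omega>)
    let ?u = "\<lambda>m. u (r m)" and ?n = "\<lambda>m. n (r m)"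
    define dw where "dw m k = W (?u m (Suc k)) \<omega> - W (?u m k) \<omega>" for m k
    have dev: "dev (r m) k i j \<omega> = (dw m k \<bullet> i) * (dw m k \<bullet> j) - (if i = j then ?u m (Suc k) - ?u m k else 0)" for m k i j
      by (simp add: dev_def dw_def inner_diff_left algebra_simps)
    have Qeq: "(\<Sum>k<?n m. (norm (dw m k))\<^sup>2) = Q (r m) \<omega> + real DIM('a) * (t - s)" for m
    proof -
      have "(\<Sum>i\<in>Basis. dev (r m) k i i \<omega>) = (norm (dw m k))\<^sup>2 - real DIM('a) * (?u m (Suc k) - ?u m k)" for k
        unfolding dev by (simp add: sum_subtractf power2_norm_eq_inner euclidean_inner[of "dw m k" "dw m k"])
      then have "Q (r m) \<omega> = (\<Sum>k<?n m. (norm (dw m k))\<^sup>2 - real DIM('a) * (?u m (Suc k) - ?u m k))"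
        unfolding Q_def by (subst sum.swap) simp
      then show ?thesis by (simp add: sum_subtractf fine_partition_steps[OF ur])
    qed
    \<comment> \<open>A convergent sequence is bounded, which gives a path-dependent
      \<open>K\<close> valid for all partitions of the subsequence.\<close>
    have "Bseq (\<lambda>m. Q (r m) \<omega> + real DIM('a) * (t - s))"
      using elim(3) by (intro convergent_imp_Bseq convergent_add) (auto simp: convergent_def intro: tendsto_const)
    then obtain K where K: "\<And>m. norm (Q (r m) \<omega> + real DIM('a) * (t - s)) \<le> K" unfolding Bseq_def by blast
    have K': "(\<Sum>k<?n m. (norm (dw m k))\<^sup>2) \<le> K" for m
      using K[of m] unfolding Qeq by simp
    have T: "(\<lambda>m. \<Sum>k<?n m.
      (h (?u m (Suc k), X (?u m (Suc k)) \<omega>) - h (?u m k, X (?u m k) \<omega>)) \<bullet> (X (?u m (Suc k)) \<omega> - X (?u m k) \<omega>)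
      - (\<epsilon> (?u m (Suc k)))\<^sup>2 * (D (?u m (Suc k), X (?u m (Suc k)) \<omega>) (0, dw m k) \<bullet> dw m k)) \<longlonglongrightarrow> 0"
      unfolding dw_def
      by (rule covariation_taylor[where x = "\<lambda>q. X q \<omega>" and v = "\<lambda>q. W q \<omega>", OF deriv D elim(1) interval ur mesh _ C_nonneg E])
        (use elim(4) K' in \<open>auto simp: dw_def\<close>)
    have R: "(\<lambda>m. \<Sum>k<?n m. (\<Sum>i\<in>Basis. c i i (?u m (Suc k)) \<omega>) * (?u m (Suc k) - ?u m k))
        \<longlonglongrightarrow> integral {s..t} (\<lambda>q. \<Sum>i\<in>Basis. c i i q \<omega>)"
    proof (rule right_Riemann_sum_tendsto[OF ur mesh interval])
      show "continuous_on {s..t} (\<lambda>q. \<Sum>i\<in>Basis. c i i q \<omega>)" unfolding c_def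
        by (intro continuous_intros \<epsilon>_cont continuous_on_compose2[OF D] elim(1)) auto
    qed
    have Peq: "P (r m) \<omega> = (\<Sum>k<?n m. (\<epsilon> (?u m (Suc k)))\<^sup>2 * (D (?u m (Suc k), X (?u m (Suc k)) \<omega>) (0, dw m k) \<bullet> dw m k))
        - (\<Sum>k<?n m. (\<Sum>i\<in>Basis. c i i (?u m (Suc k)) \<omega>) * (?u m (Suc k) - ?u m k))" for m
    proof -
      have "(\<Sum>i\<in>Basis. \<Sum>j\<in>Basis. c i j (?u m (Suc k)) \<omega> * dev (r m) k i j \<omega>) =
          (\<epsilon> (?u m (Suc k)))\<^sup>2 * (D (?u m (Suc k), X (?u m (Suc k)) \<omega>) (0, dw m k) \<bullet> dw m k)
          - (\<Sum>i\<in>Basis. c i i (?u m (Suc k)) \<omega>) * (?u m (Suc k) - ?u m k)" for k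
      proof -
        let ?J = "D (?u m (Suc k), X (?u m (Suc k)) \<omega>)"
        have "(0, dw m k) = (\<Sum>i\<in>Basis. (dw m k \<bullet> i) *\<^sub>R (0::real, i))"
          by (simp add: sum_prod euclidean_representation)
        then have "?J (0, dw m k) = (\<Sum>i\<in>Basis. (dw m k \<bullet> i) *\<^sub>R ?J (0, i))"
          by (simp only: blinfun.sum_right blinfun.scaleR_right)
        then have "?J (0, dw m k) \<bullet> dw m k = (\<Sum>i\<in>Basis. (dw m k \<bullet> i) * (?J (0, i) \<bullet> dw m k))"
          by (simp add: inner_sum_left)
        also have "\<dots> = (\<Sum>i\<in>Basis. \<Sum>j\<in>Basis. (?J (0, i) \<bullet> j) * ((dw m k \<bullet> i) * (dw m k \<bullet> j)))"
          by (subst euclidean_inner) (simp add: sum_distrib_left algebra_simps)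
        finally have 1: "(\<epsilon> (?u m (Suc k)))\<^sup>2 * (?J (0, dw m k) \<bullet> dw m k) =
            (\<Sum>i\<in>Basis. \<Sum>j\<in>Basis. c i j (?u m (Suc k)) \<omega> * ((dw m k \<bullet> i) * (dw m k \<bullet> j)))"
          by (simp add: c_def sum_distrib_left algebra_simps)
        \<comment> \<open>The centring is diagonal, so only the trace of the spatial derivative,
          that is the divergence, enters the Riemann sum.\<close>
        have 2: "(\<Sum>i\<in>Basis. \<Sum>j\<in>Basis. c i j (?u m (Suc k)) \<omega> * (if i = j then ?u m (Suc k) - ?u m k else 0)) =
            (\<Sum>i\<in>Basis. c i i (?u m (Suc k)) \<omega>) * (?u m (Suc k) - ?u m k)"
          by (simp add: if_distrib sum_distrib_right cong: if_cong)
        show ?thesis unfolding dev right_diff_distrib sum_subtractf 1 2 ..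
      qed
      moreover have "P (r m) \<omega> = (\<Sum>k<?n m. \<Sum>i\<in>Basis. \<Sum>j\<in>Basis. c i j (?u m (Suc k)) \<omega> * dev (r m) k i j \<omega>)"
        unfolding P_def
        by (rule sym, rule trans, rule sum.swap, rule sum.cong[OF refl], rule sum.swap)
      ultimately show ?thesis by (simp add: sum_subtractf)
    qed
    \<comment> \<open>Taylor error, fluctuation and Riemann sum add up to the covariation
      sum.\<close>
    have "(\<lambda>m. (\<Sum>k<?n m.
      (h (?u m (Suc k), X (?u m (Suc k)) \<omega>) - h (?u m k, X (?u m k) \<omega>)) \<bullet> (X (?u m (Suc k)) \<omega> - X (?u m k) \<omega>)
      - (\<epsilon> (?u m (Suc k)))\<^sup>2 * (D (?u m (Suc k), X (?u m (Suc k)) \<omega>) (0, dw m k) \<bullet> dw m k))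
      + P (r m) \<omega> + (\<Sum>k<?n m. (\<Sum>i\<in>Basis. c i i (?u m (Suc k)) \<omega>) * (?u m (Suc k) - ?u m k)))
       \<longlonglongrightarrow> 0 + 0 + integral {s..t} (\<lambda>q. \<Sum>i\<in>Basis. c i i q \<omega>)"
      by (intro tendsto_add T elim(2) R)
    then show ?case by (simp add: Peq sum_subtractf c_def sum_distrib_left)
  qed
  with r show ?thesis by (rule that)
qed

lemma stochastic_integrals_exist:
  fixes h :: "real \<Rightarrow> 'a \<Rightarrow> 'a"
  assumes h: "C1_on ({s..t} \<times> UNIV) (\<lambda>(r, x). h r x)"
  obtains B F where "has_backward_integral M (\<bullet>) (\<lambda>r \<omega>. h r (X r \<omega>)) X s t B"
    "has_forward_integral M (\<bullet>) (\<lambda>r \<omega>. h r (X r \<omega>)) X s t F"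
    "AE \<omega> in M. B \<omega> - F \<omega> = integral {s..t} (\<lambda>r. (\<epsilon> r)\<^sup>2 * divergence (h r) (X r \<omega>))"
proof -
  define h' where "h' = (\<lambda>(r, x). h r x)"
  obtain D where D: "continuous_on ({s..t} \<times> UNIV) D"
    and deriv': "\<forall>z\<in>{s..t} \<times> UNIV. (h' has_derivative blinfun_apply (D z)) (at z within {s..t} \<times> UNIV)"
    and sect: "\<forall>r\<in>{s..t}. \<forall>x. (h r has_derivative (\<lambda>y. D (r, x) (0, y))) (at x)"
    using C1_on_time_space[OF h] unfolding h'_def by blast
  note deriv = deriv'[rule_format]
  have div: "divergence (h r) x = (\<Sum>i\<in>Basis. D (r, x) (0, i) \<bullet> i)" if "r \<in> {s..t}" for r x
    using sect that by (intro divergence_eq) blast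
  have h'_cont: "continuous_on ({s..t} \<times> UNIV) h'"
    using deriv by (rule has_derivative_continuous_on)
  define H where "H r \<omega> = h r (X r \<omega>)" for r \<omega>
  have H: "H r \<in> borel_measurable (G r)" if r: "r \<in> {s..t}" for r
  proof -
    have "continuous_on UNIV (\<lambda>x. h' (r, x))"
      by (intro continuous_on_compose2[OF h'_cont] continuous_intros) (use r in auto)
    then have "(\<lambda>x. h' (r, x)) \<in> borel_measurable borel" by (rule borel_measurable_continuous_onI)
    from measurable_compose[OF X_adapted[OF r] this] show ?thesis by (simp add: H_def[abs_def] h'_def)
  qed
  have H_cont: "AE \<omega> in M. continuous_on {s..t} (\<lambda>r. H r \<omega>)"
    using X_cont
  proof eventually_elim
    case (elim \<omega>)
    have "continuous_on {s..t} (\<lambda>r. h' (r, X r \<omega>))"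
      by (intro continuous_on_compose2[OF h'_cont] continuous_intros elim) auto
    then show ?case by (simp add: H_def h'_def)
  qed
  obtain B where B: "has_backward_integral M (\<bullet>) H X s t B"
    using has_backward_integral_exists[OF H H_cont] by blast
  \<comment> \<open>Right minus left sum is the sum of increments of the integrand against
    increments of \<open>X\<close>; multiplication by -1 matches the form of
    \<open>mesh_limit_scaleR\<close>.\<close>
  define S where "S n u \<omega> = right_sum (\<bullet>) H X n u \<omega> + (-1) *\<^sub>R left_sum (\<bullet>) H X n u \<omega>" for n u \<omega>
  have S_eq: "S n u \<omega> = (\<Sum>k<n. (h' (u (Suc k), X (u (Suc k)) \<omega>) - h' (u k, X (u k) \<omega>)) \<bullet> (X (u (Suc k)) \<omega> - X (u k) \<omega>))" for n u \<omega>
    by (simp add: S_def right_sum_def left_sum_def h'_def H_def inner_diff_left sum_subtractf)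
  have S_meas: "S n u \<in> borel_measurable M" if fp: "fine_partition d s t n u" for d n u
  proof -
    have "left_sum (\<bullet>) H X n u \<in> borel_measurable M"
      unfolding left_sum_def using adapted_measurable[OF H] X_measurable fine_partition_mem[OF fp]
      by (intro borel_measurable_sum borel_measurable_inner borel_measurable_diff) auto
    with right_sum_measurable[OF H fp] show ?thesis unfolding S_def by measurable
  qed
  define I where "I \<omega> = integral {s..t} (\<lambda>r. (\<epsilon> r)\<^sup>2 * divergence (h r) (X r \<omega>))" for \<omega>
  have I_eq: "I \<omega> = integral {s..t} (\<lambda>q. (\<epsilon> q)\<^sup>2 * (\<Sum>i\<in>Basis. D (q, X q \<omega>) (0, i) \<bullet> i))" for \<omega>
    unfolding I_def by (intro Henstock_Kurzweil_Integration.integral_cong) (simp add: div)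
  have sub: "\<exists>r. strict_mono r \<and> (AE \<omega> in M. (\<lambda>m. S (n (r m)) (u (r m)) \<omega>) \<longlonglongrightarrow> I \<omega>)"
    if u: "\<And>m. fine_partition (1 / real (Suc m)) s t (n m) (u m)" for n u
    unfolding S_eq I_eq by (rule covariation_subseq[OF deriv D u], assumption, intro exI conjI, assumption+)
  have "\<exists>n u. fine_partition (1 / real (Suc m)) s t n u" for m
    using interval by (intro ex_fine_partition) auto
  then obtain n u where u: "\<And>m. fine_partition (1 / real (Suc m)) s t (n m) (u m)" by metis
  obtain r where r: "AE \<omega> in M. (\<lambda>m. S (n (r m)) (u (r m)) \<omega>) \<longlonglongrightarrow> I \<omega>"
    using sub[OF u] by blast
  \<comment> \<open>\<open>M\<close> need not be complete, so \<open>I\<close> itself may fail to be measurable.\<close>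
  define Q where "Q \<omega> = lim (\<lambda>m. S (n (r m)) (u (r m)) \<omega>)" for \<omega>
  have Sr: "S (n (r m)) (u (r m)) \<in> borel_measurable M" for m by (rule S_meas[OF u])
  have Q: "Q \<in> borel_measurable M" unfolding Q_def using Sr by (intro borel_measurable_lim_metric)
  have QI: "AE \<omega> in M. Q \<omega> = I \<omega>"
    using r by eventually_elim (simp add: Q_def limI)
  \<comment> \<open>Different sequences of partitions give different subsequences but the same
    pathwise integral, so the single function \<open>Q\<close> is the limit for all of them.\<close>
  have "mesh_limit M S s t Q"
  proof (rule mesh_limitI[OF Q, of 1])
    fix n u assume u: "\<And>m. fine_partition (1 / real (Suc m)) s t (n m) (u m)"
    obtain r where r: "strict_mono r" "AE \<omega> in M. (\<lambda>m. S (n (r m)) (u (r m)) \<omega>) \<longlonglongrightarrow> I \<omega>"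
      using sub[OF u] by blast
    have "vanishes_in_prob M (\<lambda>m \<omega>. S (n (r m)) (u (r m)) \<omega> - Q \<omega>)"
    proof (rule vanishes_in_prob_AE)
      show "(\<lambda>\<omega>. S (n (r m)) (u (r m)) \<omega> - Q \<omega>) \<in> borel_measurable M" for m
        using S_meas[OF u] Q by (rule borel_measurable_diff)
      show "AE \<omega> in M. (\<lambda>m. S (n (r m)) (u (r m)) \<omega> - Q \<omega>) \<longlonglongrightarrow> 0"
        using r(2) QI by eventually_elim (simp add: LIM_zero)
    qed
    with r(1) show "\<exists>r. strict_mono r \<and> vanishes_in_prob M (\<lambda>m \<omega>. S (n (r m)) (u (r m)) \<omega> - Q \<omega>)" by blast
  qed (auto intro: S_meas)
  \<comment> \<open>Subtracting the covariation sums from the right sums leaves exactly the left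
    sums.\<close>
  then have "mesh_limit M (\<lambda>n u \<omega>. right_sum (\<bullet>) H X n u \<omega> + (-1) *\<^sub>R S n u \<omega>) s t (\<lambda>\<omega>. B \<omega> + (-1) *\<^sub>R Q \<omega>)"
    using B unfolding has_backward_integral_def by (intro mesh_limit_add mesh_limit_scaleR)
  then have F: "has_forward_integral M (\<bullet>) H X s t (\<lambda>\<omega>. B \<omega> - Q \<omega>)"
    by (simp add: has_forward_integral_def S_def)
  have H_eq: "H = (\<lambda>r \<omega>. h r (X r \<omega>))" by (intro ext) (simp add: H_def)
  show ?thesis
  proof (rule that)
    show "AE \<omega> in M. B \<omega> - (B \<omega> - Q \<omega>) = integral {s..t} (\<lambda>r. (\<epsilon> r)\<^sup>2 * divergence (h r) (X r \<omega>))"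
      using QI by eventually_elim (simp add: I_def)
  qed (use B F in \<open>simp_all only: H_eq\<close>)
qed

end

section \<open>Increments of a backward stochastic differential equation\<close>

lemma sum_by_parts:
  fixes e :: "nat \<Rightarrow> real" and w :: "nat \<Rightarrow> 'a::real_vector"
  shows "(\<Sum>k<n. e (Suc k) *\<^sub>R (w (Suc k) - w k)) =
    e n *\<^sub>R w n - e 0 *\<^sub>R w 0 - (\<Sum>k<n. (e (Suc k) - e k) *\<^sub>R w k)"
  by (induction n) (auto simp: algebra_simps)

text \<open>
  A Riemann sum of a Lipschitz coefficient is compared pathwise with a single increment through
  summation by parts, so no estimate of a stochastic integral is involved.
\<close>

lemma right_sum_lipschitz_deviation:
  fixes \<epsilon> :: "real \<Rightarrow> real" and w :: "real \<Rightarrow> 'a::real_normed_vector"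
  assumes p: "fine_partition d r u n p"
    and L: "\<And>x y. x \<in> {r..u} \<Longrightarrow> y \<in> {r..u} \<Longrightarrow> \<bar>\<epsilon> x - \<epsilon> y\<bar> \<le> L * \<bar>x - y\<bar>"
    and K: "\<And>x. x \<in> {r..u} \<Longrightarrow> norm (w x) \<le> K" and L0: "0 \<le> L"
  shows "norm ((\<Sum>k<n. \<epsilon> (p (Suc k)) *\<^sub>R (w (p (Suc k)) - w (p k))) - \<epsilon> u *\<^sub>R (w u - w r)) \<le> 2 * L * K * (u - r)"
proof -
  have ends: "p 0 = r" "p n = u" using p by (auto simp: fine_partition_def)
  have mem: "p k \<in> {r..u}" if "k \<le> n" for k by (rule fine_partition_mem[OF p that])
  have ru: "r \<le> u" using mem[of 0] ends by simp
  have "(\<Sum>k<n. w (p (Suc k)) - w (p k)) = w u - w r"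
    by (simp only: sum_lessThan_telescope[of "\<lambda>k. w (p k)"] ends)
  then have "(\<Sum>k<n. \<epsilon> (p (Suc k)) *\<^sub>R (w (p (Suc k)) - w (p k))) - \<epsilon> u *\<^sub>R (w u - w r)
      = (\<Sum>k<n. (\<epsilon> (p (Suc k)) - \<epsilon> u) *\<^sub>R (w (p (Suc k)) - w (p k)))"
    by (simp only: scaleR_left_diff_distrib sum_subtractf scaleR_sum_right[symmetric])
  \<comment> \<open>Summation by parts for \<open>\<epsilon> - \<epsilon> u\<close>, so that the
    boundary term at \<open>u\<close> drops out. The boundary term at \<open>r\<close> and the
    remaining sum contribute \<open>L * K * (u - r)\<close> each, whence the factor 2.\<close>
  also have "\<dots> = - ((\<epsilon> r - \<epsilon> u) *\<^sub>R w r) - (\<Sum>k<n. (\<epsilon> (p (Suc k)) - \<epsilon> (p k)) *\<^sub>R w (p k))"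
    using sum_by_parts[of "\<lambda>k. \<epsilon> (p k) - \<epsilon> u" "\<lambda>k. w (p k)" n] by (simp add: ends)
  also have "norm \<dots> \<le> norm ((\<epsilon> r - \<epsilon> u) *\<^sub>R w r) + norm (\<Sum>k<n. (\<epsilon> (p (Suc k)) - \<epsilon> (p k)) *\<^sub>R w (p k))"
    by (rule order_trans[OF norm_triangle_ineq4]) simp
  also have "\<dots> \<le> L * K * (u - r) + L * K * (u - r)"
  proof (rule add_mono)
    have "norm ((\<epsilon> r - \<epsilon> u) *\<^sub>R w r) \<le> (L * \<bar>r - u\<bar>) * K"
      using L[of r u] K[of r] ru L0 by (auto intro!: mult_mono)
    then show "norm ((\<epsilon> r - \<epsilon> u) *\<^sub>R w r) \<le> L * K * (u - r)" using ru by (simp add: algebra_simps)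
    have "norm (\<Sum>k<n. (\<epsilon> (p (Suc k)) - \<epsilon> (p k)) *\<^sub>R w (p k)) \<le> (\<Sum>k<n. L * K * (p (Suc k) - p k))"
    proof (rule sum_norm_le)
      fix k assume "k \<in> {..<n}"
      then have k: "k < n" by simp
      have "norm ((\<epsilon> (p (Suc k)) - \<epsilon> (p k)) *\<^sub>R w (p k)) \<le> (L * \<bar>p (Suc k) - p k\<bar>) * K"
        using L[OF mem mem, of "Suc k" k] K[OF mem, of k] k L0 by (auto intro!: mult_mono)
      then show "norm ((\<epsilon> (p (Suc k)) - \<epsilon> (p k)) *\<^sub>R w (p k)) \<le> L * K * (p (Suc k) - p k)"
        using fine_partition_le[OF p, of k "Suc k"] k by (simp add: algebra_simps)
    qed
    also have "\<dots> = L * K * (u - r)" by (rule fine_partition_steps[OF p])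
    finally show "norm (\<Sum>k<n. (\<epsilon> (p (Suc k)) - \<epsilon> (p k)) *\<^sub>R w (p k)) \<le> L * K * (u - r)" .
  qed
  finally show ?thesis by (simp add: algebra_simps)
qed

section \<open>Noise over adjacent intervals\<close>

lemma fine_partition_concat:
  assumes p: "fine_partition d r u n p" and q: "fine_partition d u t m q"
  shows "fine_partition d r t (n + m) (\<lambda>k. if k \<le> n then p k else q (k - n))"
  unfolding fine_partition_def
proof (intro conjI allI impI)
  let ?w = "\<lambda>k. if k \<le> n then p k else q (k - n)"
  have ends: "p 0 = r" "p n = u" "q 0 = u" "q m = t" using p q by (auto simp: fine_partition_def)
  show "?w 0 = r" using ends by simp
  show "?w (n + m) = t" using ends by (cases m) auto
  fix k assume k: "k < n + m"
  consider "k < n" | "n \<le> k" by linarith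
  then have "?w k \<le> ?w (Suc k) \<and> ?w (Suc k) - ?w k < d"
  proof cases
    case 1
    then show ?thesis using p by (simp add: fine_partition_def)
  next
    case 2
    then have "?w k = q (k - n)" "?w (Suc k) = q (Suc (k - n))" "k - n < m"
      using k ends by (auto simp: Suc_diff_le)
    then show ?thesis using q by (simp only:) (simp add: fine_partition_def)
  qed
  then show "?w k \<le> ?w (Suc k)" "?w (Suc k) - ?w k < d" by auto
qed

lemma right_sum_concat:
  assumes p: "fine_partition d r u n p" and q: "fine_partition d u t m q"
  shows "right_sum op H X (n + m) (\<lambda>k. if k \<le> n then p k else q (k - n)) \<omega>
    = right_sum op H X n p \<omega> + right_sum op H X m q \<omega>"
proof -
  let ?w = "\<lambda>k. if k \<le> n then p k else q (k - n)"
  have ends: "p n = u" "q 0 = u" using p q by (auto simp: fine_partition_def)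
  define g where "g k = op (H (?w (Suc k)) \<omega>) (X (?w (Suc k)) \<omega> - X (?w k) \<omega>)" for k
  have "(\<Sum>k<n + m. g k) = (\<Sum>k<n. g k) + (\<Sum>k<m. g (n + k))"
    by (induction m) (auto simp: add.assoc)
  moreover have "(\<Sum>k<n. g k) = right_sum op H X n p \<omega>"
    unfolding right_sum_def g_def by (intro sum.cong) auto
  moreover have "(\<Sum>k<m. g (n + k)) = right_sum op H X m q \<omega>"
    unfolding right_sum_def
  proof (rule sum.cong[OF refl])
    fix k
    have "?w (n + k) = q k" "?w (Suc (n + k)) = q (Suc k)" using ends by auto
    then show "g (n + k) = op (H (q (Suc k)) \<omega>) (X (q (Suc k)) \<omega> - X (q k) \<omega>)"
      unfolding g_def by (simp only:)
  qed
  ultimately show ?thesis unfolding right_sum_def g_def by simp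
qed

text \<open>The equation supplies noise integrals up to the terminal time only. Gluing partitions at
  \<open>u\<close> identifies the difference of two of them as a limit of sums over the interval
  from \<open>r\<close> to \<open>u\<close>; the Lipschitz estimate is uniform in the partition and
  passes to the limit.\<close>

lemma (in prob_space) backward_noise_increment:
  fixes W :: "real \<Rightarrow> 'a \<Rightarrow> 'b::euclidean_space" and \<epsilon> :: "real \<Rightarrow> real"
  assumes r: "has_backward_integral M (*\<^sub>R) (\<lambda>r _. \<epsilon> r) W r t N"
    and u: "has_backward_integral M (*\<^sub>R) (\<lambda>r _. \<epsilon> r) W u t N'"
    and ru: "r \<le> u" "u \<le> t"
    and L: "\<And>x y. x \<in> {r..u} \<Longrightarrow> y \<in> {r..u} \<Longrightarrow> \<bar>\<epsilon> x - \<epsilon> y\<bar> \<le> L * \<bar>x - y\<bar>" and L0: "0 \<le> L"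
    and K: "AE \<omega> in M. \<forall>x\<in>{r..u}. norm (W x \<omega>) \<le> K \<omega>"
  shows "AE \<omega> in M. norm (N \<omega> - N' \<omega> - \<epsilon> u *\<^sub>R (W u \<omega> - W r \<omega>)) \<le> 2 * L * K \<omega> * (u - r)"
proof -
  let ?S = "right_sum (*\<^sub>R) (\<lambda>r _. \<epsilon> r) W"
  obtain d1 where d1: "0 < d1"
    "\<forall>n u. (\<forall>m. fine_partition (d1 / Suc m) r t (n m) (u m)) \<longrightarrow>
       vanishes_in_prob M (\<lambda>m \<omega>. ?S (n m) (u m) \<omega> - N \<omega>)"
    using mesh_limit_imp_vanishes[OF r[unfolded has_backward_integral_def]] by blast
  obtain d2 where d2: "0 < d2"
    "\<forall>n p. (\<forall>m. fine_partition (d2 / Suc m) u t (n m) (p m)) \<longrightarrow>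
       vanishes_in_prob M (\<lambda>m \<omega>. ?S (n m) (p m) \<omega> - N' \<omega>)"
    using mesh_limit_imp_vanishes[OF u[unfolded has_backward_integral_def]] by blast
  define d where "d = min d1 d2"
  have d: "0 < d" "d \<le> d1" "d \<le> d2" using d1 d2 by (auto simp: d_def)
  have "\<exists>n p. fine_partition (d / Suc m) r u n p" for m
    using ru d by (intro ex_fine_partition) auto
  then obtain n p where p: "\<And>m. fine_partition (d / Suc m) r u (n m) (p m)"
    by metis
  have "\<exists>n q. fine_partition (d / Suc m) u t n q" for m
    using ru d by (intro ex_fine_partition) auto
  then obtain n' q where q: "\<And>m. fine_partition (d / Suc m) u t (n' m) (q m)"
    by metis
  define w where "w m k = (if k \<le> n m then p m k else q m (k - n m))" for m k
  have w: "fine_partition (d / Suc m) r t (n m + n' m) (w m)" for m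
    unfolding w_def by (rule fine_partition_concat[OF p q])
  have w1: "fine_partition (d1 / Suc m) r t (n m + n' m) (w m)" for m
    using d by (intro fine_partition_mono[OF w] divide_right_mono) auto
  have 1: "vanishes_in_prob M (\<lambda>m \<omega>. ?S (n m + n' m) (w m) \<omega> - N \<omega>)"
    by (rule d1(2)[rule_format]) (rule w1)
  have w2: "fine_partition (d2 / Suc m) u t (n' m) (q m)" for m
    using d by (intro fine_partition_mono[OF q] divide_right_mono) auto
  have 2: "vanishes_in_prob M (\<lambda>m \<omega>. ?S (n' m) (q m) \<omega> - N' \<omega>)"
    by (rule d2(2)[rule_format]) (rule w2)
  have "?S (n m + n' m) (w m) \<omega> = ?S (n m) (p m) \<omega> + ?S (n' m) (q m) \<omega>" for m \<omega>
    unfolding w_def by (rule right_sum_concat[OF p q])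
  then have "vanishes_in_prob M (\<lambda>m \<omega>. ?S (n m) (p m) \<omega> - (N \<omega> - N' \<omega>))"
    using vanishes_in_prob_add[OF 1 vanishes_in_prob_scaleR[OF 2, of "-1"]] by (simp add: algebra_simps)
  then obtain f where f: "AE \<omega> in M. (\<lambda>m. ?S (n (f m)) (p (f m)) \<omega> - (N \<omega> - N' \<omega>)) \<longlonglongrightarrow> 0"
    by (rule vanishes_in_prob_subseq)
  from f K show ?thesis
  proof eventually_elim
    case (elim \<omega>)
    have "(\<lambda>m. ?S (n (f m)) (p (f m)) \<omega>) \<longlonglongrightarrow> N \<omega> - N' \<omega>"
      using elim(1) by (rule LIM_zero_cancel)
    then have "(\<lambda>m. norm (?S (n (f m)) (p (f m)) \<omega> - \<epsilon> u *\<^sub>R (W u \<omega> - W r \<omega>)))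
        \<longlonglongrightarrow> norm (N \<omega> - N' \<omega> - \<epsilon> u *\<^sub>R (W u \<omega> - W r \<omega>))"
      by (intro tendsto_norm tendsto_diff tendsto_const)
    moreover have "norm (?S (n (f m)) (p (f m)) \<omega> - \<epsilon> u *\<^sub>R (W u \<omega> - W r \<omega>)) \<le> 2 * L * K \<omega> * (u - r)" for m
      unfolding right_sum_def
      by (rule right_sum_lipschitz_deviation[OF p L _ L0]) (use elim(2) in auto)
    ultimately show ?case by (intro Lim_bounded[of _ _ 0]) auto
  qed
qed

text \<open>Reflecting time by \<open>s + t - r\<close> turns the increasing filtration of the
  reversed Brownian motion into the decreasing family \<open>G\<close>. Continuity of the paths
  bounds \<open>W\<close> and the drift along \<open>X\<close>, and these bounds provide the random
  constant.\<close>

lemma backward_sde_imp_reversed_diffusion: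
  fixes W X :: "real \<Rightarrow> 'w \<Rightarrow> 'a::euclidean_space" and a :: "real \<Rightarrow> 'a \<Rightarrow> 'a"
  assumes sde: "backward_sde M G W a \<epsilon> X s t" and st: "s \<le> t"
    and a: "continuous_on ({s..t} \<times> UNIV) (\<lambda>(r, x). a r x)"
    and L: "\<And>x y. x \<in> {s..t} \<Longrightarrow> y \<in> {s..t} \<Longrightarrow> \<bar>\<epsilon> x - \<epsilon> y\<bar> \<le> L * \<bar>x - y\<bar>" and L0: "0 \<le> L"
  obtains C where "reversed_diffusion M G W X \<epsilon> s t C"
proof -
  have bm: "brownian_motion M (\<lambda>r. G (s + t - r)) (\<lambda>r. W (s + t - r)) s t"
    using sde by (simp add: backward_sde_def backward_brownian_motion_def)
  interpret prob_space M using bm by (simp add: brownian_motion_def)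
  have filt: "filtration (space M) (\<lambda>r. G (s + t - r))" and sub': "\<And>r. subalgebra M (G (s + t - r))"
    and W': "\<And>r. r \<in> {s..t} \<Longrightarrow> W (s + t - r) \<in> borel_measurable (G (s + t - r))"
    and W_cont': "AE \<omega> in M. continuous_on {s..t} (\<lambda>r. W (s + t - r) \<omega>)"
    and normal: "\<And>r u. s \<le> r \<Longrightarrow> r < u \<Longrightarrow> u \<le> t \<Longrightarrow>
        distributed M lborel (\<lambda>\<omega>. W (s + t - u) \<omega> - W (s + t - r) \<omega>)
          (\<lambda>x. ennreal (\<Prod>b\<in>Basis. normal_density 0 (sqrt (u - r)) (x \<bullet> b)))"
    and ind: "\<And>r u. s \<le> r \<Longrightarrow> r < u \<Longrightarrow> u \<le> t \<Longrightarrow> indep_set (sets (G (s + t - r)))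
          (sets (vimage_algebra (space M) (\<lambda>\<omega>. W (s + t - u) \<omega> - W (s + t - r) \<omega>) borel))"
    using bm unfolding brownian_motion_def by blast+
  have X: "\<And>r. r \<in> {s..t} \<Longrightarrow> X r \<in> borel_measurable (G r)"
    and X_cont: "AE \<omega> in M. continuous_on {s..t} (\<lambda>r. X r \<omega>)"
    and noise: "\<And>u. u \<in> {s..t} \<Longrightarrow> has_backward_integral M (*\<^sub>R) (\<lambda>r _. \<epsilon> r) W u t
        (\<lambda>\<omega>. X t \<omega> - X u \<omega> - integral {u..t} (\<lambda>r. a r (X r \<omega>)))"
    using sde unfolding backward_sde_def by blast+
  have W_cont: "AE \<omega> in M. continuous_on {s..t} (\<lambda>r. W r \<omega>)"
    using W_cont'
  proof eventually_elim
    case (elim \<omega>)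
    have "continuous_on {s..t} (\<lambda>r. W (s + t - (s + t - r)) \<omega>)"
      by (intro continuous_on_compose2[OF elim] continuous_intros) auto
    then show ?case by simp
  qed
  have aX_cont: "continuous_on {s..t} (\<lambda>r. a r (X r \<omega>))" if "continuous_on {s..t} (\<lambda>r. X r \<omega>)" for \<omega>
    using continuous_on_compose2[OF a continuous_on_Pair[OF continuous_on_id that]] by auto
  \<comment> \<open>The bound is selected path by path; the value 0 off the continuous paths keeps
    it nonnegative everywhere.\<close>
  have "\<exists>K. 0 \<le> K \<and> (continuous_on {s..t} (\<lambda>r. W r \<omega>) \<longrightarrow> continuous_on {s..t} (\<lambda>r. X r \<omega>) \<longrightarrow>
      (\<forall>r\<in>{s..t}. norm (W r \<omega>) \<le> K \<and> norm (a r (X r \<omega>)) \<le> K))" for \<omega>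
  proof (cases "continuous_on {s..t} (\<lambda>r. W r \<omega>) \<and> continuous_on {s..t} (\<lambda>r. X r \<omega>)")
    case True
    obtain K1 where K1: "\<And>r. r \<in> {s..t} \<Longrightarrow> norm (W r \<omega>) \<le> K1"
      using continuous_on_interval_bound True by blast
    obtain K2 where K2: "\<And>r. r \<in> {s..t} \<Longrightarrow> norm (a r (X r \<omega>)) \<le> K2"
      using continuous_on_interval_bound[OF aX_cont] True by blast
    show ?thesis
    proof (intro exI[of _ "max 0 (max K1 K2)"] conjI impI ballI)
      fix r assume "r \<in> {s..t}"
      then show "norm (W r \<omega>) \<le> max 0 (max K1 K2)" "norm (a r (X r \<omega>)) \<le> max 0 (max K1 K2)"
        using K1[of r] K2[of r] by linarith+
    qed simp
  qed (intro exI[of _ 0], auto)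
  then have "\<exists>K. \<forall>\<omega>. 0 \<le> K \<omega> \<and> (continuous_on {s..t} (\<lambda>r. W r \<omega>) \<longrightarrow> continuous_on {s..t} (\<lambda>r. X r \<omega>) \<longrightarrow>
      (\<forall>r\<in>{s..t}. norm (W r \<omega>) \<le> K \<omega> \<and> norm (a r (X r \<omega>)) \<le> K \<omega>))"
    by (intro choice allI)
  then obtain K where K0: "\<And>\<omega>. 0 \<le> K \<omega>" and K: "\<And>\<omega> r. continuous_on {s..t} (\<lambda>r. W r \<omega>) \<Longrightarrow>
      continuous_on {s..t} (\<lambda>r. X r \<omega>) \<Longrightarrow> r \<in> {s..t} \<Longrightarrow> norm (W r \<omega>) \<le> K \<omega> \<and> norm (a r (X r \<omega>)) \<le> K \<omega>"
    by blast
  \<comment> \<open>\<open>2 * L * K \<omega>\<close> bounds the deviation of the noise from a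
    single scaled increment, the further \<open>K \<omega>\<close> the time integral of the drift,
    both per unit of time.\<close>
  define C where "C \<omega> = 2 * L * K \<omega> + K \<omega>" for \<omega>
  have "reversed_diffusion M G W X \<epsilon> s t C"
  proof unfold_locales
    show "s \<le> t" by fact
    show "subalgebra M (G r)" for r using sub'[of "s + t - r"] by simp
    show "sets (G u) \<subseteq> sets (G r)" if "r \<le> u" for r u
      using filtration.sets_F_mono[OF filt, of "s + t - u" "s + t - r"] that by simp
    show "W r \<in> borel_measurable (G r)" if "r \<in> {s..t}" for r
      using W'[of "s + t - r"] that by simp
    show "X r \<in> borel_measurable (G r)" if "r \<in> {s..t}" for r by (rule X[OF that])
    show "AE \<omega> in M. continuous_on {s..t} (\<lambda>r. W r \<omega>)" by (rule W_cont)
    show "AE \<omega> in M. continuous_on {s..t} (\<lambda>r. X r \<omega>)" by (rule X_cont)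
    show "distributed M lborel (\<lambda>\<omega>. W r \<omega> - W u \<omega>)
        (\<lambda>x. ennreal (\<Prod>b\<in>Basis. normal_density 0 (sqrt (u - r)) (x \<bullet> b)))"
      "indep_set (sets (G u)) (sets (vimage_algebra (space M) (\<lambda>\<omega>. W r \<omega> - W u \<omega>) borel))"
      if "s \<le> r" "r < u" "u \<le> t" for r u
      using normal[of "s + t - u" "s + t - r"] ind[of "s + t - u" "s + t - r"] that by simp_all
    show "continuous_on {s..t} \<epsilon>"
    proof (rule lipschitz_on_continuous_on)
      show "L-lipschitz_on {s..t} \<epsilon>"
        using L L0 by (intro lipschitz_onI) (auto simp: dist_real_def)
    qed
    show "0 \<le> C \<omega>" for \<omega> using K0[of \<omega>] L0 by (simp add: C_def)
    show "AE \<omega> in M. norm (X u \<omega> - X r \<omega> - \<epsilon> u *\<^sub>R (W u \<omega> - W r \<omega>)) \<le> C \<omega> * (u - r)"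
      if ru: "s \<le> r" "r \<le> u" "u \<le> t" for r u
    proof -
      have "AE \<omega> in M. \<forall>x\<in>{r..u}. norm (W x \<omega>) \<le> K \<omega>"
        using W_cont X_cont by eventually_elim (use K ru in auto)
      then have "AE \<omega> in M. norm ((X t \<omega> - X r \<omega> - integral {r..t} (\<lambda>r. a r (X r \<omega>)))
          - (X t \<omega> - X u \<omega> - integral {u..t} (\<lambda>r. a r (X r \<omega>))) - \<epsilon> u *\<^sub>R (W u \<omega> - W r \<omega>)) \<le> 2 * L * K \<omega> * (u - r)"
        using ru by (intro backward_noise_increment[OF noise noise _ _ L L0]) auto
      with W_cont X_cont show ?thesis
      proof eventually_elim
        case (elim \<omega>)
        have c: "continuous_on {r..t} (\<lambda>r. a r (X r \<omega>))"
          using ru by (intro continuous_on_subset[OF aX_cont[OF elim(2)]]) auto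
        have I: "integral {r..t} (\<lambda>r. a r (X r \<omega>)) = integral {r..u} (\<lambda>r. a r (X r \<omega>)) + integral {u..t} (\<lambda>r. a r (X r \<omega>))"
          using ru integrable_continuous_real[OF c]
          by (intro Henstock_Kurzweil_Integration.integral_combine[symmetric]) auto
        have "norm (integral {r..u} (\<lambda>r. a r (X r \<omega>))) \<le> K \<omega> * (u - r)"
        proof (rule integral_bound[OF ru(2)])
          show "continuous_on {r..u} (\<lambda>r. a r (X r \<omega>))" using ru by (intro continuous_on_subset[OF c]) auto
          show "norm (a q (X q \<omega>)) \<le> K \<omega>" if "q \<in> {r..u}" for q
            using K[OF elim(1,2), of q] that ru by auto
        qed
        moreover have "X u \<omega> - X r \<omega> - \<epsilon> u *\<^sub>R (W u \<omega> - W r \<omega>) =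
          ((X t \<omega> - X r \<omega> - integral {r..t} (\<lambda>r. a r (X r \<omega>)))
          - (X t \<omega> - X u \<omega> - integral {u..t} (\<lambda>r. a r (X r \<omega>))) - \<epsilon> u *\<^sub>R (W u \<omega> - W r \<omega>))
          + integral {r..u} (\<lambda>r. a r (X r \<omega>))"
          unfolding I by simp
        ultimately have "norm (X u \<omega> - X r \<omega> - \<epsilon> u *\<^sub>R (W u \<omega> - W r \<omega>)) \<le> 2 * L * K \<omega> * (u - r) + K \<omega> * (u - r)"
          using elim(3) by (simp only:) (rule norm_triangle_mono)
        then show ?case by (simp add: C_def algebra_simps)
      qed
    qed
  qed
  then show ?thesis by (rule that)
qed

section \<open>The product weight\<close>

lemma C1_on_subset: "C1_on S g \<Longrightarrow> T \<subseteq> S \<Longrightarrow> C1_on T g"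
  unfolding C1_on_def by (meson continuous_on_subset has_derivative_subset subsetD)

lemma C1_on_imp_continuous_on: "C1_on S g \<Longrightarrow> continuous_on S g"
  unfolding C1_on_def by (auto intro: has_derivative_continuous_on)

lemma C1_on_scaleR:
  fixes \<phi> :: "'a::real_normed_vector \<Rightarrow> real" and g :: "'a \<Rightarrow> 'b::real_normed_vector"
  assumes "C1_on S \<phi>" "C1_on S g"
  shows "C1_on S (\<lambda>z. \<phi> z *\<^sub>R g z)"
proof -
  obtain P D where P: "continuous_on S P" "\<And>z. z \<in> S \<Longrightarrow> (\<phi> has_derivative blinfun_apply (P z)) (at z within S)"
    and D: "continuous_on S D" "\<And>z. z \<in> S \<Longrightarrow> (g has_derivative blinfun_apply (D z)) (at z within S)"
    using assms unfolding C1_on_def by blast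
  note cont = C1_on_imp_continuous_on[OF assms(1)] C1_on_imp_continuous_on[OF assms(2)]
  show ?thesis unfolding C1_on_def
  proof (intro exI conjI ballI)
    show "continuous_on S (\<lambda>z. \<phi> z *\<^sub>R D z + (blinfun_scaleR_left (g z) o\<^sub>L P z))"
      by (intro continuous_intros cont P D bounded_linear.continuous_on[OF bounded_linear_blinfun_scaleR_left])
    fix z assume z: "z \<in> S"
    show "((\<lambda>z. \<phi> z *\<^sub>R g z) has_derivative blinfun_apply (\<phi> z *\<^sub>R D z + (blinfun_scaleR_left (g z) o\<^sub>L P z))) (at z within S)"
      by (rule has_derivative_eq_rhs[OF has_derivative_scaleR[OF P(2)[OF z] D(2)[OF z]]])
        (auto simp: plus_blinfun.rep_eq scaleR_blinfun.rep_eq)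
  qed
qed

text \<open>Lifts a coefficient of time alone to time and space, where it can multiply a
  drift.\<close>

lemma C1_on_fst:
  fixes \<phi> :: "real \<Rightarrow> real"
  assumes "C1_on I \<phi>"
  shows "C1_on (I \<times> (UNIV :: 'a::real_normed_vector set)) (\<lambda>z. \<phi> (fst z))"
proof -
  obtain P where P: "continuous_on I P" "\<And>r. r \<in> I \<Longrightarrow> (\<phi> has_derivative blinfun_apply (P r)) (at r within I)"
    using assms unfolding C1_on_def by blast
  let ?S = "I \<times> (UNIV :: 'a set)"
  show ?thesis unfolding C1_on_def
  proof (intro exI conjI ballI)
    show "continuous_on ?S (\<lambda>z. P (fst z) o\<^sub>L fst_blinfun)"
      by (intro continuous_intros continuous_on_compose2[OF P(1)]) auto
    fix z assume z: "z \<in> ?S"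
    have "(\<phi> has_derivative blinfun_apply (P (fst z))) (at (fst z) within fst ` ?S)"
      using z by (intro has_derivative_subset[OF P(2)]) auto
    from diff_chain_within[OF has_derivative_fst[OF has_derivative_ident] this]
    show "((\<lambda>z. \<phi> (fst z)) has_derivative blinfun_apply (P (fst z) o\<^sub>L fst_blinfun)) (at z within ?S)"
      by (simp add: comp_def fst_blinfun.rep_eq blinfun_compose.rep_eq)
  qed
qed

lemma C1_on_inverse_square:
  fixes \<phi> :: "real \<Rightarrow> real"
  assumes "C1_on I \<phi>" and nz: "\<And>r. r \<in> I \<Longrightarrow> \<phi> r \<noteq> 0"
  shows "C1_on I (\<lambda>r. 1 / (\<phi> r)\<^sup>2)"
proof -
  obtain P where P: "continuous_on I P" "\<And>r. r \<in> I \<Longrightarrow> (\<phi> has_derivative blinfun_apply (P r)) (at r within I)"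
    using assms unfolding C1_on_def by blast
  show ?thesis unfolding C1_on_def
  proof (intro exI conjI ballI)
    show "continuous_on I (\<lambda>r. (- 2 / (\<phi> r)^3) *\<^sub>R P r)"
      using nz by (intro continuous_intros P C1_on_imp_continuous_on[OF assms(1)]) auto
    fix r assume r: "r \<in> I"
    show "((\<lambda>r. 1 / (\<phi> r)\<^sup>2) has_derivative blinfun_apply ((- 2 / (\<phi> r)^3) *\<^sub>R P r)) (at r within I)"
      using nz[OF r] by (auto intro!: derivative_eq_intros P(2)[OF r] ext
        simp: scaleR_blinfun.rep_eq uminus_blinfun.rep_eq field_simps power2_eq_square power3_eq_cube)
  qed
qed

text \<open>A continuous derivative is bounded on a compact interval. This supplies the Lipschitz
  constant for the comparison of noise sums.\<close>

lemma C1_on_interval_lipschitz: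
  fixes \<phi> :: "real \<Rightarrow> real"
  assumes "C1_on {s..t} \<phi>"
  obtains L where "0 \<le> L" "\<And>x y. x \<in> {s..t} \<Longrightarrow> y \<in> {s..t} \<Longrightarrow> \<bar>\<phi> x - \<phi> y\<bar> \<le> L * \<bar>x - y\<bar>"
proof -
  obtain P where P: "continuous_on {s..t} P"
    "\<And>r. r \<in> {s..t} \<Longrightarrow> (\<phi> has_derivative blinfun_apply (P r)) (at r within {s..t})"
    using assms unfolding C1_on_def by blast
  obtain B where B: "\<And>r. r \<in> {s..t} \<Longrightarrow> norm (P r) \<le> B"
    using continuous_on_interval_bound[OF P(1)] by blast
  show ?thesis
  proof (rule that[of "max B 0"])
    fix x y assume "x \<in> {s..t}" "y \<in> {s..t}"
    then have "norm (\<phi> x - \<phi> y) \<le> max B 0 * norm (x - y)"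
      by (intro differentiable_bound[OF _ P(2)])
        (auto simp: norm_blinfun.rep_eq[symmetric] intro!: B le_max_iff_disj[THEN iffD2])
    then show "\<bar>\<phi> x - \<phi> y\<bar> \<le> max B 0 * \<bar>x - y\<bar>" by simp
  qed simp
qed

section \<open>Linearity of the stochastic integrals up to null sets\<close>

lemma mesh_limit_transfer:
  assumes L: "mesh_limit M S s t I"
    and eq: "\<And>d n u. fine_partition d s t n u \<Longrightarrow> S n u = S' n u"
  shows "mesh_limit M S' s t I"
  unfolding mesh_limit_def
proof (intro conjI allI impI)
  show "I \<in> borel_measurable M" using L by (simp add: mesh_limit_def)
  fix e :: real assume "0 < e"
  then obtain d where d: "0 < d" and S: "\<And>n u. fine_partition d s t n u \<Longrightarrow>
      S n u \<in> borel_measurable M \<and> measure M {\<omega> \<in> space M. norm (S n u \<omega> - I \<omega>) > e} < e"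
    using L unfolding mesh_limit_def by blast
  show "\<exists>d>0. \<forall>n u. fine_partition d s t n u \<longrightarrow>
      S' n u \<in> borel_measurable M \<and> measure M {\<omega> \<in> space M. norm (S' n u \<omega> - I \<omega>) > e} < e"
  proof (rule exI[of _ d], intro conjI allI impI)
    fix n u assume fp: "fine_partition d s t n u"
    show "S' n u \<in> borel_measurable M" "measure M {\<omega> \<in> space M. norm (S' n u \<omega> - I \<omega>) > e} < e"
      using S[OF fp] unfolding eq[OF fp] by auto
  qed (rule d)
qed

text \<open>The sums see the integrand at partition points only. Equality on the interval alone
  matters, because the identities between the scaled drifts divide by \<open>\<epsilon>\<close>,
  which is known to be nonzero only there.\<close>

lemma has_backward_integral_transfer:
  assumes I: "has_backward_integral M op H X s t I"
    and eq: "\<And>r \<omega>. r \<in> {s..t} \<Longrightarrow> H r \<omega> = H' r \<omega>"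
  shows "has_backward_integral M op H' X s t I"
  unfolding has_backward_integral_def
proof (rule mesh_limit_transfer[OF I[unfolded has_backward_integral_def]], intro ext)
  fix d n u \<omega> assume "fine_partition d s t n u"
  then show "right_sum op H X n u \<omega> = right_sum op H' X n u \<omega>"
    unfolding right_sum_def by (intro sum.cong refl) (simp add: eq[OF fine_partition_mem])
qed

lemma has_forward_integral_transfer:
  assumes I: "has_forward_integral M op H X s t I"
    and eq: "\<And>r \<omega>. r \<in> {s..t} \<Longrightarrow> H r \<omega> = H' r \<omega>"
  shows "has_forward_integral M op H' X s t I"
  unfolding has_forward_integral_def
proof (rule mesh_limit_transfer[OF I[unfolded has_forward_integral_def]], intro ext)
  fix d n u \<omega> assume "fine_partition d s t n u"
  then show "left_sum op H X n u \<omega> = left_sum op H' X n u \<omega>"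
    unfolding left_sum_def by (intro sum.cong refl) (simp add: eq[OF fine_partition_mem])
qed

context prob_space
begin

text \<open>\<open>backward_integral\<close> is a choice among all limits: existence of one limit
  makes the choice a limit, and uniqueness up to null sets identifies it. The three summands are
  meant for the scaled drift and the two scores.\<close>

lemma backward_integral_lincomb:
  fixes X :: "real \<Rightarrow> 'a \<Rightarrow> 'b::euclidean_space"
    and c :: "nat \<Rightarrow> real"
  assumes st: "s \<le> t"
    and H: "\<And>i. i \<in> {..<3::nat} \<Longrightarrow> has_backward_integral M (\<bullet>) (H i) X s t (B i)"
    and eq: "\<And>r \<omega>. r \<in> {s..t} \<Longrightarrow> H' r \<omega> = c 0 *\<^sub>R H 0 r \<omega> + c 1 *\<^sub>R H 1 r \<omega> + c 2 *\<^sub>R H 2 r \<omega>"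
  shows "AE \<omega> in M. backward_integral M H' X s t \<omega> = c 0 * B 0 \<omega> + c 1 * B 1 \<omega> + c 2 * B 2 \<omega>"
proof -
  have "mesh_limit M (\<lambda>n u \<omega>. c 0 *\<^sub>R right_sum (\<bullet>) (H 0) X n u \<omega> + c 1 *\<^sub>R right_sum (\<bullet>) (H 1) X n u \<omega>
      + c 2 *\<^sub>R right_sum (\<bullet>) (H 2) X n u \<omega>) s t (\<lambda>\<omega>. c 0 *\<^sub>R B 0 \<omega> + c 1 *\<^sub>R B 1 \<omega> + c 2 *\<^sub>R B 2 \<omega>)"
    using H unfolding has_backward_integral_def by (intro mesh_limit_add mesh_limit_scaleR) auto
  also have "(\<lambda>n u \<omega>. c 0 *\<^sub>R right_sum (\<bullet>) (H 0) X n u \<omega> + c 1 *\<^sub>R right_sum (\<bullet>) (H 1) X n u \<omega>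
      + c 2 *\<^sub>R right_sum (\<bullet>) (H 2) X n u \<omega>) =
      right_sum (\<bullet>) (\<lambda>r \<omega>. c 0 *\<^sub>R H 0 r \<omega> + c 1 *\<^sub>R H 1 r \<omega> + c 2 *\<^sub>R H 2 r \<omega>) X"
    by (intro ext) (simp add: right_sum_def inner_add_left sum.distrib sum_distrib_left)
  finally have I: "has_backward_integral M (\<bullet>) H' X s t (\<lambda>\<omega>. c 0 *\<^sub>R B 0 \<omega> + c 1 *\<^sub>R B 1 \<omega> + c 2 *\<^sub>R B 2 \<omega>)"
    by (intro has_backward_integral_transfer[OF _ eq[symmetric]]) (simp_all only: has_backward_integral_def)
  then have "has_backward_integral M (\<bullet>) H' X s t (backward_integral M H' X s t)"
    unfolding backward_integral_def by (rule someI[of "has_backward_integral M (\<bullet>) H' X s t"])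
  with I have "AE \<omega> in M. backward_integral M H' X s t \<omega> = c 0 *\<^sub>R B 0 \<omega> + c 1 *\<^sub>R B 1 \<omega> + c 2 *\<^sub>R B 2 \<omega>"
    unfolding has_backward_integral_def by (intro mesh_limit_unique[OF st])
  then show ?thesis by simp
qed

lemma forward_integral_lincomb:
  fixes X :: "real \<Rightarrow> 'a \<Rightarrow> 'b::euclidean_space"
    and c :: "nat \<Rightarrow> real"
  assumes st: "s \<le> t"
    and H: "\<And>i. i \<in> {..<3::nat} \<Longrightarrow> has_forward_integral M (\<bullet>) (H i) X s t (B i)"
    and eq: "\<And>r \<omega>. r \<in> {s..t} \<Longrightarrow> H' r \<omega> = c 0 *\<^sub>R H 0 r \<omega> + c 1 *\<^sub>R H 1 r \<omega> + c 2 *\<^sub>R H 2 r \<omega>"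
  shows "AE \<omega> in M. forward_integral M H' X s t \<omega> = c 0 * B 0 \<omega> + c 1 * B 1 \<omega> + c 2 * B 2 \<omega>"
proof -
  have "mesh_limit M (\<lambda>n u \<omega>. c 0 *\<^sub>R left_sum (\<bullet>) (H 0) X n u \<omega> + c 1 *\<^sub>R left_sum (\<bullet>) (H 1) X n u \<omega>
      + c 2 *\<^sub>R left_sum (\<bullet>) (H 2) X n u \<omega>) s t (\<lambda>\<omega>. c 0 *\<^sub>R B 0 \<omega> + c 1 *\<^sub>R B 1 \<omega> + c 2 *\<^sub>R B 2 \<omega>)"
    using H unfolding has_forward_integral_def by (intro mesh_limit_add mesh_limit_scaleR) auto
  also have "(\<lambda>n u \<omega>. c 0 *\<^sub>R left_sum (\<bullet>) (H 0) X n u \<omega> + c 1 *\<^sub>R left_sum (\<bullet>) (H 1) X n u \<omega>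
      + c 2 *\<^sub>R left_sum (\<bullet>) (H 2) X n u \<omega>) =
      left_sum (\<bullet>) (\<lambda>r \<omega>. c 0 *\<^sub>R H 0 r \<omega> + c 1 *\<^sub>R H 1 r \<omega> + c 2 *\<^sub>R H 2 r \<omega>) X"
    by (intro ext) (simp add: left_sum_def inner_add_left sum.distrib sum_distrib_left)
  finally have I: "has_forward_integral M (\<bullet>) H' X s t (\<lambda>\<omega>. c 0 *\<^sub>R B 0 \<omega> + c 1 *\<^sub>R B 1 \<omega> + c 2 *\<^sub>R B 2 \<omega>)"
    by (intro has_forward_integral_transfer[OF _ eq[symmetric]]) (simp_all only: has_forward_integral_def)
  then have "has_forward_integral M (\<bullet>) H' X s t (forward_integral M H' X s t)"
    unfolding forward_integral_def by (rule someI[of "has_forward_integral M (\<bullet>) H' X s t"])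
  with I have "AE \<omega> in M. forward_integral M H' X s t \<omega> = c 0 *\<^sub>R B 0 \<omega> + c 1 *\<^sub>R B 1 \<omega> + c 2 *\<^sub>R B 2 \<omega>"
    unfolding has_forward_integral_def by (intro mesh_limit_unique[OF st])
  then show ?thesis by simp
qed

end

section \<open>The exponent of the weight\<close>

lemma ln_product_weight_eq:
  "ln (product_weight M \<epsilon> \<beta> \<nu>1 \<mu>1 \<nu>2 \<mu>2 a b X s t \<omega>) =
    \<beta> * ln (path_ratio M \<epsilon> \<nu>1 \<mu>1 X s t \<omega>) + \<beta> * ln (path_ratio M \<epsilon> \<nu>2 \<mu>2 X s t \<omega>)
      - ln (path_ratio M \<epsilon> a b X s t \<omega>)"
proof -
  have pos: "0 < path_ratio M \<epsilon> \<nu> \<mu> X s t \<omega>" for \<nu> \<mu> by (simp add: path_ratio_def)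
  have "0 < path_ratio M \<epsilon> \<nu>1 \<mu>1 X s t \<omega> powr \<beta>" "0 < path_ratio M \<epsilon> \<nu>2 \<mu>2 X s t \<omega> powr \<beta>"
    "0 < inverse (path_ratio M \<epsilon> a b X s t \<omega>)" using pos by (simp_all add: less_imp_neq[symmetric])
  then show ?thesis
    unfolding product_weight_def using pos by (simp add: ln_mult_pos ln_powr ln_inverse)
qed

text \<open>A difference of squares with score coefficients m and n: here m + n is
  \<open>e\<^sup>2\<close>, which cancels the prefactor, and m - n is
  \<open>- s\<^sup>2\<close>.\<close>

lemma reversal_drift_norm_difference:
  fixes F g :: "'a::real_inner" and e s :: real
  assumes "e \<noteq> 0"
  shows "1 / e\<^sup>2 * ((norm (F + ((e\<^sup>2 - s\<^sup>2) / 2) *\<^sub>R g))\<^sup>2 - (norm (F - ((e\<^sup>2 + s\<^sup>2) / 2) *\<^sub>R g))\<^sup>2)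
    = 2 * (F \<bullet> g) - s\<^sup>2 * (g \<bullet> g)"
proof -
  have "(norm (F + m *\<^sub>R g))\<^sup>2 - (norm (F - n *\<^sub>R g))\<^sup>2 = (m + n) * (2 * (F \<bullet> g) + (m - n) * (g \<bullet> g))" for m n :: real
    by (simp add: power2_norm_eq_inner inner_add_left inner_add_right inner_diff_left inner_diff_right inner_commute algebra_simps)
  from this[of "(e\<^sup>2 - s\<^sup>2) / 2" "(e\<^sup>2 + s\<^sup>2) / 2"] have
    "(norm (F + ((e\<^sup>2 - s\<^sup>2) / 2) *\<^sub>R g))\<^sup>2 - (norm (F - ((e\<^sup>2 + s\<^sup>2) / 2) *\<^sub>R g))\<^sup>2
      = e\<^sup>2 * (2 * (F \<bullet> g) - s\<^sup>2 * (g \<bullet> g))"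
    by (simp add: field_simps)
  then show ?thesis using assms by simp
qed

text \<open>The same factorisation: the two score coefficients differ by
  \<open>e\<^sup>2 * \<beta>\<close>, which absorbs the prefactor, and \<open>rel\<close> makes
  their sum \<open>\<beta> * s\<^sup>2\<close>.\<close>

lemma proposal_drift_norm_difference:
  fixes F g :: "'a::real_inner" and e s \<eta> \<beta> :: real
  assumes "e \<noteq> 0" and rel: "2 * \<eta> * s\<^sup>2 = \<beta> * (e\<^sup>2 + s\<^sup>2)"
  shows "1 / e\<^sup>2 * ((norm (F - (\<eta> * s\<^sup>2 - e\<^sup>2 * \<beta>) *\<^sub>R g))\<^sup>2 - (norm (F - (\<eta> * s\<^sup>2) *\<^sub>R g))\<^sup>2)
    = 2 * \<beta> * (F \<bullet> g) - \<beta>\<^sup>2 * s\<^sup>2 * (g \<bullet> g)"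
proof -
  have "(norm (F - m *\<^sub>R g))\<^sup>2 - (norm (F - n *\<^sub>R g))\<^sup>2 = (n - m) * (2 * (F \<bullet> g) - (m + n) * (g \<bullet> g))" for m n :: real
    by (simp add: power2_norm_eq_inner inner_diff_left inner_diff_right inner_commute algebra_simps)
  from this[of "\<eta> * s\<^sup>2 - e\<^sup>2 * \<beta>" "\<eta> * s\<^sup>2"] have
    "(norm (F - (\<eta> * s\<^sup>2 - e\<^sup>2 * \<beta>) *\<^sub>R g))\<^sup>2 - (norm (F - (\<eta> * s\<^sup>2) *\<^sub>R g))\<^sup>2
      = e\<^sup>2 * \<beta> * (2 * (F \<bullet> g) - (2 * \<eta> * s\<^sup>2 - e\<^sup>2 * \<beta>) * (g \<bullet> g))"
    by (simp add: algebra_simps)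
  also have "2 * \<eta> * s\<^sup>2 - e\<^sup>2 * \<beta> = \<beta> * s\<^sup>2" using rel by (simp add: algebra_simps)
  finally have eq: "(norm (F - (\<eta> * s\<^sup>2 - e\<^sup>2 * \<beta>) *\<^sub>R g))\<^sup>2 - (norm (F - (\<eta> * s\<^sup>2) *\<^sub>R g))\<^sup>2
      = e\<^sup>2 * \<beta> * (2 * (F \<bullet> g) - (\<beta> * s\<^sup>2) * (g \<bullet> g))" .
  show ?thesis unfolding eq using assms(1) by (simp add: power2_eq_square algebra_simps)
qed

text \<open>Since \<epsilon> is a constant multiple of \<sigma>, the six drifts divided by
  \<epsilon>^2 are combinations of \<open>k\<close>, \<open>g1\<close> and \<open>g2\<close> with
  coefficients constant in time. Three pairs of stochastic integrals therefore suffice, and only the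
  pair for \<open>k\<close> survives in the weight.\<close>

lemma (in reversed_diffusion) ln_product_weight:
  fixes f g1 g2 a b \<mu>1 \<mu>2 \<nu>1 \<nu>2 :: "real \<Rightarrow> 'a \<Rightarrow> 'a" and \<sigma> :: "real \<Rightarrow> real" and \<beta> \<eta> \<zeta> :: real
  assumes f: "C1_on ({s..t} \<times> UNIV) (\<lambda>(r, x). f r x)"
    and g1: "C1_on ({s..t} \<times> UNIV) (\<lambda>(r, x). g1 r x)"
    and g2: "C1_on ({s..t} \<times> UNIV) (\<lambda>(r, x). g2 r x)"
    and \<sigma>: "C1_on {s..t} \<sigma>" "\<And>r. r \<in> {s..t} \<Longrightarrow> 0 < \<sigma> r"
    and \<epsilon>: "\<And>r. \<epsilon> r = \<zeta> * \<sigma> r" and \<zeta>: "0 < \<zeta>" and rel: "2 * \<eta> = \<beta> * (\<zeta>\<^sup>2 + 1)"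
    and \<mu>1: "\<And>r x. \<mu>1 r x = f r x + (((\<epsilon> r)\<^sup>2 - (\<sigma> r)\<^sup>2) / 2) *\<^sub>R g1 r x"
    and \<nu>1: "\<And>r x. \<nu>1 r x = f r x - (((\<epsilon> r)\<^sup>2 + (\<sigma> r)\<^sup>2) / 2) *\<^sub>R g1 r x"
    and \<mu>2: "\<And>r x. \<mu>2 r x = f r x + (((\<epsilon> r)\<^sup>2 - (\<sigma> r)\<^sup>2) / 2) *\<^sub>R g2 r x"
    and \<nu>2: "\<And>r x. \<nu>2 r x = f r x - (((\<epsilon> r)\<^sup>2 + (\<sigma> r)\<^sup>2) / 2) *\<^sub>R g2 r x"
    and a: "\<And>r x. a r x = f r x - (\<eta> * (\<sigma> r)\<^sup>2) *\<^sub>R (g1 r x + g2 r x)"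
    and b: "\<And>r x. b r x = f r x - (\<eta> * (\<sigma> r)\<^sup>2 - (\<epsilon> r)\<^sup>2 * \<beta>) *\<^sub>R (g1 r x + g2 r x)"
  shows "AE \<omega> in M. ln (product_weight M \<epsilon> \<beta> \<nu>1 \<mu>1 \<nu>2 \<mu>2 a b X s t \<omega>) =
    integral {s..t} (\<lambda>r. (2 * \<beta> - 1) * divergence (f r) (X r \<omega>)
      + (\<sigma> r)\<^sup>2 * \<beta> * (g1 r (X r \<omega>) \<bullet> g2 r (X r \<omega>))
      + (\<sigma> r)\<^sup>2 / 2 * \<beta> * (\<beta> - 1) * (norm (g1 r (X r \<omega>) + g2 r (X r \<omega>)))\<^sup>2)"
proof -
  have \<epsilon>_nz: "\<epsilon> r \<noteq> 0" "0 < \<epsilon> r" if "r \<in> {s..t}" for r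
    using \<zeta> \<sigma>(2)[OF that] by (simp_all add: \<epsilon>)
  have \<epsilon>_C1: "C1_on {s..t} \<epsilon>"
  proof -
    have "C1_on {s..t} (\<lambda>r. \<zeta>)"
      unfolding C1_on_def by (intro exI[of _ "\<lambda>_. 0"]) (auto simp: zero_blinfun.rep_eq)
    from C1_on_scaleR[OF this \<sigma>(1)] show ?thesis by (simp add: \<epsilon>[abs_def])
  qed
  define k where "k r x = (1 / (\<epsilon> r)\<^sup>2) *\<^sub>R f r x" for r x
  have k: "C1_on ({s..t} \<times> UNIV) (\<lambda>(r, x). k r x)"
  proof -
    have "C1_on ({s..t} \<times> UNIV) (\<lambda>z. (1 / (\<epsilon> (fst z))\<^sup>2) *\<^sub>R (case z of (r, x) \<Rightarrow> f r x))"
      by (intro C1_on_scaleR f C1_on_fst[where \<phi> = "\<lambda>r. 1 / (\<epsilon> r)\<^sup>2"] C1_on_inverse_square \<epsilon>_C1 \<epsilon>_nz)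
    then show ?thesis by (simp add: k_def case_prod_beta')
  qed
  obtain Df where Df: "continuous_on ({s..t} \<times> UNIV) Df"
    "\<forall>r\<in>{s..t}. \<forall>x. (f r has_derivative (\<lambda>y. blinfun_apply (Df (r, x)) (0::real, y))) (at x)"
    using C1_on_time_space[OF f] by blast
  have divf: "divergence (f r) x = (\<Sum>i\<in>Basis. blinfun_apply (Df (r, x)) (0::real, i) \<bullet> i)" if "r \<in> {s..t}" for r x
    using Df(2) that by (intro divergence_eq) blast
  \<comment> \<open>The scaling depends on time alone and commutes with the spatial divergence; the
    factor \<open>(\<epsilon> r)\<^sup>2\<close> from the quadratic covariation removes it.\<close>
  have divk: "(\<epsilon> r)\<^sup>2 * divergence (k r) x = divergence (f r) x" if r: "r \<in> {s..t}" for r x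
  proof -
    have "(k r has_derivative (\<lambda>y. (1 / (\<epsilon> r)\<^sup>2) *\<^sub>R blinfun_apply (Df (r, x)) (0::real, y))) (at x)"
      unfolding k_def[abs_def] using Df(2) r by (intro has_derivative_scaleR_right) blast
    from divergence_eq[OF this] show ?thesis
      using \<epsilon>_nz[OF r] by (simp add: divf[OF r] sum_divide_distrib[symmetric])
  qed
  \<comment> \<open>Index 0 is the scaled drift, 1 and 2 are the scores; an indexed family allows
    all the limits to be selected at once.\<close>
  define h where "h i = (if i = 0 then k else if i = 1 then g1 else g2)" for i :: nat
  have hC: "C1_on ({s..t} \<times> UNIV) (\<lambda>(r, x). h i r x)" for i
    using k g1 g2 by (simp add: h_def)
  have "\<exists>B F. has_backward_integral M (\<bullet>) (\<lambda>r \<omega>. h i r (X r \<omega>)) X s t B \<and>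
      has_forward_integral M (\<bullet>) (\<lambda>r \<omega>. h i r (X r \<omega>)) X s t F \<and>
      (AE \<omega> in M. B \<omega> - F \<omega> = integral {s..t} (\<lambda>r. (\<epsilon> r)\<^sup>2 * divergence (h i r) (X r \<omega>)))" for i
    by (rule stochastic_integrals_exist[OF hC[of i]]) (intro exI conjI)
  then have "\<forall>i. \<exists>B F. has_backward_integral M (\<bullet>) (\<lambda>r \<omega>. h i r (X r \<omega>)) X s t B \<and>
      has_forward_integral M (\<bullet>) (\<lambda>r \<omega>. h i r (X r \<omega>)) X s t F \<and>
      (AE \<omega> in M. B \<omega> - F \<omega> = integral {s..t} (\<lambda>r. (\<epsilon> r)\<^sup>2 * divergence (h i r) (X r \<omega>)))"
    by blast
  then obtain B where "\<forall>i. \<exists>F. has_backward_integral M (\<bullet>) (\<lambda>r \<omega>. h i r (X r \<omega>)) X s t (B i) \<and>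
      has_forward_integral M (\<bullet>) (\<lambda>r \<omega>. h i r (X r \<omega>)) X s t F \<and>
      (AE \<omega> in M. B i \<omega> - F \<omega> = integral {s..t} (\<lambda>r. (\<epsilon> r)\<^sup>2 * divergence (h i r) (X r \<omega>)))"
    by (rule choice[THEN exE])
  then obtain F where BF_all: "\<forall>i. has_backward_integral M (\<bullet>) (\<lambda>r \<omega>. h i r (X r \<omega>)) X s t (B i) \<and>
      has_forward_integral M (\<bullet>) (\<lambda>r \<omega>. h i r (X r \<omega>)) X s t (F i) \<and>
      (AE \<omega> in M. B i \<omega> - F i \<omega> = integral {s..t} (\<lambda>r. (\<epsilon> r)\<^sup>2 * divergence (h i r) (X r \<omega>)))"
    by (rule choice[THEN exE])
  note B = BF_all[rule_format, THEN conjunct1]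
    and F = BF_all[rule_format, THEN conjunct2, THEN conjunct1]
    and BF = BF_all[rule_format, THEN conjunct2, THEN conjunct2]
  define l where "l = 1 / \<zeta>\<^sup>2"
  have ls: "(\<sigma> r)\<^sup>2 / (\<epsilon> r)\<^sup>2 = l" if "r \<in> {s..t}" for r
    using \<sigma>(2)[OF that] \<zeta> by (simp add: \<epsilon> l_def power_mult_distrib)
  define cc where "cc x y z i = (if i = 0 then x else if i = 1 then y else z)" for x y z :: real and i :: nat
  have bint: "AE \<omega> in M. backward_integral M (\<lambda>r \<omega>. (1 / (\<epsilon> r)\<^sup>2) *\<^sub>R \<nu> r (X r \<omega>)) X s t \<omega> = B 0 \<omega> + y * B 1 \<omega> + z * B 2 \<omega>"
    if "\<And>r x. r \<in> {s..t} \<Longrightarrow> (1 / (\<epsilon> r)\<^sup>2) *\<^sub>R \<nu> r x = k r x + y *\<^sub>R g1 r x + z *\<^sub>R g2 r x" for \<nu> y z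
    using backward_integral_lincomb[where H = "\<lambda>i r \<omega>. h i r (X r \<omega>)" and B = B and c = "cc 1 y z"
        and H' = "\<lambda>r \<omega>. (1 / (\<epsilon> r)\<^sup>2) *\<^sub>R \<nu> r (X r \<omega>)", OF interval B] that
    by (simp add: cc_def h_def)
  have fint: "AE \<omega> in M. forward_integral M (\<lambda>r \<omega>. (1 / (\<epsilon> r)\<^sup>2) *\<^sub>R \<mu> r (X r \<omega>)) X s t \<omega> = F 0 \<omega> + y * F 1 \<omega> + z * F 2 \<omega>"
    if "\<And>r x. r \<in> {s..t} \<Longrightarrow> (1 / (\<epsilon> r)\<^sup>2) *\<^sub>R \<mu> r x = k r x + y *\<^sub>R g1 r x + z *\<^sub>R g2 r x" for \<mu> y z
    using forward_integral_lincomb[where H = "\<lambda>i r \<omega>. h i r (X r \<omega>)" and B = F and c = "cc 1 y z"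
        and H' = "\<lambda>r \<omega>. (1 / (\<epsilon> r)\<^sup>2) *\<^sub>R \<mu> r (X r \<omega>)", OF interval F] that
    by (simp add: cc_def h_def)
  have plus: "((\<epsilon> r)\<^sup>2 + (\<sigma> r)\<^sup>2) / 2 / (\<epsilon> r)\<^sup>2 = (1 + l) / 2"
    and minus: "((\<epsilon> r)\<^sup>2 - (\<sigma> r)\<^sup>2) / 2 / (\<epsilon> r)\<^sup>2 = (1 - l) / 2" if "r \<in> {s..t}" for r
    using \<epsilon>_nz[OF that] by (simp_all add: ls[OF that, symmetric] field_simps)
  have \<nu>1': "(1 / (\<epsilon> r)\<^sup>2) *\<^sub>R \<nu>1 r x = k r x + (- ((1 + l) / 2)) *\<^sub>R g1 r x + 0 *\<^sub>R g2 r x" if "r \<in> {s..t}" for r x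
  proof -
    have "(1 / (\<epsilon> r)\<^sup>2) *\<^sub>R \<nu>1 r x = k r x - (((\<epsilon> r)\<^sup>2 + (\<sigma> r)\<^sup>2) / 2 / (\<epsilon> r)\<^sup>2) *\<^sub>R g1 r x"
      by (simp add: \<nu>1 k_def scaleR_diff_right)
    then show ?thesis unfolding plus[OF that] by simp
  qed
  have \<nu>2': "(1 / (\<epsilon> r)\<^sup>2) *\<^sub>R \<nu>2 r x = k r x + 0 *\<^sub>R g1 r x + (- ((1 + l) / 2)) *\<^sub>R g2 r x" if "r \<in> {s..t}" for r x
  proof -
    have "(1 / (\<epsilon> r)\<^sup>2) *\<^sub>R \<nu>2 r x = k r x - (((\<epsilon> r)\<^sup>2 + (\<sigma> r)\<^sup>2) / 2 / (\<epsilon> r)\<^sup>2) *\<^sub>R g2 r x"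
      by (simp add: \<nu>2 k_def scaleR_diff_right)
    then show ?thesis unfolding plus[OF that] by simp
  qed
  have \<mu>1': "(1 / (\<epsilon> r)\<^sup>2) *\<^sub>R \<mu>1 r x = k r x + ((1 - l) / 2) *\<^sub>R g1 r x + 0 *\<^sub>R g2 r x" if "r \<in> {s..t}" for r x
  proof -
    have "(1 / (\<epsilon> r)\<^sup>2) *\<^sub>R \<mu>1 r x = k r x + (((\<epsilon> r)\<^sup>2 - (\<sigma> r)\<^sup>2) / 2 / (\<epsilon> r)\<^sup>2) *\<^sub>R g1 r x"
      by (simp add: \<mu>1 k_def scaleR_add_right)
    then show ?thesis unfolding minus[OF that] by simp
  qed
  have \<mu>2': "(1 / (\<epsilon> r)\<^sup>2) *\<^sub>R \<mu>2 r x = k r x + 0 *\<^sub>R g1 r x + ((1 - l) / 2) *\<^sub>R g2 r x" if "r \<in> {s..t}" for r x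
  proof -
    have "(1 / (\<epsilon> r)\<^sup>2) *\<^sub>R \<mu>2 r x = k r x + (((\<epsilon> r)\<^sup>2 - (\<sigma> r)\<^sup>2) / 2 / (\<epsilon> r)\<^sup>2) *\<^sub>R g2 r x"
      by (simp add: \<mu>2 k_def scaleR_add_right)
    then show ?thesis unfolding minus[OF that] by simp
  qed
  have a': "(1 / (\<epsilon> r)\<^sup>2) *\<^sub>R a r x = k r x + (- (\<eta> * l)) *\<^sub>R g1 r x + (- (\<eta> * l)) *\<^sub>R g2 r x" if "r \<in> {s..t}" for r x
  proof -
    have "(1 / (\<epsilon> r)\<^sup>2) *\<^sub>R a r x = k r x - (\<eta> * ((\<sigma> r)\<^sup>2 / (\<epsilon> r)\<^sup>2)) *\<^sub>R (g1 r x + g2 r x)"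
      by (simp add: a k_def scaleR_diff_right)
    then show ?thesis unfolding ls[OF that] by (simp add: scaleR_add_right)
  qed
  have b_coeff: "(\<eta> * (\<sigma> r)\<^sup>2 - (\<epsilon> r)\<^sup>2 * \<beta>) / (\<epsilon> r)\<^sup>2 = \<eta> * l - \<beta>" if "r \<in> {s..t}" for r
    using \<epsilon>_nz[OF that] by (simp add: ls[OF that, symmetric] field_simps)
  have b': "(1 / (\<epsilon> r)\<^sup>2) *\<^sub>R b r x = k r x + (- (\<eta> * l - \<beta>)) *\<^sub>R g1 r x + (- (\<eta> * l - \<beta>)) *\<^sub>R g2 r x" if "r \<in> {s..t}" for r x
  proof -
    have "(1 / (\<epsilon> r)\<^sup>2) *\<^sub>R b r x = k r x - ((\<eta> * (\<sigma> r)\<^sup>2 - (\<epsilon> r)\<^sup>2 * \<beta>) / (\<epsilon> r)\<^sup>2) *\<^sub>R (g1 r x + g2 r x)"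
      by (simp add: b k_def scaleR_diff_right)
    then show ?thesis unfolding b_coeff[OF that] by (simp add: scaleR_add_right scaleR_left_diff_distrib)
  qed
  \<comment> \<open>The relation between \<eta>, \<beta> and \<zeta> divided by \<zeta>^2. It
    equates the score coefficients of the scaled proposal drifts with \<beta> times those of the
    scaled reversal drifts.\<close>
  have rel_l: "2 * \<eta> * l = \<beta> * (1 + l)"
    using \<zeta> rel by (simp add: l_def field_simps)
  have rel_\<sigma>: "2 * \<eta> * (\<sigma> r)\<^sup>2 = \<beta> * ((\<epsilon> r)\<^sup>2 + (\<sigma> r)\<^sup>2)" for r
    using rel by (simp add: \<epsilon> power_mult_distrib algebra_simps)
  have BF0: "AE \<omega> in M. B 0 \<omega> - F 0 \<omega> = integral {s..t} (\<lambda>r. divergence (f r) (X r \<omega>))"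
    using BF[of 0]
  proof eventually_elim
    case (elim \<omega>)
    also have "integral {s..t} (\<lambda>r. (\<epsilon> r)\<^sup>2 * divergence (h 0 r) (X r \<omega>)) = integral {s..t} (\<lambda>r. divergence (f r) (X r \<omega>))"
      by (intro Henstock_Kurzweil_Integration.integral_cong) (simp add: h_def divk)
    finally show ?case .
  qed
  have int_\<nu>1: "AE \<omega> in M. backward_integral M (\<lambda>r \<omega>. (1 / (\<epsilon> r)\<^sup>2) *\<^sub>R \<nu>1 r (X r \<omega>)) X s t \<omega>
      = B 0 \<omega> + (- ((1 + l) / 2)) * B 1 \<omega> + (0) * B 2 \<omega>"
    by (rule bint) (rule \<nu>1')
  have int_\<nu>2: "AE \<omega> in M. backward_integral M (\<lambda>r \<omega>. (1 / (\<epsilon> r)\<^sup>2) *\<^sub>R \<nu>2 r (X r \<omega>)) X s t \<omega>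
      = B 0 \<omega> + (0) * B 1 \<omega> + (- ((1 + l) / 2)) * B 2 \<omega>"
    by (rule bint) (rule \<nu>2')
  have int_a: "AE \<omega> in M. backward_integral M (\<lambda>r \<omega>. (1 / (\<epsilon> r)\<^sup>2) *\<^sub>R a r (X r \<omega>)) X s t \<omega>
      = B 0 \<omega> + (- (\<eta> * l)) * B 1 \<omega> + (- (\<eta> * l)) * B 2 \<omega>"
    by (rule bint) (rule a')
  have int_\<mu>1: "AE \<omega> in M. forward_integral M (\<lambda>r \<omega>. (1 / (\<epsilon> r)\<^sup>2) *\<^sub>R \<mu>1 r (X r \<omega>)) X s t \<omega>
      = F 0 \<omega> + ((1 - l) / 2) * F 1 \<omega> + (0) * F 2 \<omega>"
    by (rule fint) (rule \<mu>1')
  have int_\<mu>2: "AE \<omega> in M. forward_integral M (\<lambda>r \<omega>. (1 / (\<epsilon> r)\<^sup>2) *\<^sub>R \<mu>2 r (X r \<omega>)) X s t \<omega>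
      = F 0 \<omega> + (0) * F 1 \<omega> + ((1 - l) / 2) * F 2 \<omega>"
    by (rule fint) (rule \<mu>2')
  have int_b: "AE \<omega> in M. forward_integral M (\<lambda>r \<omega>. (1 / (\<epsilon> r)\<^sup>2) *\<^sub>R b r (X r \<omega>)) X s t \<omega>
      = F 0 \<omega> + (- (\<eta> * l - \<beta>)) * F 1 \<omega> + (- (\<eta> * l - \<beta>)) * F 2 \<omega>"
    by (rule fint) (rule b')
  show ?thesis
    using BF0 int_\<nu>1 int_\<nu>2 int_a int_\<mu>1 int_\<mu>2 int_b X_cont
  proof eventually_elim
    case (elim \<omega>)
    define f' where "f' r = f r (X r \<omega>)" for r
    define u1 where "u1 r = g1 r (X r \<omega>)" for r
    define u2 where "u2 r = g2 r (X r \<omega>)" for r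
    define dv where "dv r = divergence (f r) (X r \<omega>)" for r
    note contX = elim(8)
    have cf: "continuous_on {s..t} f'" "continuous_on {s..t} u1" "continuous_on {s..t} u2"
      unfolding f'_def u1_def u2_def
      using continuous_on_compose2[OF C1_on_imp_continuous_on[OF f] continuous_on_Pair[OF continuous_on_id contX]]
        continuous_on_compose2[OF C1_on_imp_continuous_on[OF g1] continuous_on_Pair[OF continuous_on_id contX]]
        continuous_on_compose2[OF C1_on_imp_continuous_on[OF g2] continuous_on_Pair[OF continuous_on_id contX]]
      by auto
    have c\<sigma>: "continuous_on {s..t} \<sigma>" by (rule C1_on_imp_continuous_on[OF \<sigma>(1)])
    have cdv: "continuous_on {s..t} dv"
    proof -
      have "continuous_on {s..t} (\<lambda>r. \<Sum>i\<in>Basis. blinfun_apply (Df (r, X r \<omega>)) (0, i) \<bullet> i)"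
        by (intro continuous_intros continuous_on_compose2[OF Df(1)] contX) auto
      then show ?thesis by (rule continuous_on_eq) (simp add: dv_def divf)
    qed
    define q1 where "q1 r = 2 * (f' r \<bullet> u1 r) - (\<sigma> r)\<^sup>2 * (u1 r \<bullet> u1 r)" for r
    define q2 where "q2 r = 2 * (f' r \<bullet> u2 r) - (\<sigma> r)\<^sup>2 * (u2 r \<bullet> u2 r)" for r
    define q3 where "q3 r = 2 * \<beta> * (f' r \<bullet> (u1 r + u2 r)) - \<beta>\<^sup>2 * (\<sigma> r)\<^sup>2 * ((u1 r + u2 r) \<bullet> (u1 r + u2 r))" for r
    have I1: "integral {s..t} (\<lambda>r. 1 / (\<epsilon> r)\<^sup>2 * ((norm (\<mu>1 r (X r \<omega>)))\<^sup>2 - (norm (\<nu>1 r (X r \<omega>)))\<^sup>2)) = integral {s..t} q1"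
      by (intro Henstock_Kurzweil_Integration.integral_cong)
        (simp only: \<mu>1 \<nu>1 q1_def f'_def u1_def reversal_drift_norm_difference[OF \<epsilon>_nz(1)])
    have I2: "integral {s..t} (\<lambda>r. 1 / (\<epsilon> r)\<^sup>2 * ((norm (\<mu>2 r (X r \<omega>)))\<^sup>2 - (norm (\<nu>2 r (X r \<omega>)))\<^sup>2)) = integral {s..t} q2"
      by (intro Henstock_Kurzweil_Integration.integral_cong)
        (simp only: \<mu>2 \<nu>2 q2_def f'_def u2_def reversal_drift_norm_difference[OF \<epsilon>_nz(1)])
    have I3: "integral {s..t} (\<lambda>r. 1 / (\<epsilon> r)\<^sup>2 * ((norm (b r (X r \<omega>)))\<^sup>2 - (norm (a r (X r \<omega>)))\<^sup>2)) = integral {s..t} q3"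
      by (intro Henstock_Kurzweil_Integration.integral_cong)
        (simp only: a b q3_def f'_def u1_def u2_def proposal_drift_norm_difference[OF \<epsilon>_nz(1) rel_\<sigma>])
    have int: "dv integrable_on {s..t}" "q1 integrable_on {s..t}" "q2 integrable_on {s..t}" "q3 integrable_on {s..t}"
      unfolding q1_def q2_def q3_def
      by (intro integrable_continuous_real continuous_intros cf c\<sigma> cdv)+
    have coeffs: "\<beta> * (- ((1 + l) / 2)) = - (\<eta> * l)" "\<beta> * ((1 - l) / 2) = - (\<eta> * l - \<beta>)"
      using rel_l by (simp_all add: field_simps)
    \<comment> \<open>Grouped by integral: the factors of the score integrals are zero by
      \<open>coeffs\<close>, and the drift integral occurs \<beta> + \<beta> - 1 times.\<close>
    have "ln (product_weight M \<epsilon> \<beta> \<nu>1 \<mu>1 \<nu>2 \<mu>2 a b X s t \<omega>) =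
       (2 * \<beta> - 1) * (B 0 \<omega> - F 0 \<omega>)
       + (\<beta> * (- ((1 + l) / 2)) + \<eta> * l) * (B 1 \<omega> + B 2 \<omega>)
       - (\<beta> * ((1 - l) / 2) + (\<eta> * l - \<beta>)) * (F 1 \<omega> + F 2 \<omega>)
       + \<beta> / 2 * integral {s..t} q1 + \<beta> / 2 * integral {s..t} q2 - 1 / 2 * integral {s..t} q3"
      unfolding ln_product_weight_eq path_ratio_def ln_exp elim(2-7) I1 I2 I3 by (simp add: algebra_simps)
    also have "\<dots> = (2 * \<beta> - 1) * integral {s..t} dv
       + \<beta> / 2 * integral {s..t} q1 + \<beta> / 2 * integral {s..t} q2 - 1 / 2 * integral {s..t} q3"
      unfolding elim(1) coeffs dv_def by simp
    also have "\<dots> = integral {s..t} (\<lambda>r. (2 * \<beta> - 1) * dv r + \<beta> / 2 * q1 r + \<beta> / 2 * q2 r - 1 / 2 * q3 r)"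
      by (intro integral_unique[symmetric] has_integral_add has_integral_diff has_integral_mult_right integrable_integral int)
    also have "\<dots> = integral {s..t} (\<lambda>r. (2 * \<beta> - 1) * divergence (f r) (X r \<omega>)
      + (\<sigma> r)\<^sup>2 * \<beta> * (g1 r (X r \<omega>) \<bullet> g2 r (X r \<omega>))
      + (\<sigma> r)\<^sup>2 / 2 * \<beta> * (\<beta> - 1) * (norm (g1 r (X r \<omega>) + g2 r (X r \<omega>)))\<^sup>2)"
    proof (rule Henstock_Kurzweil_Integration.integral_cong)
      fix r
      \<comment> \<open>The products of \<open>f'\<close> with the scores cancel. In what is left,
        |u1|^2 + |u2|^2 is |u1 + u2|^2 minus twice the inner product of \<open>u1\<close> and
        \<open>u2\<close>, which gives both remaining terms.\<close>
      have "(2 * \<beta> - 1) * dv r + \<beta> / 2 * q1 r + \<beta> / 2 * q2 r - 1 / 2 * q3 r = (2 * \<beta> - 1) * dv r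
        + (\<sigma> r)\<^sup>2 * \<beta> * (u1 r \<bullet> u2 r) + (\<sigma> r)\<^sup>2 / 2 * \<beta> * (\<beta> - 1) * (norm (u1 r + u2 r))\<^sup>2"
        unfolding q1_def q2_def q3_def power2_norm_eq_inner
        by (simp add: inner_add_left inner_add_right inner_commute power2_eq_square field_simps)
      then show "(2 * \<beta> - 1) * dv r + \<beta> / 2 * q1 r + \<beta> / 2 * q2 r - 1 / 2 * q3 r =
        (2 * \<beta> - 1) * divergence (f r) (X r \<omega>) + (\<sigma> r)\<^sup>2 * \<beta> * (g1 r (X r \<omega>) \<bullet> g2 r (X r \<omega>))
        + (\<sigma> r)\<^sup>2 / 2 * \<beta> * (\<beta> - 1) * (norm (g1 r (X r \<omega>) + g2 r (X r \<omega>)))\<^sup>2"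
        by (simp add: dv_def u1_def u2_def)
    qed
    finally show ?case .
  qed
qed

section \<open>The corrector and the backward equation of its weight\<close>

theorem propositionH4:
  fixes M :: "'w measure" and N1 :: "'v1 measure" and N2 :: "'v2 measure"
    and G :: "real \<Rightarrow> 'w measure" and F1 :: "real \<Rightarrow> 'v1 measure" and F2 :: "real \<Rightarrow> 'v2 measure"
    and W X :: "real \<Rightarrow> 'w \<Rightarrow> 'a::euclidean_space"
    and W1 Y1 :: "real \<Rightarrow> 'v1 \<Rightarrow> 'a" and W2 Y2 :: "real \<Rightarrow> 'v2 \<Rightarrow> 'a"
    and f a b \<mu>1 \<mu>2 \<nu>1 \<nu>2 :: "real \<Rightarrow> 'a \<Rightarrow> 'a" and p1 p2 :: "real \<Rightarrow> 'a \<Rightarrow> real"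
    and \<sigma> \<epsilon> :: "real \<Rightarrow> real" and T \<tau> \<tau>' \<beta> c \<eta> \<zeta> :: real
    and w :: "real \<Rightarrow> 'w \<Rightarrow> real" and rate :: "real \<Rightarrow> 'w \<Rightarrow> real"
  assumes times: "0 \<le> \<tau>" "\<tau> < \<tau>'" "\<tau>' \<le> T"
    and f_smooth: "C1_on ({0..T} \<times> UNIV) (\<lambda>(t, x). f t x)"
    and \<sigma>_smooth: "C1_on {0..T} \<sigma>"
    and \<sigma>_pos: "\<And>t. t \<in> {0..T} \<Longrightarrow> 0 < \<sigma> t"
    and model1: "forward_sde N1 F1 W1 f \<sigma> Y1 0 T"
    and model2: "forward_sde N2 F2 W2 f \<sigma> Y2 0 T"
    and marginal1: "\<And>t. t \<in> {\<tau>..\<tau>'} \<Longrightarrow> distributed N1 lborel (Y1 t) (\<lambda>x. ennreal (p1 t x))"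
    and marginal2: "\<And>t. t \<in> {\<tau>..\<tau>'} \<Longrightarrow> distributed N2 lborel (Y2 t) (\<lambda>x. ennreal (p2 t x))"
    and p1_pos: "\<And>t x. t \<in> {\<tau>..\<tau>'} \<Longrightarrow> 0 < p1 t x"
    and p2_pos: "\<And>t x. t \<in> {\<tau>..\<tau>'} \<Longrightarrow> 0 < p2 t x"
    and p1_smooth: "C1_on ({\<tau>..\<tau>'} \<times> UNIV) (\<lambda>(t, x). ln (p1 t x))"
      "C1_on ({\<tau>..\<tau>'} \<times> UNIV) (\<lambda>(t, x). grad (\<lambda>y. ln (p1 t y)) x)"
    and p2_smooth: "C1_on ({\<tau>..\<tau>'} \<times> UNIV) (\<lambda>(t, x). ln (p2 t x))"
      "C1_on ({\<tau>..\<tau>'} \<times> UNIV) (\<lambda>(t, x). grad (\<lambda>y. ln (p2 t y)) x)"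
    and target: "\<And>t. t \<in> {\<tau>..\<tau>'} \<Longrightarrow> integrable lborel (\<lambda>x. (p1 t x * p2 t x) powr \<beta>)"
    and \<beta>: "0 < \<beta>" and c: "c \<in> {0..1/2}"
    and \<eta>: "\<eta> = \<beta> + (1 - \<beta>) * c"
    and \<zeta>: "\<zeta> = sqrt (1 + (1 - \<beta>) * (2 * c / \<beta>))"
    and \<epsilon>: "\<And>t. \<epsilon> t = \<zeta> * \<sigma> t"
    and a: "\<And>t x. a t x = f t x -
      (\<eta> * (\<sigma> t)\<^sup>2) *\<^sub>R (grad (\<lambda>y. ln (p1 t y)) x + grad (\<lambda>y. ln (p2 t y)) x)"
    and b: "\<And>t x. b t x = f t x -
      (\<eta> * (\<sigma> t)\<^sup>2 - (\<epsilon> t)\<^sup>2 * \<beta>) *\<^sub>R (grad (\<lambda>y. ln (p1 t y)) x + grad (\<lambda>y. ln (p2 t y)) x)"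
    and \<mu>1: "\<mu>1 = reversal_forward_drift f \<sigma> \<epsilon> p1" and \<nu>1: "\<nu>1 = reversal_backward_drift f \<sigma> \<epsilon> p1"
    and \<mu>2: "\<mu>2 = reversal_forward_drift f \<sigma> \<epsilon> p2" and \<nu>2: "\<nu>2 = reversal_backward_drift f \<sigma> \<epsilon> p2"
    and w: "\<And>t. w t = product_weight M \<epsilon> \<beta> \<nu>1 \<mu>1 \<nu>2 \<mu>2 a b X t \<tau>'"
    and rate: "\<And>t \<omega>. rate t \<omega> =
      (2 * \<beta> - 1) * divergence (f t) (X t \<omega>)
      + (\<sigma> t)\<^sup>2 * \<beta> * (grad (\<lambda>y. ln (p1 t y)) (X t \<omega>) \<bullet> grad (\<lambda>y. ln (p2 t y)) (X t \<omega>))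
      + (\<sigma> t)\<^sup>2 / 2 * \<beta> * (\<beta> - 1) *
          (norm (grad (\<lambda>y. ln (p1 t y)) (X t \<omega>) + grad (\<lambda>y. ln (p2 t y)) (X t \<omega>)))\<^sup>2"
  shows
    "(backward_sampler M G W a \<epsilon> (product_target \<beta> p1 p2 \<tau>') X \<tau> \<tau>'
      \<longleftrightarrow>
      backward_sampler M G W
        (\<lambda>t x. f t x - (\<eta> * (\<sigma> t)\<^sup>2) *\<^sub>R grad (\<lambda>y. ln (p1 t y)) x
                     - (\<eta> * (\<sigma> t)\<^sup>2) *\<^sub>R grad (\<lambda>y. ln (p2 t y)) x)
        (\<lambda>t. \<zeta> * \<sigma> t) (product_target \<beta> p1 p2 \<tau>') X \<tau> \<tau>')
     \<and>
     (backward_sampler M G W a \<epsilon> (product_target \<beta> p1 p2 \<tau>') X \<tau> \<tau>' \<longrightarrow>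
        (\<forall>t\<in>{\<tau>..\<tau>'}. AE \<omega> in M. ln (w t \<omega>) = integral {t..\<tau>'} (\<lambda>r. rate r \<omega>)) \<and>
        (\<exists>L. (\<forall>t\<in>{\<tau>..\<tau>'}. AE \<omega> in M. L t \<omega> = ln (w t \<omega>)) \<and>
             (AE \<omega> in M. L \<tau>' \<omega> = 0 \<and>
                (\<forall>t\<in>{\<tau>..\<tau>'}. ((\<lambda>t. L t \<omega>) has_real_derivative - rate t \<omega>)
                   (at t within {\<tau>..\<tau>'})))))"
proof (intro conjI impI)
  \<comment> \<open>The two samplers have the same drift and diffusion coefficient as functions, so
    the equivalence is an equality of arguments.\<close>
  have drift: "a = (\<lambda>t x. f t x - (\<eta> * (\<sigma> t)\<^sup>2) *\<^sub>R grad (\<lambda>y. ln (p1 t y)) x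
                     - (\<eta> * (\<sigma> t)\<^sup>2) *\<^sub>R grad (\<lambda>y. ln (p2 t y)) x)"
    by (intro ext) (simp add: a scaleR_add_right)
  have "\<epsilon> = (\<lambda>t. \<zeta> * \<sigma> t)" by (intro ext) (rule \<epsilon>)
  with drift show "backward_sampler M G W a \<epsilon> (product_target \<beta> p1 p2 \<tau>') X \<tau> \<tau>'
      \<longleftrightarrow>
      backward_sampler M G W
        (\<lambda>t x. f t x - (\<eta> * (\<sigma> t)\<^sup>2) *\<^sub>R grad (\<lambda>y. ln (p1 t y)) x
                     - (\<eta> * (\<sigma> t)\<^sup>2) *\<^sub>R grad (\<lambda>y. ln (p2 t y)) x)
        (\<lambda>t. \<zeta> * \<sigma> t) (product_target \<beta> p1 p2 \<tau>') X \<tau> \<tau>'"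
    by simp
next
  assume sampler: "backward_sampler M G W a \<epsilon> (product_target \<beta> p1 p2 \<tau>') X \<tau> \<tau>'"
  define g1 where "g1 t x = grad (\<lambda>y. ln (p1 t y)) x" for t x
  define g2 where "g2 t x = grad (\<lambda>y. ln (p2 t y)) x" for t x
  have sub: "{\<tau>..\<tau>'} \<subseteq> {0..T}" using times by auto
  have f_C1: "C1_on ({\<tau>..\<tau>'} \<times> UNIV) (\<lambda>(t, x). f t x)"
    by (rule C1_on_subset[OF f_smooth]) (use sub in auto)
  have g1_C1: "C1_on ({\<tau>..\<tau>'} \<times> UNIV) (\<lambda>(t, x). g1 t x)"
    using p1_smooth(2) by (simp add: g1_def)
  have g2_C1: "C1_on ({\<tau>..\<tau>'} \<times> UNIV) (\<lambda>(t, x). g2 t x)"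
    using p2_smooth(2) by (simp add: g2_def)
  have \<sigma>_C1: "C1_on {\<tau>..\<tau>'} \<sigma>" by (rule C1_on_subset[OF \<sigma>_smooth sub])
  have \<sigma>_pos': "0 < \<sigma> t" if "t \<in> {\<tau>..\<tau>'}" for t using \<sigma>_pos that sub by blast
  \<comment> \<open>Multiplied by \<beta>, the radicand is \<beta> (1 - 2 c) + 2 c, a sum of
    nonnegative terms as c is at most 1/2; for c = 0 it equals \<beta>, otherwise the second term is
    positive.\<close>
  have \<zeta>2_pos: "0 < 1 + (1 - \<beta>) * (2 * c / \<beta>)"
  proof -
    have "0 < \<beta> * (1 - 2 * c) + 2 * c"
    proof (cases "c = 0")
      case False
      then have "0 < 2 * c" "0 \<le> \<beta> * (1 - 2 * c)" using c \<beta> by auto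
      then show ?thesis by linarith
    qed (use \<beta> in simp)
    then have "0 < (\<beta> * (1 - 2 * c) + 2 * c) / \<beta>" using \<beta> by simp
    also have "\<dots> = 1 + (1 - \<beta>) * (2 * c / \<beta>)" using \<beta> by (simp add: field_simps)
    finally show ?thesis .
  qed
  then have \<zeta>_pos: "0 < \<zeta>" and \<zeta>2: "\<zeta>\<^sup>2 = 1 + (1 - \<beta>) * (2 * c / \<beta>)"
    by (simp_all add: \<zeta>)
  \<comment> \<open>Here the formulas for \<eta> and \<zeta> meet: both sides equal 2 \<beta> + 2 (1
    - \<beta>) c.\<close>
  have rel: "2 * \<eta> = \<beta> * (\<zeta>\<^sup>2 + 1)"
    unfolding \<zeta>2 \<eta> using \<beta> by (simp add: field_simps)
  obtain L where L: "0 \<le> L" "\<And>x y. x \<in> {\<tau>..\<tau>'} \<Longrightarrow> y \<in> {\<tau>..\<tau>'} \<Longrightarrow> \<bar>\<sigma> x - \<sigma> y\<bar> \<le> L * \<bar>x - y\<bar>"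
    using C1_on_interval_lipschitz[OF \<sigma>_C1] by blast
  have \<epsilon>_lip: "\<bar>\<epsilon> x - \<epsilon> y\<bar> \<le> (\<zeta> * L) * \<bar>x - y\<bar>" if "x \<in> {\<tau>..\<tau>'}" "y \<in> {\<tau>..\<tau>'}" for x y
  proof -
    have "\<bar>\<epsilon> x - \<epsilon> y\<bar> = \<zeta> * \<bar>\<sigma> x - \<sigma> y\<bar>"
      using \<zeta>_pos by (simp add: \<epsilon> right_diff_distrib[symmetric] abs_mult)
    also have "\<dots> \<le> \<zeta> * (L * \<bar>x - y\<bar>)" using L(2)[OF that] \<zeta>_pos by (intro mult_left_mono) auto
    finally show ?thesis by (simp add: mult.assoc)
  qed
  have \<sigma>_cont: "continuous_on {\<tau>..\<tau>'} \<sigma>" by (rule C1_on_imp_continuous_on[OF \<sigma>_C1])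
  note conts = C1_on_imp_continuous_on[OF f_C1] C1_on_imp_continuous_on[OF g1_C1] C1_on_imp_continuous_on[OF g2_C1]
  have a_cont: "continuous_on ({\<tau>..\<tau>'} \<times> UNIV) (\<lambda>(t, x). a t x)"
  proof -
    have "continuous_on ({\<tau>..\<tau>'} \<times> UNIV) (\<lambda>z. (case z of (t, x) \<Rightarrow> f t x) -
        (\<eta> * (\<sigma> (fst z))\<^sup>2) *\<^sub>R ((case z of (t, x) \<Rightarrow> g1 t x) + (case z of (t, x) \<Rightarrow> g2 t x)))"
      by (intro continuous_on_diff continuous_on_add continuous_on_scaleR continuous_on_mult continuous_on_power
          continuous_on_const conts continuous_on_compose2[OF \<sigma>_cont] continuous_on_fst continuous_on_id) auto
    then show ?thesis by (simp add: a g1_def g2_def case_prod_beta')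
  qed
  have sde: "backward_sde M G W a \<epsilon> X \<tau> \<tau>'" using sampler by (simp add: backward_sampler_def)
  have "0 \<le> \<zeta> * L" using \<zeta>_pos L by simp
  then obtain C where "reversed_diffusion M G W X \<epsilon> \<tau> \<tau>' C"
    using backward_sde_imp_reversed_diffusion[OF sde _ a_cont \<epsilon>_lip] times by auto
  then interpret reversed_diffusion M G W X \<epsilon> \<tau> \<tau>' C .
  have AE_w: "AE \<omega> in M. ln (w t \<omega>) = integral {t..\<tau>'} (\<lambda>r. rate r \<omega>)" if t: "t \<in> {\<tau>..\<tau>'}" for t
  proof -
    interpret t: reversed_diffusion M G W X \<epsilon> t \<tau>' C
      using t by (intro subinterval) auto
    have t_sub: "{t..\<tau>'} \<subseteq> {\<tau>..\<tau>'}" "{t..\<tau>'} \<times> UNIV \<subseteq> {\<tau>..\<tau>'} \<times> (UNIV :: 'a set)" using t by auto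
    show ?thesis
      unfolding w rate g1_def[symmetric] g2_def[symmetric]
      by (rule t.ln_product_weight[OF C1_on_subset[OF f_C1 t_sub(2)] C1_on_subset[OF g1_C1 t_sub(2)]
            C1_on_subset[OF g2_C1 t_sub(2)] C1_on_subset[OF \<sigma>_C1 t_sub(1)] _ \<epsilon> \<zeta>_pos rel])
        (use t \<sigma>_pos' in \<open>auto simp: \<mu>1 \<mu>2 \<nu>1 \<nu>2 a b g1_def g2_def reversal_forward_drift_def reversal_backward_drift_def\<close>)
  qed
  show "\<forall>t\<in>{\<tau>..\<tau>'}. AE \<omega> in M. ln (w t \<omega>) = integral {t..\<tau>'} (\<lambda>r. rate r \<omega>)"
    using AE_w by blast
  obtain D where D: "continuous_on ({\<tau>..\<tau>'} \<times> UNIV) D"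
    "\<forall>r\<in>{\<tau>..\<tau>'}. \<forall>x. (f r has_derivative (\<lambda>y. blinfun_apply (D (r, x)) (0::real, y))) (at x)"
    using C1_on_time_space[OF f_C1] by blast
  have div: "divergence (f r) x = (\<Sum>i\<in>Basis. blinfun_apply (D (r, x)) (0::real, i) \<bullet> i)" if "r \<in> {\<tau>..\<tau>'}" for r x
    using D(2) that by (intro divergence_eq) blast
  \<comment> \<open>Continuity of the rate makes its time integral differentiable at every time,
    including both ends of the interval.\<close>
  have rate_cont: "AE \<omega> in M. continuous_on {\<tau>..\<tau>'} (\<lambda>r. rate r \<omega>)"
    using X_cont
  proof eventually_elim
    case (elim \<omega>)
    have "continuous_on {\<tau>..\<tau>'} (\<lambda>r. \<Sum>i\<in>Basis. blinfun_apply (D (r, X r \<omega>)) (0, i) \<bullet> i)"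
      by (intro continuous_intros continuous_on_compose2[OF D(1)] elim) auto
    then have "continuous_on {\<tau>..\<tau>'} (\<lambda>r. divergence (f r) (X r \<omega>))"
      by (rule continuous_on_eq) (simp add: div)
    moreover have "continuous_on {\<tau>..\<tau>'} (\<lambda>r. g1 r (X r \<omega>))" "continuous_on {\<tau>..\<tau>'} (\<lambda>r. g2 r (X r \<omega>))"
      using continuous_on_compose2[OF conts(2) continuous_on_Pair[OF continuous_on_id elim]]
        continuous_on_compose2[OF conts(3) continuous_on_Pair[OF continuous_on_id elim]] by auto
    ultimately show ?case
      unfolding rate g1_def[symmetric] g2_def[symmetric] by (intro continuous_intros \<sigma>_cont) auto
  qed
  \<comment> \<open>Each \<open>w t\<close> is fixed only up to a null set of its own, so its paths
    in \<open>t\<close> need not be differentiable. The pathwise integral of the rate is a version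
    whose paths almost surely are; the variable lower limit produces the minus sign and the value 0
    at \<open>\<tau>'\<close>.\<close>
  show "\<exists>L. (\<forall>t\<in>{\<tau>..\<tau>'}. AE \<omega> in M. L t \<omega> = ln (w t \<omega>)) \<and>
     (AE \<omega> in M. L \<tau>' \<omega> = 0 \<and>
        (\<forall>t\<in>{\<tau>..\<tau>'}. ((\<lambda>t. L t \<omega>) has_real_derivative - rate t \<omega>) (at t within {\<tau>..\<tau>'})))"
  proof (intro exI[of _ "\<lambda>t \<omega>. integral {t..\<tau>'} (\<lambda>r. rate r \<omega>)"] conjI ballI)
    show "AE \<omega> in M. integral {t..\<tau>'} (\<lambda>r. rate r \<omega>) = ln (w t \<omega>)" if "t \<in> {\<tau>..\<tau>'}" for t
      using AE_w[OF that] by eventually_elim simp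
    show "AE \<omega> in M. integral {\<tau>'..\<tau>'} (\<lambda>r. rate r \<omega>) = 0 \<and>
        (\<forall>t\<in>{\<tau>..\<tau>'}. ((\<lambda>t. integral {t..\<tau>'} (\<lambda>r. rate r \<omega>)) has_real_derivative - rate t \<omega>) (at t within {\<tau>..\<tau>'}))"
      using rate_cont
      by eventually_elim (auto intro: integral_has_real_derivative')
  qed
qed

end
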